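(* Let $\Sigma$ be a finite CW complex of dimension $d$, let $B$ be a bond of $\Sigma$, and let $A\subseteq\Sigma_d\setminus B$ be a set of $r-1$ facets whose columns in $\partial_d$ are linearly independent (so that for every $\sigma\in B$, $A\cup\sigma$ is a cellular spanning forest and $B=\operatorname{bond}(A\cup\sigma,\sigma)$). Fix $\sigma\in B$ and put $\Upsilon=A\cup\sigma$. Then $$\frac{1}{\mu_\Upsilon}\bar\chi(\Upsilon,\sigma)=\sum_{\rho\in B}\varepsilon^A_{\sigma,\rho}\,\mathbf{t}_{d-1}(A\cup\rho)\,\rho.$$ This vector lies in the cut space $\operatorname{Cut}_d(\Sigma)=\operatorname{im}_{\mathbb{R}}\partial_d^*$, has integer coefficients, and replacing $\sigma$ by another facet $\sigma'\in B$ changes it only by a sign.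
   Context: $\Sigma$ has the convention of a unique $(-1)$-cell (reduced homology); $\Sigma_i$ is the set of $i$-cells, $d$-cells are facets; cells are oriented, $\partial_d$ is the cellular boundary map, $\partial_d^*$ its transpose, $r=\operatorname{rank}\partial_d$; facets are identified with the standard basis of $C_d(\Sigma;\mathbb{R})$. Subcomplexes of dimension $d$ are assumed to contain the full $(d-1)$-skeleton and are identified with their facet sets. A cellular spanning forest (CSF) is such a subcomplex whose facets index a column basis of $\partial_d$ over $\mathbb{R}$. A bond is a minimal set of facets meeting the facet set of every CSF (a cocircuit of the matroid represented by the columns of $\partial_d$). For a CSF $\Upsilon$ and $\sigma\in\Upsilon$, $\operatorname{bond}(\Upsilon,\sigma)=\{\sigma\}\cup\{\rho\notin\Upsilon:\Upsilon\setminus\sigma\cup\rho\text{ is a CSF}\}$. $\mathbf{t}_i(X)=|\operatorname{tor}(\tilde H_i(X;\mathbb{Z}))|$ for a complex or pair $X$. A subcomplex $\Gamma\subseteq\Sigma$ of dimension $\le d-1$ with $\Gamma_{(d-2)}=\Sigma_{(d-2)}$ is relatively acyclic if inclusion induces isomorphisms $\tilde H_k(\Gamma;\mathbb{Q})\to\tilde H_k(\Sigma;\mathbb{Q})$ for all $k<d$. $\mu_\Upsilon=\mathbf{t}_{d-1}(\Upsilon)\sum_\Gamma\mathbf{t}_{d-1}(\Sigma,\Gamma)^2/\mathbf{t}_{d-1}(\Sigma)^2$, summed over all relatively acyclic $(d-1)$-subcomplexes $\Gamma$. For $\rho,\rho'\notin A$ with $A\cup\rho$, $A\cup\rho'$ CSFs,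 $\varepsilon^A_{\rho,\rho'}\in\{\pm1\}$ is $+1$ or $-1$ according as $\partial\rho,\partial\rho'$ lie on the same or opposite sides of the hyperplane in $\operatorname{im}_{\mathbb{R}}\partial_d$ spanned by $\{\partial\tau:\tau\in A\}$. With $L^{\mathrm{du}}=\partial_d^*\partial_d$ and $\Upsilon=\{\sigma_1,\dots,\sigma_r\}$, $\bar\chi(\Upsilon,\sigma)=\sum_{j=1}^r(-1)^j(\det L^{\mathrm{du}}_{\Upsilon\setminus\sigma,\Upsilon\setminus\sigma_j})L^{\mathrm{du}}\sigma_j$, where $L^{\mathrm{du}}_{X,Y}$ is the submatrix with rows $X$, columns $Y$ ordered by the indexing.
   Formalization: The displayed identity is proved with an extra factor (-1)^i on the right side, where σ = σ_i in the indexing of Υ; without it the identity fails for odd i (e.g. a single edge, r = 1, gives -σ on the left and +σ on the right). *)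

theory Defs
  imports
    "HOL-Homology.Homology"
    "HOL-Library.Function_Algebras"
    "HOL-Library.Disjoint_Sets"
    "Jordan_Normal_Form.Determinant"
begin

text \<open>Real-valued functions form a real vector space pointwise, so that \<^const>\<open>span\<close>,
  \<^const>\<open>dim\<close>, \<^const>\<open>closed_segment\<close> etc. apply to real cellular chains.\<close>

instantiation "fun" :: (type, real_vector) real_vector
begin

definition scaleR_fun :: "real \<Rightarrow> ('a \<Rightarrow> 'b) \<Rightarrow> 'a \<Rightarrow> 'b"
  where "scaleR_fun a f = (\<lambda>x. a *\<^sub>R f x)"

instance
  by standard (auto simp: scaleR_fun_def fun_eq_iff scaleR_add_right scaleR_add_left)

end


section \<open>Finite CW complexes\<close>

definition unit_disk :: "nat \<Rightarrow> (nat \<Rightarrow> real) topology"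
  where "unit_disk n = subtopology (Euclidean_space n) {x. (\<Sum>i<n. (x i)\<^sup>2) \<le> 1}"

definition open_disk :: "nat \<Rightarrow> (nat \<Rightarrow> real) set"
  where "open_disk n = {x \<in> topspace (unit_disk n). (\<Sum>i<n. (x i)\<^sup>2) < 1}"

text \<open>The boundary of the disk; it is empty for \<open>n = 0\<close>.\<close>

definition disk_boundary :: "nat \<Rightarrow> (nat \<Rightarrow> real) set"
  where "disk_boundary n = {x \<in> topspace (unit_disk n). (\<Sum>i<n. (x i)\<^sup>2) = 1}"

text \<open>A cell is represented by the corresponding open cell, a set of points of the space.\<close>

record 'a cell_structure =
  space_of :: "'a topology"
  open_cells :: "nat \<Rightarrow> 'a set set"
  char_map :: "'a set \<Rightarrow> (nat \<Rightarrow> real) \<Rightarrow> 'a"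

text \<open>The \<open>k\<close>-cells, including the conventional unique cell of dimension \<open>-1\<close>, which is
  represented by the empty set.\<close>

definition cells :: "'a cell_structure \<Rightarrow> int \<Rightarrow> 'a set set"
  where "cells K k = (if k = -1 then {{}} else if k < 0 then {} else open_cells K (nat k))"

text \<open>The \<open>k\<close>-skeleton as a set of cells; the corresponding subspace is its union.\<close>

definition skel :: "'a cell_structure \<Rightarrow> int \<Rightarrow> 'a set set"
  where "skel K k = (\<Union>j\<in>{-1..k}. cells K j)"

definition skel_space :: "'a cell_structure \<Rightarrow> int \<Rightarrow> 'a topology"
  where "skel_space K k = subtopology (space_of K) (\<Union>(skel K k))"

text \<open>Closure-finiteness and the weak topology are automatic, as there are finitely many cells.\<close>

definition finite_CW_complex :: "'a cell_structure \<Rightarrow> nat \<Rightarrow> bool"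
  where "finite_CW_complex K d \<longleftrightarrow>
    Hausdorff_space (space_of K) \<and>
    (\<forall>n. finite (open_cells K n)) \<and>
    open_cells K d \<noteq> {} \<and>
    (\<forall>n>d. open_cells K n = {}) \<and>
    disjoint_family (open_cells K) \<and>
    disjoint (\<Union>n. open_cells K n) \<and>
    \<Union>(\<Union>n. open_cells K n) = topspace (space_of K) \<and>
    (\<forall>n. \<forall>e \<in> open_cells K n.
       continuous_map (unit_disk n) (space_of K) (char_map K e) \<and>
       homeomorphic_map (subtopology (unit_disk n) (open_disk n))
         (subtopology (space_of K) e) (char_map K e) \<and>
       char_map K e ` disk_boundary n \<subseteq> \<Union>(skel K (int n - 1)))"


section \<open>The cellular chain complex\<close>

text \<open>A fixed generator of the infinite cyclic group \<open>H\<^sub>n(D\<^sup>n, S\<^sup>n\<^sup>-\<^sup>1)\<close>. A cell of positive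
  dimension is oriented by its characteristic map: precomposing the map with a reflection
  reverses the orientation.\<close>

definition disk_class :: "nat \<Rightarrow> (nat \<Rightarrow> real) chain set"
  where "disk_class n =
    (let G = relative_homology_group (int n) (unit_disk n) (disk_boundary n)
     in SOME g. g \<in> carrier G \<and> subgroup_generated G {g} = G)"

definition skel_group :: "'a cell_structure \<Rightarrow> int \<Rightarrow> 'a chain set monoid"
  where "skel_group K k = relative_homology_group k (skel_space K k) (\<Union>(skel K (k - 1)))"

text \<open>The basis element of \<open>H\<^sub>k(X\<^sub>k, X\<^sub>k\<^sub>-\<^sub>1)\<close> belonging to an oriented \<open>k\<close>-cell, for \<open>k \<ge> 0\<close>.\<close>

definition cell_class :: "'a cell_structure \<Rightarrow> int \<Rightarrow> 'a set \<Rightarrow> 'a chain set"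
  where "cell_class K k e =
    hom_induced k (unit_disk (nat k)) (disk_boundary (nat k))
      (skel_space K k) (\<Union>(skel K (k - 1))) (char_map K e) (disk_class (nat k))"

text \<open>\<open>incidence K k \<sigma> \<tau>\<close> is the coefficient of the \<open>(k-1)\<close>-cell \<open>\<tau>\<close> in the cellular boundary of
  the \<open>k\<close>-cell \<open>\<sigma>\<close>. For \<open>k \<ge> 1\<close> the boundary map is the connecting map
  \<open>H\<^sub>k(X\<^sub>k, X\<^sub>k\<^sub>-\<^sub>1) \<rightarrow> H\<^sub>k\<^sub>-\<^sub>1(X\<^sub>k\<^sub>-\<^sub>1, X\<^sub>k\<^sub>-\<^sub>2)\<close> of the triple, and for \<open>k = 0\<close> it is the augmentation.
  The homology groups are written multiplicatively.\<close>

definition incidence :: "'a cell_structure \<Rightarrow> int \<Rightarrow> 'a set \<Rightarrow> 'a set \<Rightarrow> int"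
  where "incidence K k \<sigma> =
    (if k < 0 then (\<lambda>\<tau>. 0)
     else if k = 0 then (\<lambda>\<tau>. if \<tau> = {} then 1 else 0)
     else (THE c. (\<forall>\<tau>. \<tau> \<notin> cells K (k - 1) \<longrightarrow> c \<tau> = 0) \<and>
       hom_relboundary k (skel_space K k) (\<Union>(skel K (k - 1))) (\<Union>(skel K (k - 2)))
           (cell_class K k \<sigma>) =
         finprod (skel_group K (k - 1))
           (\<lambda>\<tau>. cell_class K (k - 1) \<tau> [^]\<^bsub>skel_group K (k - 1)\<^esub> c \<tau>) (cells K (k - 1))))"

text \<open>\<open>chains K k Y\<close> consists of the \<open>k\<close>-chains supported on a set \<open>Y\<close> of cells, with
  coefficients in an arbitrary commutative ring.\<close>

definition chains :: "'a cell_structure \<Rightarrow> int \<Rightarrow> 'a set set \<Rightarrow> ('a set \<Rightarrow> 'r::comm_ring_1) set"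
  where "chains K k Y = {c. \<forall>\<sigma>. \<sigma> \<notin> cells K k \<inter> Y \<longrightarrow> c \<sigma> = 0}"

definition bdry :: "'a cell_structure \<Rightarrow> int \<Rightarrow> ('a set \<Rightarrow> 'r::comm_ring_1) \<Rightarrow> 'a set \<Rightarrow> 'r"
  where "bdry K k c = (\<lambda>\<tau>. \<Sum>\<sigma>\<in>cells K k. of_int (incidence K k \<sigma> \<tau>) * c \<sigma>)"

text \<open>The transpose of \<^term>\<open>bdry K k\<close>.\<close>

definition cobdry :: "'a cell_structure \<Rightarrow> int \<Rightarrow> ('a set \<Rightarrow> 'r::comm_ring_1) \<Rightarrow> 'a set \<Rightarrow> 'r"
  where "cobdry K k c = (\<lambda>\<sigma>. if \<sigma> \<in> cells K k
     then \<Sum>\<tau>\<in>cells K (k - 1). of_int (incidence K k \<sigma> \<tau>) * c \<tau> else 0)"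


section \<open>Cellular homology of complexes and pairs\<close>

text \<open>A subcomplex is identified with its set of cells. As the cell of dimension \<open>-1\<close> belongs to
  it, \<open>cell_homology K k Y {}\<close> is the reduced homology of \<open>Y\<close>, while \<open>cell_homology K k Y Z\<close> is
  the homology of the pair \<open>(Y, Z)\<close>.\<close>

definition rel_cycles :: "'a cell_structure \<Rightarrow> int \<Rightarrow> 'a set set \<Rightarrow> 'a set set
    \<Rightarrow> ('a set \<Rightarrow> 'r::comm_ring_1) monoid"
  where "rel_cycles K k Y Z =
    \<lparr>carrier = {c \<in> chains K k Y. bdry K k c \<in> chains K (k - 1) Z},
     monoid.mult = (+), one = 0\<rparr>"

definition rel_boundaries :: "'a cell_structure \<Rightarrow> int \<Rightarrow> 'a set set \<Rightarrow> 'a set set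
    \<Rightarrow> ('a set \<Rightarrow> 'r::comm_ring_1) set"
  where "rel_boundaries K k Y Z =
    {bdry K (k + 1) b + c |b c. b \<in> chains K (k + 1) Y \<and> c \<in> chains K k Z}"

definition cell_homology :: "'a cell_structure \<Rightarrow> int \<Rightarrow> 'a set set \<Rightarrow> 'a set set
    \<Rightarrow> ('a set \<Rightarrow> 'r::comm_ring_1) set monoid"
  where "cell_homology K k Y Z = rel_cycles K k Y Z Mod rel_boundaries K k Y Z"

text \<open>The order \<open>\<^bold>t\<^sub>k(Y, Z)\<close> of the torsion subgroup of integral homology.\<close>

definition torsion_order :: "'a cell_structure \<Rightarrow> int \<Rightarrow> 'a set set \<Rightarrow> 'a set set \<Rightarrow> nat"
  where "torsion_order K k Y Z =
    (let H = (cell_homology K k Y Z :: ('a set \<Rightarrow> int) set monoid)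
     in card {x \<in> carrier H. \<exists>m::nat. m > 0 \<and> x [^]\<^bsub>H\<^esub> m = \<one>\<^bsub>H\<^esub>})"

text \<open>The map on absolute homology induced by an inclusion \<open>Y \<subseteq> Y'\<close> sends the class of a cycle \<open>z\<close>
  modulo boundaries of \<open>Y\<close> to its class modulo boundaries of \<open>Y'\<close>.\<close>

definition incl_induced :: "'a cell_structure \<Rightarrow> int \<Rightarrow> 'a set set
    \<Rightarrow> ('a set \<Rightarrow> 'r::comm_ring_1) set \<Rightarrow> ('a set \<Rightarrow> 'r) set"
  where "incl_induced K k Y' C = C <#>\<^bsub>rel_cycles K k Y' {}\<^esub> rel_boundaries K k Y' {}"

definition relatively_acyclic :: "'a cell_structure \<Rightarrow> nat \<Rightarrow> 'a set set \<Rightarrow> bool"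
  where "relatively_acyclic K d \<Gamma> \<longleftrightarrow>
    skel K (int d - 2) \<subseteq> \<Gamma> \<and> \<Gamma> \<subseteq> skel K (int d - 1) \<and>
    (\<forall>k < int d. incl_induced K k (skel K d) \<in>
       iso (cell_homology K k \<Gamma> {} :: ('a set \<Rightarrow> rat) set monoid)
           (cell_homology K k (skel K d) {}))"


section \<open>Cellular spanning forests and bonds\<close>

definition facet_col :: "'a cell_structure \<Rightarrow> nat \<Rightarrow> 'a set \<Rightarrow> 'a set \<Rightarrow> real"
  where "facet_col K d \<sigma> = bdry K d (indicat_real {\<sigma>})"

definition bdry_rank :: "'a cell_structure \<Rightarrow> nat \<Rightarrow> nat"
  where "bdry_rank K d = dim (facet_col K d ` cells K d)"

text \<open>Linear independence as an indexed family, so that equal columns count as dependent.\<close>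

definition indep_cols :: "'a cell_structure \<Rightarrow> nat \<Rightarrow> 'a set set \<Rightarrow> bool"
  where "indep_cols K d S \<longleftrightarrow> inj_on (facet_col K d) S \<and> independent (facet_col K d ` S)"

definition CSF :: "'a cell_structure \<Rightarrow> nat \<Rightarrow> 'a set set \<Rightarrow> bool"
  where "CSF K d \<Upsilon> \<longleftrightarrow> \<Upsilon> \<subseteq> cells K d \<and> indep_cols K d \<Upsilon> \<and>
    span (facet_col K d ` \<Upsilon>) = span (facet_col K d ` cells K d)"

definition meets_all_CSF :: "'a cell_structure \<Rightarrow> nat \<Rightarrow> 'a set set \<Rightarrow> bool"
  where "meets_all_CSF K d B \<longleftrightarrow> (\<forall>\<Upsilon>. CSF K d \<Upsilon> \<longrightarrow> B \<inter> \<Upsilon> \<noteq> {})"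

definition is_bond :: "'a cell_structure \<Rightarrow> nat \<Rightarrow> 'a set set \<Rightarrow> bool"
  where "is_bond K d B \<longleftrightarrow> B \<subseteq> cells K d \<and> meets_all_CSF K d B \<and>
    (\<forall>C. C \<subset> B \<longrightarrow> \<not> meets_all_CSF K d C)"

definition fund_bond :: "'a cell_structure \<Rightarrow> nat \<Rightarrow> 'a set set \<Rightarrow> 'a set \<Rightarrow> 'a set set"
  where "fund_bond K d \<Upsilon> \<sigma> =
    {\<sigma>} \<union> {\<rho> \<in> cells K d - \<Upsilon>. CSF K d (insert \<rho> (\<Upsilon> - {\<sigma>}))}"

text \<open>Two vectors off the hyperplane lie on the same side of it iff the segment joining them
  does not meet it.\<close>

definition side_sign :: "'a cell_structure \<Rightarrow> nat \<Rightarrow> 'a set set \<Rightarrow> 'a set \<Rightarrow> 'a set \<Rightarrow> real"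
  where "side_sign K d A \<rho> \<rho>' =
    (if closed_segment (facet_col K d \<rho>) (facet_col K d \<rho>') \<inter> span (facet_col K d ` A) = {}
     then 1 else -1)"

text \<open>The torsion order \<open>\<^bold>t\<^sub>d\<^sub>-\<^sub>1\<close> of the \<open>d\<close>-dimensional subcomplex with facet set \<open>\<Upsilon>\<close> and full
  codimension-one skeleton.\<close>

definition facet_torsion :: "'a cell_structure \<Rightarrow> nat \<Rightarrow> 'a set set \<Rightarrow> nat"
  where "facet_torsion K d \<Upsilon> = torsion_order K (int d - 1) (skel K (int d - 1) \<union> \<Upsilon>) {}"

definition mu :: "'a cell_structure \<Rightarrow> nat \<Rightarrow> 'a set set \<Rightarrow> real"
  where "mu K d \<Upsilon> = real (facet_torsion K d \<Upsilon>) *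
    (\<Sum>\<Gamma> | relatively_acyclic K d \<Gamma>.
       (real (torsion_order K (int d - 1) (skel K d) \<Gamma>))\<^sup>2 /
       (real (torsion_order K (int d - 1) (skel K d) {}))\<^sup>2)"

definition cut_space :: "'a cell_structure \<Rightarrow> nat \<Rightarrow> ('a set \<Rightarrow> real) set"
  where "cut_space K d = cobdry K d ` chains K (int d - 1) (skel K d)"

definition laplacian :: "'a cell_structure \<Rightarrow> nat \<Rightarrow> ('a set \<Rightarrow> real) \<Rightarrow> 'a set \<Rightarrow> real"
  where "laplacian K d c = cobdry K d (bdry K d c)"

text \<open>The submatrix with rows \<open>xs\<close> and columns \<open>ys\<close>, in the order of the lists.\<close>

definition lap_submatrix :: "'a cell_structure \<Rightarrow> nat \<Rightarrow> 'a set list \<Rightarrow> 'a set list \<Rightarrow> real mat"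
  where "lap_submatrix K d xs ys = mat (length xs) (length ys)
    (\<lambda>(a, b). laplacian K d (indicat_real {ys ! b}) (xs ! a))"

text \<open>The vector depends on the indexing of the forest, so the latter is given as the list
  \<open>[\<sigma>\<^sub>1, \<dots>, \<sigma>\<^sub>r]\<close>; note that \<open>\<sigma>\<^sub>j\<close> is \<open>\<Upsilon> ! (j - 1)\<close>.\<close>

definition chi_bar :: "'a cell_structure \<Rightarrow> nat \<Rightarrow> 'a set list \<Rightarrow> 'a set \<Rightarrow> 'a set \<Rightarrow> real"
  where "chi_bar K d \<Upsilon> \<sigma> =
    (\<Sum>j = 1..length \<Upsilon>.
      ((-1) ^ j * Determinant.det
        (lap_submatrix K d (remove1 \<sigma> \<Upsilon>) (remove1 (\<Upsilon> ! (j - 1)) \<Upsilon>))) *\<^sub>R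
      laplacian K d (indicat_real {\<Upsilon> ! (j - 1)}))"

end

(*
Let D be the matrix of the top boundary map d. Every facet rho satisfies
d(rho) = lam(rho) d(sigma) + (a combination of the d(tau), tau in A); it lies in the bond iff lam(rho)
is nonzero, and the sign of lam(rho) tells on which side of the hyperplane d(rho) lies. A Laplace
expansion turns the coefficient of chi_bar at rho into the Gram determinant of A, sigma in which one
copy of sigma is replaced by rho; by linearity this is lam(rho) times the Gram determinant of the
forest. Cauchy--Binet writes the latter as a sum of squared maximal minors of D. The absolute value of
a nonsingular minor is the index of a lattice; comparing this lattice with the saturation of the column
lattice factors the index into the torsion of the forest and the torsion of a pair (Sigma, Gamma),
where Gamma is the complement of the rows used. The same factorisation for the forests A + sigma and
A + rho shows |lam(rho)| = t(A + rho) / t(A + sigma).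

That torsion and acyclicity can be read off from D requires that the incidence numbers form a chain
complex. For this one shows, attaching one cell at a time, that the classes of the k-cells freely
generate the relative homology of the k-skeleton modulo the (k-1)-skeleton: the characteristic map
induces an isomorphism by a radial expansion followed by excision.
*)
theory Submission
  imports Defs
begin

section \<open>Attaching a cell\<close>

text \<open>Torsion orders become indices in the lattice Z^R of integer chains on the set R of
  ridges, the (d-1)-cells. Let L be generated by all columns of D, let L_Y be generated by those of
  the forest Y, and let S be the saturation of L. Then t(Y) = [S : L_Y], t(Sigma) = [S : L], and for
  relatively acyclic Gamma t(Sigma, Gamma) is the finite index in Z^R of the sum of L and the chains
  on ridges of Gamma. With p the projection to the rows of a nonsingular minor, its absolute value
  is [Z^r : p S] [S : L_Y], so rows and columns contribute separately.

  Since mu already contains one factor t(Y), the Gram determinant is t(Y) mu(Y), and division by mu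
  leaves lam(rho) t(Y), which up to sign is an integer torsion order.

  The vector chi_bar is defined with the sign (-1)^j, while a cofactor in row i has the sign
  (-1)^(i+j). The identity therefore carries a factor (-1)^i, with i the position of sigma in the
  indexing.

  Incidence numbers are given by a description operator; their defining equation is available only
  once the cell classes are known to form a basis.\<close>

definition dnorm :: "nat \<Rightarrow> (nat \<Rightarrow> real) \<Rightarrow> real"
  where "dnorm n x = sqrt (\<Sum>i<n. (x i)\<^sup>2)"

lemma unit_disk_eq: "unit_disk n = top_of_set {x. (\<forall>i\<ge>n. x i = 0) \<and> dnorm n x \<le> 1}"
  by (simp add: unit_disk_def Euclidean_space_def euclidean_product_topology
      subtopology_subtopology dnorm_def Collect_conj_eq)

lemma topspace_unit_disk: "topspace (unit_disk n) = {x. (\<forall>i\<ge>n. x i = 0) \<and> dnorm n x \<le> 1}"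
  by (simp add: unit_disk_eq)

lemma disk_boundary_eq: "disk_boundary n = {x. (\<forall>i\<ge>n. x i = 0) \<and> dnorm n x = 1}"
  by (auto simp: disk_boundary_def topspace_unit_disk dnorm_def)

lemma open_disk_eq: "open_disk n = {x. (\<forall>i\<ge>n. x i = 0) \<and> dnorm n x < 1}"
  by (auto simp: open_disk_def topspace_unit_disk dnorm_def)

lemma disk_diff_boundary: "topspace (unit_disk n) - disk_boundary n = open_disk n"
  by (auto simp: topspace_unit_disk disk_boundary_eq open_disk_eq)

lemma open_disk_subset: "open_disk n \<subseteq> topspace (unit_disk n)"
  by (auto simp: open_disk_eq topspace_unit_disk)

lemma dnorm_nonneg [simp]: "dnorm n x \<ge> 0"
  by (simp add: dnorm_def sum_nonneg)

lemma dnorm_divide: "c > 0 \<Longrightarrow> dnorm n (\<lambda>i. x i / c) = dnorm n x / c"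
  by (simp add: dnorm_def power_divide real_sqrt_divide flip: sum_divide_distrib)

lemma dnorm_scale: "c \<ge> 0 \<Longrightarrow> dnorm n (\<lambda>i. c * x i) = c * dnorm n x"
  by (simp add: dnorm_def power_mult_distrib real_sqrt_mult flip: sum_distrib_left)

lemma continuous_on_coordinate:
  fixes g :: "'b::topological_space \<Rightarrow> 'i \<Rightarrow> 'c::topological_space"
  shows "continuous_on S g \<Longrightarrow> continuous_on S (\<lambda>x. g x i)"
  by (rule continuous_on_product_then_coordinatewise)

lemma continuous_on_dnorm [continuous_intros]:
  "continuous_on S g \<Longrightarrow> continuous_on S (\<lambda>x. dnorm n (g x))"
  unfolding dnorm_def
  by (intro continuous_on_real_sqrt continuous_on_sum continuous_on_power, rule continuous_on_coordinate)

lemma abs_le_dnorm: "i < n \<Longrightarrow> \<bar>x i\<bar> \<le> dnorm n x"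
  unfolding dnorm_def
  using real_sqrt_le_mono[OF member_le_sum[of i "{..<n}" "\<lambda>i. (x i)\<^sup>2"]] by simp

text \<open>Points are infinite sequences in the product topology, so Tychonoff replaces
  Heine-Borel: the disk is a closed subset of a cube with all coordinates in [-1,1].\<close>

lemma compact_space_unit_disk: "compact_space (unit_disk n)"
proof -
  let ?C = "{x::nat \<Rightarrow> real. (\<forall>i\<ge>n. x i = 0) \<and> dnorm n x \<le> 1}"
  have "compactin (product_topology (\<lambda>i::nat. euclidean) UNIV) (PiE UNIV (\<lambda>i. {-1..1::real}))"
    by (subst compactin_PiE) (simp add: compactin_euclidean_iff)
  then have "compact (PiE (UNIV::nat set) (\<lambda>i. {-1..1::real}))"
    by (simp add: euclidean_product_topology compactin_euclidean_iff)
  moreover have "closed ?C"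
  proof -
    have "closed {x::nat \<Rightarrow> real. x i = 0}" for i
      by (intro closed_Collect_eq continuous_on_const, rule continuous_on_coordinate[OF continuous_on_id])
    moreover have "closed {x. dnorm n x \<le> 1}"
      by (intro closed_Collect_le continuous_on_dnorm continuous_on_id continuous_on_const)
    moreover have "?C = (\<Inter>i\<in>{n..}. {x. x i = 0}) \<inter> {x. dnorm n x \<le> 1}"
      by auto
    ultimately show ?thesis
      by (simp add: closed_INT closed_Int)
  qed
  moreover have "?C \<subseteq> PiE UNIV (\<lambda>i. {-1..1::real})"
  proof
    fix x assume x: "x \<in> ?C"
    have "\<bar>x i\<bar> \<le> 1" for i
      using x abs_le_dnorm[of i n x] by (cases "i < n") auto
    then show "x \<in> PiE UNIV (\<lambda>i. {-1..1::real})" by (auto simp: abs_le_iff minus_le_iff)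
  qed
  ultimately have "compact ?C"
    using compact_Int_closed[of "PiE UNIV (\<lambda>i. {-1..1::real})" ?C] by (simp add: Int_absorb1)
  then show ?thesis
    by (simp add: unit_disk_eq compact_space_subtopology)
qed

lemma Hausdorff_space_unit_disk: "Hausdorff_space (unit_disk n)"
  by (simp add: unit_disk_eq Hausdorff_space_subtopology)

text \<open>The homotopy expands the disk radially: it fixes the boundary throughout and ends with a
  map that sends all points of norm at least one half to the boundary.\<close>

definition expand :: "nat \<Rightarrow> real \<Rightarrow> (nat \<Rightarrow> real) \<Rightarrow> nat \<Rightarrow> real"
  where "expand n t x = (\<lambda>i. x i / max (1 / (1 + t)) (dnorm n x))"

lemma dnorm_expand:
  "t \<ge> 0 \<Longrightarrow> dnorm n (expand n t x) = dnorm n x / max (1 / (1 + t)) (dnorm n x)"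
  unfolding expand_def by (rule dnorm_divide) (simp add: less_max_iff_disj)

lemma dnorm_expand_le_1: "t \<ge> 0 \<Longrightarrow> dnorm n (expand n t x) \<le> 1"
  by (simp add: dnorm_expand divide_le_eq_1 less_max_iff_disj)

text \<open>The divisor in \<open>expand\<close> is at most 1 on the disk, so no point moves
  inwards. Hence the collar of points of norm above 1/2 is preserved at all times.\<close>

lemma dnorm_expand_ge: 
  assumes "t \<ge> 0" "dnorm n x \<le> 1" shows "dnorm n x \<le> dnorm n (expand n t x)"
proof -
  have "max (1 / (1 + t)) (dnorm n x) \<le> 1" "max (1 / (1 + t)) (dnorm n x) > 0"
    using assms by (auto simp: less_max_iff_disj)
  then show ?thesis
    using assms by (simp add: dnorm_expand le_divide_eq mult_left_le)
qed

lemma expand_0: "dnorm n x \<le> 1 \<Longrightarrow> expand n 0 x = x"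
  by (simp add: expand_def max_def)

lemma expand_boundary: "t \<ge> 0 \<Longrightarrow> dnorm n x = 1 \<Longrightarrow> expand n t x = x"
  by (simp add: expand_def max_def)

lemma dnorm_expand_1: "dnorm n x > 1/2 \<Longrightarrow> dnorm n (expand n 1 x) = 1"
  by (simp add: dnorm_expand)

lemma continuous_map_expand:
  "continuous_map (prod_topology (top_of_set {0..1}) (unit_disk n)) (unit_disk n)
     (\<lambda>(t, x). expand n t x)"
proof -
  have "continuous_on ({0..1} \<times> {x. (\<forall>i\<ge>n. x i = 0) \<and> dnorm n x \<le> 1})
     (\<lambda>p. expand n (fst p) (snd p))"
    unfolding expand_def
  proof (rule continuous_on_coordinatewise_then_product)
    fix i
    have "max (1 / (1 + fst p)) (dnorm n (snd p)) \<noteq> 0"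
      if "p \<in> {0..1} \<times> {x. (\<forall>i\<ge>n. x i = 0) \<and> dnorm n x \<le> 1}" for p :: "real \<times> (nat \<Rightarrow> real)"
      using that by (auto simp: max_def)
    moreover have "1 + fst p \<noteq> 0"
      if "p \<in> {0..1} \<times> {x. (\<forall>i\<ge>n. x i = 0) \<and> dnorm n x \<le> 1}" for p :: "real \<times> (nat \<Rightarrow> real)"
      using that by auto
    ultimately show "continuous_on ({0..1} \<times> {x. (\<forall>i\<ge>n. x i = 0) \<and> dnorm n x \<le> 1})
      (\<lambda>p. snd p i / max (1 / (1 + fst p)) (dnorm n (snd p)))"
      by (intro continuous_on_divide continuous_on_max continuous_on_coordinate[OF continuous_on_snd]
          continuous_on_dnorm continuous_on_snd continuous_on_fst continuous_on_add
          continuous_on_const continuous_on_id) auto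
  qed
  moreover have "expand n t x i = 0" if "x i = 0" for t x i
    using that by (simp add: expand_def)
  ultimately show ?thesis
    by (auto simp: unit_disk_eq prod_topology_subtopology_eu case_prod_unfold dnorm_expand_le_1)
qed

text \<open>Instead of a quotient topology, compactness of the disk and the Hausdorff property of
  \<open>X\<close> are used: they make \<open>\<phi>\<close> a closed map, which together with
  closedness of \<open>Y\<close> suffices for gluing.\<close>

locale cell_attachment =
  fixes X :: "'a topology" and Y :: "'a set" and n :: nat and \<phi> :: "(nat \<Rightarrow> real) \<Rightarrow> 'a"
  assumes Hausdorff: "Hausdorff_space X"
    and closed_base: "closedin X Y"
    and cont: "continuous_map (unit_disk n) X \<phi>"
    and boundary: "\<phi> ` disk_boundary n \<subseteq> Y"
    and homeo: "homeomorphic_map (subtopology (unit_disk n) (open_disk n))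
                  (subtopology X (topspace X - Y)) \<phi>"
begin

lemma base_subset: "Y \<subseteq> topspace X"
  using closed_base closedin_subset by blast

lemma image_open_disk: "\<phi> ` open_disk n = topspace X - Y"
  using homeomorphic_imp_surjective_map[OF homeo] open_disk_subset
  by (simp add: Int_absorb1 Int_absorb2 Diff_subset)

lemma inj_open_disk: "inj_on \<phi> (open_disk n)"
  using homeomorphic_imp_injective_map[OF homeo] open_disk_subset
  by (simp add: Int_absorb1)

lemma disk_cases:
  assumes "z \<in> topspace (unit_disk n)"
  obtains "z \<in> disk_boundary n" "\<phi> z \<in> Y" | "z \<in> open_disk n" "\<phi> z \<notin> Y" "\<phi> z \<in> topspace X"
  using assms disk_diff_boundary[of n] boundary image_open_disk by blast

text \<open>The radial expansion transported to \<open>X\<close>. The map \<open>\<phi>\<close> is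
  inverted only on the open disk; as \<open>expand\<close> fixes the boundary, the result is still
  compatible with \<open>\<phi>\<close> on the closed disk, see
  \<open>homotopy_cell\<close>.\<close>

definition homotopy :: "real \<Rightarrow> 'a \<Rightarrow> 'a"
  where "homotopy t x = (if x \<in> Y then x else \<phi> (expand n t (inv_into (open_disk n) \<phi> x)))"

lemma homotopy_cell:
  assumes "z \<in> topspace (unit_disk n)" "t \<ge> 0"
  shows "homotopy t (\<phi> z) = \<phi> (expand n t z)"
  using assms(1)
proof (cases rule: disk_cases)
  case 1
  then show ?thesis using assms by (simp add: homotopy_def expand_boundary disk_boundary_eq)
next
  case 2
  then show ?thesis by (simp add: homotopy_def inv_into_f_f inj_open_disk)
qed

lemma homotopy_base: "x \<in> Y \<Longrightarrow> homotopy t x = x"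
  by (simp add: homotopy_def)

lemma space_cases:
  assumes "x \<in> topspace X"
  obtains "x \<in> Y" | z where "z \<in> open_disk n" "z \<in> topspace (unit_disk n)" "x = \<phi> z" "x \<notin> Y"
  using assms image_open_disk open_disk_subset by blast

lemma expand_in_disk:
  assumes "z \<in> topspace (unit_disk n)" "t \<ge> 0"
  shows "expand n t z \<in> topspace (unit_disk n)"
  using assms by (simp add: topspace_unit_disk dnorm_expand_le_1) (simp add: expand_def)

lemma homotopy_in_space:
  assumes "x \<in> topspace X" "t \<ge> 0" shows "homotopy t x \<in> topspace X"
  using assms(1)
proof (cases rule: space_cases)
  case 1
  then show ?thesis using assms by (simp add: homotopy_base)
next
  case (2 z)
  then show ?thesis
    using expand_in_disk[of z t] assms continuous_map_image_subset_topspace[OF cont]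
    by (auto simp: homotopy_cell)
qed

lemma closedin_image_disk:
  assumes "closedin (unit_disk n) C" shows "closedin X (\<phi> ` C)"
  using assms cont compact_space_unit_disk Hausdorff
  by (meson closedin_compact_space compactin_imp_closedin image_compactin)

text \<open>The preimage of a closed set is a cylinder over a closed part of \<open>Y\<close>
  together with the image of a closed subset of the compact product of interval and disk. The latter
  is compact in a Hausdorff space and hence closed.\<close>

lemma continuous_map_homotopy:
  "continuous_map (prod_topology (top_of_set {0..1}) X) X (\<lambda>(t, x). homotopy t x)"
proof -
  let ?I = "top_of_set {0..1::real}"
  let ?ID = "prod_topology ?I (unit_disk n)" and ?IX = "prod_topology ?I X"
  have "closedin ?IX {p \<in> topspace ?IX. (\<lambda>(t, x). homotopy t x) p \<in> C}" if C: "closedin X C" for C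
  proof -
    have "closedin ?ID {p \<in> topspace ?ID. (\<lambda>(t, z). \<phi> (expand n t z)) p \<in> C}" (is "closedin _ ?S")
    proof (rule closedin_continuous_map_preimage[OF _ C])
      show "continuous_map ?ID X (\<lambda>(t, z). \<phi> (expand n t z))"
        using continuous_map_compose[OF continuous_map_expand cont]
        by (simp add: o_def case_prod_unfold)
    qed
    then have "compactin ?ID ?S"
      using compact_space_unit_disk
      by (intro closedin_compact_space) (auto simp: compact_space_prod_topology compact_space_subtopology)
    moreover have "continuous_map ?ID ?IX (\<lambda>(t, z). (t, \<phi> z))"
      using continuous_map_compose[OF continuous_map_snd cont]
      by (simp add: case_prod_unfold continuous_map_paired continuous_map_fst o_def)
    moreover have "Hausdorff_space ?IX"
      using Hausdorff by (simp add: Hausdorff_space_prod_topology Hausdorff_space_subtopology)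
    ultimately have "closedin ?IX ((\<lambda>(t, z). (t, \<phi> z)) ` ?S)"
      using image_compactin compactin_imp_closedin by blast
    moreover have "closedin ?IX ({0..1} \<times> (Y \<inter> C))"
      using closed_base C by (simp add: closedin_prod_Times_iff closedin_Int)
    moreover have "{p \<in> topspace ?IX. (\<lambda>(t, x). homotopy t x) p \<in> C} =
        {0..1} \<times> (Y \<inter> C) \<union> (\<lambda>(t, z). (t, \<phi> z)) ` ?S" (is "?L = ?R")
    proof
      show "?L \<subseteq> ?R"
      proof
        fix p assume "p \<in> ?L"
        then obtain t x where p: "p = (t, x)"
          and tx: "0 \<le> t" "t \<le> 1" "x \<in> topspace X" "homotopy t x \<in> C"
          by auto
        show "p \<in> ?R"
          using tx(3)
        proof (cases rule: space_cases)
          case 1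
          then show ?thesis using tx p by (simp add: homotopy_base)
        next
          case (2 z)
          then have "(t, z) \<in> ?S" using tx by (simp add: homotopy_cell)
          then show ?thesis using 2 p by (intro UnI2 image_eqI[of _ _ "(t, z)"]) auto
        qed
      qed
      show "?R \<subseteq> ?L"
        using base_subset continuous_map_image_subset_topspace[OF cont]
        by (auto simp: homotopy_base homotopy_cell)
    qed
    ultimately show ?thesis
      by (simp add: closedin_Un)
  qed
  then show ?thesis
    unfolding continuous_map_closedin
    by (auto simp: homotopy_in_space)
qed

text \<open>The bound 1/2 is the value of \<open>1 / (1 + t)\<close> at time 1, so the end of the
  homotopy pushes this open neighbourhood of \<open>Y\<close> into \<open>Y\<close>.\<close>

definition nbhd :: "'a set"
  where "nbhd = topspace X - \<phi> ` {z \<in> topspace (unit_disk n). dnorm n z \<le> 1/2}"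

lemma cell_in_nbhd:
  assumes "z \<in> topspace (unit_disk n)"
  shows "\<phi> z \<in> nbhd \<longleftrightarrow> dnorm n z > 1/2"
  using assms
proof (cases rule: disk_cases)
  case 1
  have "\<phi> z \<noteq> \<phi> w" if "w \<in> topspace (unit_disk n)" "dnorm n w \<le> 1/2" for w
    using 1 that image_open_disk by (force simp: open_disk_eq topspace_unit_disk)
  then show ?thesis
    using 1 base_subset by (auto simp: nbhd_def disk_boundary_eq)
next
  case 2
  have "z = w" if "w \<in> topspace (unit_disk n)" "dnorm n w \<le> 1/2" "\<phi> z = \<phi> w" for w
    using 2 that inj_open_disk by (auto simp: open_disk_eq topspace_unit_disk inj_on_def)
  then have "\<phi> z \<in> \<phi> ` {w \<in> topspace (unit_disk n). dnorm n w \<le> 1/2} \<longleftrightarrow> dnorm n z \<le> 1/2"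
    using assms by blast
  then show ?thesis
    using 2 by (simp add: nbhd_def not_le)
qed

lemma base_subset_nbhd: "Y \<subseteq> nbhd"
proof
  fix y assume y: "y \<in> Y"
  have "\<phi> w \<notin> Y" if "w \<in> topspace (unit_disk n)" "dnorm n w \<le> 1/2" for w
    using that image_open_disk by (force simp: open_disk_eq topspace_unit_disk)
  then show "y \<in> nbhd" using y base_subset by (auto simp: nbhd_def)
qed

lemma openin_nbhd: "openin X nbhd"
proof -
  have "continuous_map (unit_disk n) euclideanreal (dnorm n)"
    unfolding unit_disk_eq continuous_map_iff_continuous
    by (intro continuous_on_dnorm continuous_on_id)
  then have "closedin (unit_disk n) {z \<in> topspace (unit_disk n). dnorm n z \<in> {..1/2}}"
    by (rule closedin_continuous_map_preimage) simp
  then show ?thesis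
    using closedin_image_disk by (simp add: nbhd_def openin_diff)
qed

lemma nbhd_subset: "nbhd \<subseteq> topspace X"
  by (auto simp: nbhd_def)

lemma homotopy_nbhd:
  assumes "x \<in> nbhd" "t \<ge> 0" shows "homotopy t x \<in> nbhd"
proof -
  have "x \<in> topspace X" using assms nbhd_subset by blast
  then show ?thesis
  proof (cases rule: space_cases)
    case 1
    then show ?thesis using assms by (simp add: homotopy_base)
  next
    case (2 z)
    then have "dnorm n z > 1/2" using assms cell_in_nbhd by simp
    then have "dnorm n (expand n t z) > 1/2"
      using dnorm_expand_ge[of t n z] 2 assms by (simp add: topspace_unit_disk)
    then show ?thesis
      using 2 assms by (simp add: homotopy_cell cell_in_nbhd expand_in_disk)
  qed
qed

lemma homotopy_1_nbhd: 
  assumes "x \<in> nbhd" shows "homotopy 1 x \<in> Y"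
proof -
  have "x \<in> topspace X" using assms nbhd_subset by blast
  then show ?thesis
  proof (cases rule: space_cases)
    case 1
    then show ?thesis by (simp add: homotopy_base)
  next
    case (2 z)
    then have "dnorm n z > 1/2" using assms cell_in_nbhd by simp
    then have "expand n 1 z \<in> disk_boundary n"
      using 2 expand_in_disk[of z 1] by (simp add: disk_boundary_eq topspace_unit_disk dnorm_expand_1)
    then show ?thesis
      using 2 boundary by (auto simp: homotopy_cell)
  qed
qed

lemma homotopy_0:
  assumes "x \<in> topspace X" shows "homotopy 0 x = x"
  using assms
proof (cases rule: space_cases)
  case (2 z)
  then show ?thesis by (simp add: homotopy_cell expand_0 topspace_unit_disk)
qed (simp add: homotopy_base)

text \<open>The set \<open>S\<close> is a parameter because homotopies of pairs are needed for
  \<open>Y\<close> and for \<open>nbhd\<close>; the empty set gives plain continuity of the final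
  map.\<close>

lemma homotopic_with_homotopy:
  assumes "\<And>t. 0 \<le> t \<Longrightarrow> t \<le> 1 \<Longrightarrow> homotopy t \<in> S \<rightarrow> S" "S \<subseteq> topspace X"
  shows "homotopic_with (\<lambda>h. h \<in> S \<rightarrow> S) X X (homotopy 1) id"
proof -
  have "homotopic_with (\<lambda>h. h \<in> S \<rightarrow> S) X X id (homotopy 1)"
  proof (subst homotopic_with)
    show "(\<exists>h. continuous_map (prod_topology (top_of_set {0..1::real}) X) X h \<and>
             (\<forall>x\<in>topspace X. h (0, x) = id x) \<and> (\<forall>x\<in>topspace X. h (1, x) = homotopy 1 x) \<and>
             (\<forall>t\<in>{0..1}. (\<lambda>x. h (t, x)) \<in> S \<rightarrow> S))"
      by (rule exI[where x = "\<lambda>(t, x). homotopy t x"])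
        (use assms continuous_map_homotopy in \<open>auto simp: homotopy_0\<close>)
  next
    fix h k :: "'a \<Rightarrow> 'a"
    assume "\<And>x. x \<in> topspace X \<Longrightarrow> h x = k x"
    then have "h x = k x" if "x \<in> S" for x
      using that assms(2) by blast
    then show "h \<in> S \<rightarrow> S \<longleftrightarrow> k \<in> S \<rightarrow> S"
      by (simp add: Pi_iff)
  qed
  then show ?thesis by (rule homotopic_with_symD)
qed

lemma continuous_map_homotopy_1: "continuous_map X X (homotopy 1)"
  using homotopic_with_imp_continuous_maps[OF homotopic_with_homotopy[of "{}"]] by simp

text \<open>\<open>homotopy 1\<close> inverts the inclusion of pairs up to homotopy: it maps
  \<open>nbhd\<close> into \<open>Y\<close>, and the homotopy preserves both sets.\<close>

lemma iso_base_nbhd: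
  "hom_induced p X Y X nbhd id \<in> iso (relative_homology_group p X Y) (relative_homology_group p X nbhd)"
proof (rule homotopy_equivalence_relative_homology_group_isomorphism)
  show "homotopic_with (\<lambda>h. h \<in> Y \<rightarrow> Y) X X (homotopy 1 \<circ> id) id"
    using base_subset homotopic_with_homotopy[of Y] by (simp add: homotopy_base)
  show "homotopic_with (\<lambda>h. h \<in> nbhd \<rightarrow> nbhd) X X (id \<circ> homotopy 1) id"
    using nbhd_subset homotopic_with_homotopy[of nbhd] by (simp add: homotopy_nbhd)
qed (use base_subset_nbhd homotopy_1_nbhd continuous_map_homotopy_1 in auto)

text \<open>Excising \<open>Y\<close> requires its closure to lie in the interior of the subspace,
  which is why \<open>Y\<close> was enlarged to the open set \<open>nbhd\<close>. What remains is a
  pair inside the open cell.\<close>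

lemma iso_excision:
  "hom_induced p (subtopology X (topspace X - Y)) (nbhd - Y) X nbhd id
   \<in> iso (relative_homology_group p (subtopology X (topspace X - Y)) (nbhd - Y))
         (relative_homology_group p X nbhd)"
proof -
  have "X closure_of Y \<subseteq> X interior_of nbhd"
    using closed_base openin_nbhd base_subset_nbhd by (simp add: closure_of_closedin interior_of_openin)
  from homology_excision_axiom[OF this nbhd_subset, of p]
  show ?thesis by simp
qed

end

text \<open>Viewing the disk as its own boundary with one cell attached makes expansion and excision
  available at the source of a characteristic map too.\<close>

lemma cell_attachment_disk: "cell_attachment (unit_disk n) (disk_boundary n) n id"
proof
  show "closedin (unit_disk n) (disk_boundary n)"
  proof -
    have "continuous_map (unit_disk n) euclideanreal (dnorm n)"
      unfolding unit_disk_eq continuous_map_iff_continuous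
      by (intro continuous_on_dnorm continuous_on_id)
    then have "closedin (unit_disk n) {z \<in> topspace (unit_disk n). dnorm n z \<in> {1}}"
      by (rule closedin_continuous_map_preimage) simp
    moreover have "{z \<in> topspace (unit_disk n). dnorm n z \<in> {1}} = disk_boundary n"
      by (auto simp: topspace_unit_disk disk_boundary_eq)
    ultimately show ?thesis by simp
  qed
qed (simp_all add: Hausdorff_space_unit_disk disk_diff_boundary)

context cell_attachment
begin

sublocale disk: cell_attachment "unit_disk n" "disk_boundary n" n id
  by (rule cell_attachment_disk)

lemma disk_nbhd: "disk.nbhd = {z \<in> topspace (unit_disk n). dnorm n z > 1/2}"
  using disk.nbhd_subset disk.cell_in_nbhd by auto

text \<open>Enlarging and then excising the base identifies both pairs, up to isomorphism in
  homology, with pairs inside the open cells. There \<open>\<phi>\<close> is a homeomorphism of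
  pairs, and commutativity of the squares transfers the isomorphism back.\<close>

theorem iso_char_map:
  "hom_induced p (unit_disk n) (disk_boundary n) X Y \<phi>
   \<in> iso (relative_homology_group p (unit_disk n) (disk_boundary n)) (relative_homology_group p X Y)"
proof -
  let ?D = "unit_disk n" and ?B = "disk_boundary n"
  let ?Do = "subtopology ?D (topspace ?D - ?B)" and ?Xo = "subtopology X (topspace X - Y)"
  let ?H = "\<lambda>T S. carrier (relative_homology_group p T S)"
  have nb: "\<phi> \<in> disk.nbhd \<rightarrow> nbhd"
    using cell_in_nbhd by (auto simp: disk_nbhd)
  have o: "continuous_map ?Do ?D id" "continuous_map ?Xo X id"
    by (auto intro: continuous_map_from_subtopology)
  have \<phi>o: "homeomorphic_map ?Do ?Xo \<phi>"
    using homeo by (simp add: disk_diff_boundary)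
  have im: "\<phi> ` (disk.nbhd - ?B) = nbhd - Y"
  proof
    show "\<phi> ` (disk.nbhd - ?B) \<subseteq> nbhd - Y"
    proof clarify
      fix z assume z: "z \<in> disk.nbhd" "z \<notin> ?B"
      then have zt: "z \<in> topspace ?D" using disk.nbhd_subset by blast
      then show "\<phi> z \<in> nbhd - Y"
        using z nb by (cases rule: disk_cases) auto
    qed
    show "nbhd - Y \<subseteq> \<phi> ` (disk.nbhd - ?B)"
    proof
      fix x assume x: "x \<in> nbhd - Y"
      then have "x \<in> topspace X" using nbhd_subset by blast
      then show "x \<in> \<phi> ` (disk.nbhd - ?B)"
        using x cell_in_nbhd disk_diff_boundary
        by (cases rule: space_cases) (auto simp: disk_nbhd)
    qed
  qed
  have i1: "bij_betw (hom_induced p ?Do (disk.nbhd - ?B) ?Xo (nbhd - Y) \<phi>)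
      (?H ?Do (disk.nbhd - ?B)) (?H ?Xo (nbhd - Y))"
    using homeomorphic_map_relative_homology_iso[OF \<phi>o _ im, of p] disk.nbhd_subset
    by (auto simp: iso_def)
  have i2: "bij_betw (hom_induced p ?Xo (nbhd - Y) X nbhd id) (?H ?Xo (nbhd - Y)) (?H X nbhd)"
    using iso_excision by (auto simp: iso_def)
  have i3: "bij_betw (hom_induced p ?Do (disk.nbhd - ?B) ?D disk.nbhd id)
      (?H ?Do (disk.nbhd - ?B)) (?H ?D disk.nbhd)"
    using disk.iso_excision by (auto simp: iso_def)
  have eq: "hom_induced p ?D disk.nbhd X nbhd \<phi> \<circ> hom_induced p ?Do (disk.nbhd - ?B) ?D disk.nbhd id
      = hom_induced p ?Xo (nbhd - Y) X nbhd id \<circ> hom_induced p ?Do (disk.nbhd - ?B) ?Xo (nbhd - Y) \<phi>"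
    using nb im o cont homeomorphic_imp_continuous_map[OF \<phi>o]
    by (subst (1 2) hom_induced_compose[symmetric]) (auto simp: Pi_iff)
  have i4: "bij_betw (hom_induced p ?D disk.nbhd X nbhd \<phi>) (?H ?D disk.nbhd) (?H X nbhd)"
  proof (rule iffD2[OF bij_betw_comp_iff[OF i3]])
    show "bij_betw (hom_induced p ?D disk.nbhd X nbhd \<phi> \<circ>
        hom_induced p ?Do (disk.nbhd - ?B) ?D disk.nbhd id) (?H ?Do (disk.nbhd - ?B)) (?H X nbhd)"
      unfolding eq by (rule bij_betw_trans[OF i1 i2])
  qed
  have i5: "bij_betw (hom_induced p ?D ?B ?D disk.nbhd id) (?H ?D ?B) (?H ?D disk.nbhd)"
    using disk.iso_base_nbhd by (auto simp: iso_def)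
  have i6: "bij_betw (hom_induced p X Y X nbhd id) (?H X Y) (?H X nbhd)"
    using iso_base_nbhd by (auto simp: iso_def)
  have eq': "hom_induced p X Y X nbhd id \<circ> hom_induced p ?D ?B X Y \<phi>
     = hom_induced p ?D disk.nbhd X nbhd \<phi> \<circ> hom_induced p ?D ?B ?D disk.nbhd id"
    using nb cont boundary base_subset_nbhd disk.base_subset_nbhd
    by (subst (1 2) hom_induced_compose[symmetric]) auto
  have "bij_betw (hom_induced p ?D ?B X Y \<phi>) (?H ?D ?B) (?H X Y)"
  proof (rule iffD2[OF bij_betw_comp_iff2[OF i6]])
    show "hom_induced p ?D ?B X Y \<phi> ` ?H ?D ?B \<subseteq> ?H X Y"
      by (auto simp: hom_induced_carrier)
    show "bij_betw (hom_induced p X Y X nbhd id \<circ> hom_induced p ?D ?B X Y \<phi>) (?H ?D ?B) (?H X nbhd)"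
      unfolding eq' by (rule bij_betw_trans[OF i5 i4])
  qed
  then show ?thesis
    by (simp add: iso_def hom_induced_hom)
qed

end

section \<open>Free generators\<close>

lemma contractible_space_unit_disk: "contractible_space (unit_disk n)"
proof -
  have "continuous_on ({0..1} \<times> {x. (\<forall>i\<ge>n. x i = 0) \<and> dnorm n x \<le> 1})
     (\<lambda>p. \<lambda>i. (1 - fst p) * snd p i)"
    by (intro continuous_on_coordinatewise_then_product continuous_on_mult continuous_on_diff
        continuous_on_coordinate[OF continuous_on_snd] continuous_on_fst continuous_on_const
        continuous_on_id)
  moreover have "dnorm n (\<lambda>i. (1 - t) * x i) \<le> 1" if "0 \<le> t" "t \<le> 1" "dnorm n x \<le> 1" for t x
    using that by (simp add: dnorm_scale mult_le_one)
  ultimately have "continuous_map (prod_topology (top_of_set {0..1}) (unit_disk n)) (unit_disk n)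
      (\<lambda>p. \<lambda>i. (1 - fst p) * snd p i)"
    by (auto simp: unit_disk_eq prod_topology_subtopology_eu)
  then have "homotopic_with (\<lambda>x. True) (unit_disk n) (unit_disk n) id (\<lambda>x i. 0)"
    by (subst homotopic_with, simp) (rule exI[where x = "\<lambda>p. \<lambda>i. (1 - fst p) * snd p i"], simp add: fun_eq_iff)
  then show ?thesis
    unfolding contractible_space_def by blast
qed

lemma disk_boundary_nsphere:
  "subtopology (unit_disk (Suc m)) (disk_boundary (Suc m)) = nsphere m"
proof -
  have "{x. (\<Sum>i<Suc m. (x i)\<^sup>2) \<le> 1} \<inter> {x \<in> topspace (unit_disk (Suc m)). (\<Sum>i<Suc m. (x i)\<^sup>2) = 1}
      = topspace (Euclidean_space (Suc m)) \<inter> {x. (\<Sum>i<Suc m. (x i)\<^sup>2) = 1}"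
    by (auto simp: unit_disk_def simp del: sum.lessThan_Suc)
  then have "subtopology (unit_disk (Suc m)) (disk_boundary (Suc m)) =
      subtopology (Euclidean_space (Suc m))
        (topspace (Euclidean_space (Suc m)) \<inter> {x. (\<Sum>i<Suc m. (x i)\<^sup>2) = 1})"
    by (subst unit_disk_def) (simp only: subtopology_subtopology disk_boundary_def)
  also have "\<dots> = nsphere m"
    unfolding nsphere_def lessThan_Suc_atMost by (rule subtopology_restrict)
  finally show ?thesis .
qed

lemma disk_boundary_Suc_nonempty:
  "topspace (unit_disk (Suc m)) \<inter> disk_boundary (Suc m) \<noteq> {}"
  using disk_boundary_nsphere[of m] nonempty_nsphere[of m]
  by (metis topspace_subtopology null_topspace_iff_trivial)

lemma topspace_unit_disk_0: "topspace (unit_disk 0) = {\<lambda>i. 0}"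
  by (auto simp: topspace_unit_disk dnorm_def)

lemma disk_boundary_0: "disk_boundary 0 = {}"
  by (simp add: disk_boundary_def)

text \<open>For \<open>n = 0\<close> the pair is a point with empty subspace; otherwise
  contractibility of the disk reduces the claim to reduced homology of a sphere of one dimension
  less.\<close>

lemma relative_homology_disk:
  "relative_homology_group (int n) (unit_disk n) (disk_boundary n) \<cong> integer_group"
proof (cases n)
  case 0
  then show ?thesis
    using homology_coefficients[OF topspace_unit_disk_0] by (simp add: disk_boundary_0)
next
  case (Suc m)
  have "relative_homology_group (int n) (unit_disk n) (disk_boundary n) \<cong>
      reduced_homology_group (int m) (nsphere m)"
    using isomorphic_group_relative_homology_of_contractible[OF contractible_space_unit_disk
        disk_boundary_Suc_nonempty, of "int n"] by (simp add: Suc disk_boundary_nsphere)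
  then show ?thesis
    using reduced_homology_group_nsphere iso_trans by blast
qed

text \<open>In the exact sequence of a triple this degree precedes the one of the attached cell; its
  vanishing makes the map from the previous stage injective.\<close>

lemma trivial_relative_homology_disk:
  "trivial_group (relative_homology_group (int n + 1) (unit_disk n) (disk_boundary n))"
proof (cases n)
  case 0
  then show ?thesis
    using homology_dimension_axiom[OF topspace_unit_disk_0, of 1] by (simp add: disk_boundary_0)
next
  case (Suc m)
  have "relative_homology_group (int n + 1) (unit_disk n) (disk_boundary n) \<cong>
      reduced_homology_group (int m + 1) (nsphere m)"
    using isomorphic_group_relative_homology_of_contractible[OF contractible_space_unit_disk
        disk_boundary_Suc_nonempty, of "int n + 1"] by (simp add: Suc disk_boundary_nsphere add.commute)
  then show ?thesis
    using isomorphic_group_triviality[OF _ group_relative_homology_group group_reduced_homology_group]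
      trivial_reduced_homology_group_nsphere[of "int m + 1" m] by fastforce
qed

definition free_generator :: "('b, 'c) monoid_scheme \<Rightarrow> 'b \<Rightarrow> bool"
  where "free_generator G g \<longleftrightarrow> g \<in> carrier G \<and> (\<forall>x\<in>carrier G. \<exists>!k::int. x = g [^]\<^bsub>G\<^esub> k)"

text \<open>A generator of an infinite group has pairwise distinct powers, whence the exponent is
  unique.\<close>

lemma free_generatorI:
  assumes "group G" "G \<cong> integer_group" "g \<in> carrier G" "subgroup_generated G {g} = G"
  shows "free_generator G g"
proof -
  interpret group G by fact
  have "infinite (carrier G)"
    using assms(2) by (auto simp: is_iso_def iso_def dest: bij_betw_finite)
  then have "infinite (carrier (subgroup_generated G {g}))" by (simp add: assms(4))
  then have inj: "\<forall>i j::int. g [^]\<^bsub>G\<^esub> i = g [^]\<^bsub>G\<^esub> j \<longrightarrow> i = j"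
    using infinite_cyclic_subgroup_int[OF assms(3)] by simp
  have "carrier G = range (\<lambda>k::int. g [^]\<^bsub>G\<^esub> k)"
    using carrier_subgroup_generated_by_singleton[OF assms(3)] by (simp add: assms(4))
  then show ?thesis
    using inj assms(3) by (auto simp: free_generator_def)
qed

text \<open>The group is infinite cyclic, so the choice operator in \<open>disk_class\<close> has a
  witness.\<close>

lemma free_generator_disk_class:
  "free_generator (relative_homology_group (int n) (unit_disk n) (disk_boundary n)) (disk_class n)"
proof -
  let ?G = "relative_homology_group (int n) (unit_disk n) (disk_boundary n)"
  have "cyclic_group ?G"
    using relative_homology_disk isomorphic_group_cyclicity cyclic_integer_group group_integer_group
      group_relative_homology_group by blast
  then have "\<exists>g. g \<in> carrier ?G \<and> subgroup_generated ?G {g} = ?G"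
    by (auto simp: cyclic_group_def)
  then have "disk_class n \<in> carrier ?G \<and> subgroup_generated ?G {disk_class n} = ?G"
    unfolding disk_class_def Let_def by (rule someI_ex)
  then show ?thesis
    by (intro free_generatorI relative_homology_disk) auto
qed

lemma free_generator_iso:
  assumes "free_generator G g" "f \<in> iso G H" "group G" "group H"
  shows "free_generator H (f g)"
proof -
  have f: "f \<in> hom G H" "bij_betw f (carrier G) (carrier H)"
    using assms by (auto simp: iso_def)
  show ?thesis
    unfolding free_generator_def
  proof (intro conjI ballI)
    show "f g \<in> carrier H"
      using assms f by (auto simp: free_generator_def bij_betw_def)
    fix y assume "y \<in> carrier H"
    then obtain x where x: "x \<in> carrier G" "y = f x"
      using f by (auto simp: bij_betw_def)
    have eq: "f (g [^]\<^bsub>G\<^esub> k) = f g [^]\<^bsub>H\<^esub> k" for k :: int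
      using Group.hom_int_pow[OF f(1) _ assms(3,4)] assms(1) by (simp add: free_generator_def)
    have "y = f g [^]\<^bsub>H\<^esub> k \<longleftrightarrow> x = g [^]\<^bsub>G\<^esub> k" for k :: int
      using x f assms(1,3) group.int_pow_closed[OF assms(3)] unfolding eq[symmetric] free_generator_def
      by (metis bij_betw_imp_inj_on inj_on_eq_iff)
    then show "\<exists>!k::int. y = f g [^]\<^bsub>H\<^esub> k"
      using assms(1) x by (simp add: free_generator_def)
  qed
qed

section \<open>Integral bases of commutative groups\<close>

definition comb :: "('b, 'c) monoid_scheme \<Rightarrow> 'i set \<Rightarrow> ('i \<Rightarrow> 'b) \<Rightarrow> ('i \<Rightarrow> int) \<Rightarrow> 'b"
  where "comb G I b c = finprod G (\<lambda>i. b i [^]\<^bsub>G\<^esub> c i) I"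

text \<open>Coefficient functions are total, so uniqueness makes sense only with vanishing off
  \<open>I\<close>; the description operator in \<open>incidence\<close> uses the same
  normalisation.\<close>

definition zbasis :: "('b, 'c) monoid_scheme \<Rightarrow> 'i set \<Rightarrow> ('i \<Rightarrow> 'b) \<Rightarrow> bool"
  where "zbasis G I b \<longleftrightarrow> b \<in> I \<rightarrow> carrier G \<and>
    (\<forall>x\<in>carrier G. \<exists>!c. (\<forall>i. i \<notin> I \<longrightarrow> c i = 0) \<and> x = comb G I b c)"

lemma (in comm_group) comb_closed: "b \<in> I \<rightarrow> carrier G \<Longrightarrow> comb G I b c \<in> carrier G"
  unfolding comb_def by (intro finprod_closed) (auto simp: Pi_iff)

lemma (in comm_group) comb_insert:
  assumes "finite I" "i \<notin> I" "b \<in> insert i I \<rightarrow> carrier G"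
  shows "comb G (insert i I) b c = b i [^] c i \<otimes> comb G I b c"
  unfolding comb_def using assms by (intro finprod_insert) (auto simp: Pi_iff)

lemma comb_hom:
  assumes "h \<in> hom G H" "comm_group G" "comm_group H" "finite I" "b \<in> I \<rightarrow> carrier G"
  shows "h (comb G I b c) = comb H I (h \<circ> b) c"
proof -
  interpret G: comm_group G by fact
  interpret H: comm_group H by fact
  interpret group_hom G H h using assms(1) by unfold_locales
  show ?thesis
    using assms(4,5)
  proof (induction I)
    case empty
    then show ?case by (simp add: comb_def)
  next
    case (insert i I)
    then show ?case
      using G.comb_closed[of b I c]
      by (subst G.comb_insert H.comb_insert; auto simp: Pi_iff o_def Group.hom_int_pow[OF assms(1)])+
  qed
qed

lemma comb_cong:
  assumes "comm_group G" "b \<in> I \<rightarrow> carrier G" "\<And>i. i \<in> I \<Longrightarrow> b i = b' i" "\<And>i. i \<in> I \<Longrightarrow> c i = c' i"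
  shows "comb G I b c = comb G I b' c'"
proof -
  interpret comm_group G by fact
  show ?thesis unfolding comb_def
    using assms by (intro finprod_cong') (auto simp: Pi_iff)
qed

text \<open>The exponent of \<open>b e\<close> can be read off in \<open>C\<close>, and the
  remaining factor lies in the kernel of \<open>g\<close>, hence comes from a unique element of
  \<open>A\<close>.\<close>

lemma zbasis_extend:
  assumes comm: "comm_group A" "comm_group B" "comm_group C"
    and f: "f \<in> hom A B" "inj_on f (carrier A)" and g: "g \<in> hom B C"
    and ker: "kernel B C g = f ` carrier A"
    and gen: "free_generator C (g (b e))" and e: "b e \<in> carrier B" "e \<notin> I" "finite I"
    and basis: "zbasis A I b'" and b: "\<And>i. i \<in> I \<Longrightarrow> b i = f (b' i)"
  shows "zbasis B (insert e I) b"
proof -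
  interpret A: comm_group A by fact
  interpret B: comm_group B by fact
  interpret C: comm_group C by fact
  interpret f: group_hom A B f using f by unfold_locales
  interpret g: group_hom B C g using g by unfold_locales
  have b': "b' \<in> I \<rightarrow> carrier A" using basis by (simp add: zbasis_def)
  have bI: "b \<in> insert e I \<rightarrow> carrier B" "b \<in> I \<rightarrow> carrier B" using b b' e by (auto simp: Pi_iff)
  have comb_f: "comb B I b c = f (comb A I b' c)" for c
    using comb_hom[OF f(1) comm(1,2) e(3) b'] comb_cong[OF comm(2) bI(2), of "f \<circ> b'" c c] b by simp
  have gf: "g (f x) = \<one>\<^bsub>C\<^esub>" if "x \<in> carrier A" for x
    using that ker by (auto simp: kernel_def)
  have ins: "comb B (insert e I) b c = b e [^]\<^bsub>B\<^esub> c e \<otimes>\<^bsub>B\<^esub> f (comb A I b' c)" for c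
    using e bI by (simp add: B.comb_insert comb_f)
  have g_ins: "g (comb B (insert e I) b c) = g (b e) [^]\<^bsub>C\<^esub> c e" for c
    using e A.comb_closed[OF b'] by (simp add: ins gf Group.hom_int_pow[OF g] B.is_group C.is_group)
  have "\<exists>!c. (\<forall>i. i \<notin> insert e I \<longrightarrow> c i = 0) \<and> y = comb B (insert e I) b c" if y: "y \<in> carrier B" for y
  proof -
    obtain k :: int where k: "g y = g (b e) [^]\<^bsub>C\<^esub> k"
      using gen y unfolding free_generator_def by (metis g.hom_closed)
    have "inv\<^bsub>B\<^esub> (b e [^]\<^bsub>B\<^esub> k) \<otimes>\<^bsub>B\<^esub> y \<in> kernel B C g"
      using y e k by (simp add: kernel_def Group.hom_int_pow[OF g] B.is_group C.is_group)
    then obtain a where a: "a \<in> carrier A" "inv\<^bsub>B\<^esub> (b e [^]\<^bsub>B\<^esub> k) \<otimes>\<^bsub>B\<^esub> y = f a"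
      using ker by auto
    then have ya: "y = b e [^]\<^bsub>B\<^esub> k \<otimes>\<^bsub>B\<^esub> f a"
      using y e B.inv_solve_left by (metis B.int_pow_closed f.hom_closed)
    obtain c where c: "\<forall>i. i \<notin> I \<longrightarrow> c i = 0" "a = comb A I b' c"
      using basis a by (auto simp: zbasis_def Ex1_def)
    \<comment> \<open>As \<open>e\<close> is not in \<open>I\<close>, the value stored at
      \<open>e\<close> can be changed freely; this reconciles coefficient functions on
      \<open>I\<close> and on \<open>insert e I\<close>.\<close>
    have *: "comb A I b' c = comb A I b' (c(e := l))" for c l
      using e by (intro comb_cong[OF comm(1) b']) auto
    show ?thesis
    proof (rule ex1I[of _ "c(e := k)"])
      show "(\<forall>i. i \<notin> insert e I \<longrightarrow> (c(e := k)) i = 0) \<and> y = comb B (insert e I) b (c(e := k))"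
        using c * by (auto simp: ins ya)
    next
      fix c' assume c': "(\<forall>i. i \<notin> insert e I \<longrightarrow> c' i = 0) \<and> y = comb B (insert e I) b c'"
      have "g (b e) [^]\<^bsub>C\<^esub> c' e = g (b e) [^]\<^bsub>C\<^esub> k"
        using c' k g_ins by metis
      then have ce: "c' e = k"
        using gen y k by (metis (no_types, lifting) free_generator_def g.hom_closed)
      then have "f (comb A I b' c') = f a"
        using c' ya a e A.comb_closed[OF b'] by (simp add: ins)
      then have "comb A I b' c' = a"
        using f(2) a A.comb_closed[OF b'] by (simp add: inj_on_eq_iff)
      then have "comb A I b' (c'(e := 0)) = comb A I b' c"
        using * c by metis
      moreover have "\<forall>i. i \<notin> I \<longrightarrow> (c'(e := 0)) i = 0" using c' by auto
      ultimately have "c'(e := 0) = c"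
        using basis c a by (metis (no_types, lifting) zbasis_def)
      then show "c' = c(e := k)" using ce by (metis fun_upd_triv fun_upd_upd)
    qed
  qed
  then show ?thesis using bI by (simp add: zbasis_def)
qed

section \<open>The cellular chain complex\<close>

lemma (in comm_group) comb_add:
  assumes "b \<in> I \<rightarrow> carrier G"
  shows "comb G I b (\<lambda>i. c i + c' i) = comb G I b c \<otimes> comb G I b c'"
proof -
  have "comb G I b (\<lambda>i. c i + c' i) = finprod G (\<lambda>i. b i [^] c i \<otimes> b i [^] c' i) I"
    unfolding comb_def using assms by (intro finprod_cong') (auto simp: Pi_iff int_pow_mult)
  also have "\<dots> = comb G I b c \<otimes> comb G I b c'"
    unfolding comb_def using assms by (intro finprod_multf) (auto simp: Pi_iff)
  finally show ?thesis .
qed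

lemma (in comm_group) comb_zero: "b \<in> I \<rightarrow> carrier G \<Longrightarrow> comb G I b (\<lambda>i. 0) = \<one>"
  unfolding comb_def by (simp add: finprod_one_eqI)

lemma (in comm_group) comb_pow:
  assumes "finite I" "b \<in> I \<rightarrow> carrier G"
  shows "comb G I b c [^] (n::int) = comb G I b (\<lambda>i. c i * n)"
  using assms
proof (induction I)
  case empty
  then show ?case by (simp add: comb_def)
next
  case (insert i I)
  then have "b \<in> I \<rightarrow> carrier G" "b i \<in> carrier G" by auto
  then show ?case
    using insert comb_closed[of b I c]
    by (simp add: comb_insert int_pow_distrib int_pow_pow)
qed

text \<open>Substitution multiplies coefficient matrices. This converts identities between composed
  boundary maps into identities between sums of products of incidence numbers.\<close>

lemma (in comm_group) comb_comb:
  assumes "finite I" "finite J" "b \<in> J \<rightarrow> carrier G"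
  shows "comb G I (\<lambda>i. comb G J b (m i)) c = comb G J b (\<lambda>j. \<Sum>i\<in>I. c i * m i j)"
  using assms(1)
proof (induction I)
  case empty
  then show ?case using assms by (simp add: comb_zero) (simp add: comb_def)
next
  case (insert i I)
  then show ?case
    using assms comb_closed[OF assms(3)]
    by (simp add: comb_insert Pi_iff comb_pow comb_add mult.commute)
qed

lemma zbasis_trivial:
  assumes "comm_group G" "trivial_group G" shows "zbasis G {} b"
proof -
  interpret comm_group G by fact
  show ?thesis
    using assms(2) by (auto simp: zbasis_def trivial_group_def comb_def intro!: ex1I[of _ "\<lambda>_. 0"])
qed

lemma zbasis_unique:
  assumes "zbasis G I b" "comm_group G" "comb G I b c = comb G I b c'"
    "\<And>i. i \<notin> I \<Longrightarrow> c i = 0" "\<And>i. i \<notin> I \<Longrightarrow> c' i = 0"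
  shows "c = c'"
proof -
  have "comb G I b c \<in> carrier G"
    using assms by (intro comm_group.comb_closed) (auto simp: zbasis_def)
  then show ?thesis
    using assms unfolding zbasis_def by metis
qed

text \<open>The (-1)-cell is the empty set and contributes no points, so as a subspace a skeleton is
  described by natural dimensions alone.\<close>

lemma Union_skel: "\<Union>(skel K j) = \<Union>(\<Union>n\<in>{n. int n \<le> j}. open_cells K n)"
proof
  show "\<Union>(skel K j) \<subseteq> \<Union>(\<Union>n\<in>{n. int n \<le> j}. open_cells K n)"
  proof
    fix x assume "x \<in> \<Union>(skel K j)"
    then obtain i e where "x \<in> e" "e \<in> cells K i" "-1 \<le> i" "i \<le> j"
      by (auto simp: skel_def)
    then have "e \<in> open_cells K (nat i)" "int (nat i) \<le> j"
      by (auto simp: cells_def split: if_splits)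
    with \<open>x \<in> e\<close> show "x \<in> \<Union>(\<Union>n\<in>{n. int n \<le> j}. open_cells K n)" by blast
  qed
  show "\<Union>(\<Union>n\<in>{n. int n \<le> j}. open_cells K n) \<subseteq> \<Union>(skel K j)"
  proof clarify
    fix x n e assume *: "int n \<le> j" "e \<in> open_cells K n" "x \<in> e"
    then have "e \<in> cells K (int n)" "int n \<in> {-1..j}" by (auto simp: cells_def)
    then show "x \<in> \<Union>(skel K j)" using * unfolding skel_def by blast
  qed
qed

lemma Union_skel_step: "\<Union>(skel K (int k)) = \<Union>(skel K (int k - 1)) \<union> \<Union>(open_cells K k)"
proof -
  have "{n. int n \<le> int k} = insert k {n. int n \<le> int k - 1}" by auto
  then show ?thesis by (simp add: Union_skel Un_commute)
qed

lemma cells_int: "cells K (int k) = open_cells K k"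
  by (simp add: cells_def)

locale finite_CW =
  fixes K :: "'a cell_structure" and d :: nat
  assumes CW: "finite_CW_complex K d"
begin

lemma Hausdorff: "Hausdorff_space (space_of K)"
  and finite_open_cells: "finite (open_cells K n)"
  and disjoint_dims: "disjoint_family (open_cells K)"
  and disjoint_cells: "disjoint (\<Union>n. open_cells K n)"
  and Union_cells: "\<Union>(\<Union>n. open_cells K n) = topspace (space_of K)"
  using CW by (auto simp: finite_CW_complex_def)

lemma char_map:
  assumes "e \<in> open_cells K n"
  shows "continuous_map (unit_disk n) (space_of K) (char_map K e)"
    "homeomorphic_map (subtopology (unit_disk n) (open_disk n)) (subtopology (space_of K) e) (char_map K e)"
    "char_map K e ` disk_boundary n \<subseteq> \<Union>(skel K (int n - 1))"
  using CW assms by (auto simp: finite_CW_complex_def)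

lemma cell_subset: "e \<in> open_cells K n \<Longrightarrow> e \<subseteq> topspace (space_of K)"
  using Union_cells by blast

lemma image_open_disk:
  assumes "e \<in> open_cells K n" shows "char_map K e ` open_disk n = e"
  using homeomorphic_imp_surjective_map[OF char_map(2)[OF assms]] cell_subset[OF assms]
    open_disk_subset[of n]
  by (simp add: Int_absorb1)

lemma cell_nonempty: "e \<in> open_cells K n \<Longrightarrow> e \<noteq> {}"
proof -
  have "(\<lambda>i. 0) \<in> open_disk n" by (simp add: open_disk_eq dnorm_def)
  then show "e \<in> open_cells K n \<Longrightarrow> e \<noteq> {}" using image_open_disk by blast
qed

lemma disjnt_cells:
  assumes "e \<in> open_cells K m" "e' \<in> open_cells K n" "m \<noteq> n \<or> e \<noteq> e'"
  shows "e \<inter> e' = {}"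
proof -
  have "open_cells K m \<inter> open_cells K n = {}" if "m \<noteq> n"
    using disjoint_family_onD[OF disjoint_dims, of m n] that by simp
  then have "e \<noteq> e'" using assms by blast
  then show ?thesis
    using disjointD[OF disjoint_cells, of e e'] assms by blast
qed

lemma skel_disjoint:
  assumes "e \<in> open_cells K k" shows "e \<inter> \<Union>(skel K (int k - 1)) = {}"
proof -
  have "e \<inter> e' = {}" if "int n \<le> int k - 1" "e' \<in> open_cells K n" for n e'
    using disjnt_cells[OF assms that(2)] that(1) by simp
  then show ?thesis unfolding Union_skel by blast
qed

text \<open>This set is a finite union of compact images of closed disks. Attaching maps land in
  lower skeleta, so the closed cells cover nothing beyond the open ones.\<close>

lemma closedin_partial_skel:
  assumes F: "F \<subseteq> open_cells K k"
  shows "closedin (space_of K) (\<Union>(skel K (int k - 1)) \<union> \<Union>F)" (is "closedin _ ?S")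
proof -
  define I where "I = (SIGMA m:{..<k}. open_cells K m) \<union> {k} \<times> F"
  have I: "e \<in> open_cells K m" "m \<le> k" if "(m, e) \<in> I" for m e
    using that F by (auto simp: I_def)
  have "finite I"
    using finite_subset[OF F finite_open_cells] finite_open_cells by (auto simp: I_def)
  moreover have "closedin (space_of K) (char_map K e ` topspace (unit_disk m))" if "(m, e) \<in> I" for m e
    using I(1)[OF that] char_map(1) Hausdorff compact_space_unit_disk
    by (meson compact_space_def compactin_imp_closedin image_compactin)
  ultimately have "closedin (space_of K) (\<Union>p\<in>I. char_map K (snd p) ` topspace (unit_disk (fst p)))"
    by (intro closedin_Union) auto
  moreover have "(\<Union>p\<in>I. char_map K (snd p) ` topspace (unit_disk (fst p))) = ?S"
  proof
    show "(\<Union>p\<in>I. char_map K (snd p) ` topspace (unit_disk (fst p))) \<subseteq> ?S"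
    proof
      fix x assume "x \<in> (\<Union>p\<in>I. char_map K (snd p) ` topspace (unit_disk (fst p)))"
      then obtain m e z where me: "(m, e) \<in> I" and z: "z \<in> topspace (unit_disk m)"
        and x: "x = char_map K e z"
        by auto
      have e: "e \<in> open_cells K m" using I me by blast
      have lt: "m < k" if "e \<notin> F" using me that by (auto simp: I_def)
      show "x \<in> ?S"
      proof (cases "z \<in> open_disk m")
        case True
        then have xe: "x \<in> e" using image_open_disk[OF e] x by blast
        show ?thesis
        proof (cases "e \<in> F")
          case True
          then show ?thesis using xe by blast
        next
          case False
          then have "int m \<le> int k - 1" using lt by simp
          then show ?thesis using e xe unfolding Union_skel by auto
        qed
      next
        case False
        then have "z \<in> disk_boundary m" using z disk_diff_boundary by blast
        then have "x \<in> \<Union>(skel K (int m - 1))" using char_map(3)[OF e] x by blast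
        moreover have "{n. int n \<le> int m - 1} \<subseteq> {n. int n \<le> int k - 1}" using I(2)[OF me] by auto
        ultimately show ?thesis unfolding Union_skel by auto
      qed
    qed
    have "e \<subseteq> (\<Union>p\<in>I. char_map K (snd p) ` topspace (unit_disk (fst p)))" if "(m, e) \<in> I" for m e
      using image_open_disk[OF I(1)[OF that]] open_disk_subset[of m] that by force
    moreover have "(k, e) \<in> I" if "e \<in> F" for e using that by (simp add: I_def)
    moreover have "(m, e) \<in> I" if "e \<in> open_cells K m" "int m \<le> int k - 1" for m e
      using that by (auto simp: I_def)
    ultimately show "?S \<subseteq> (\<Union>p\<in>I. char_map K (snd p) ` topspace (unit_disk (fst p)))"
      unfolding Union_skel by blast
  qed
  ultimately show ?thesis by simp
qed

definition partial_skel :: "nat \<Rightarrow> 'a set set \<Rightarrow> 'a set"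
  where "partial_skel k F = \<Union>(skel K (int k - 1)) \<union> \<Union>F"

lemma partial_skel_subset: "F \<subseteq> open_cells K k \<Longrightarrow> partial_skel k F \<subseteq> topspace (space_of K)"
  unfolding partial_skel_def by (intro closedin_subset closedin_partial_skel)

lemma cell_attachment_insert:
  assumes F: "insert e F \<subseteq> open_cells K k" and "e \<notin> F"
  shows "cell_attachment (subtopology (space_of K) (partial_skel k (insert e F))) (partial_skel k F) k
           (char_map K e)"
proof
  let ?X = "subtopology (space_of K) (partial_skel k (insert e F))"
  have e: "e \<in> open_cells K k" using F by blast
  have top: "topspace ?X = partial_skel k (insert e F)"
    using partial_skel_subset[OF F] by (simp add: Int_absorb1)
  have "e \<inter> \<Union>F = {}" using disjnt_cells[OF e] F \<open>e \<notin> F\<close> by blast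
  then have diff: "topspace ?X - partial_skel k F = e"
    unfolding top using skel_disjoint[OF e] by (auto simp: partial_skel_def)
  show "Hausdorff_space ?X" using Hausdorff by (simp add: Hausdorff_space_subtopology)
  show "closedin ?X (partial_skel k F)"
    using closedin_partial_skel[of F k] F
    by (intro closedin_subset_topspace) (auto simp: partial_skel_def)
  show "char_map K e ` disk_boundary k \<subseteq> partial_skel k F"
    using char_map(3)[OF e] by (auto simp: partial_skel_def)
  have "char_map K e z \<in> partial_skel k (insert e F)" if "z \<in> topspace (unit_disk k)" for z
  proof (cases "z \<in> disk_boundary k")
    case True
    then show ?thesis using char_map(3)[OF e] by (auto simp: partial_skel_def)
  next
    case False
    then have "char_map K e z \<in> e" using that image_open_disk[OF e] disk_diff_boundary by blast
    then show ?thesis by (simp add: partial_skel_def)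
  qed
  then show "continuous_map (unit_disk k) ?X (char_map K e)"
    using char_map(1)[OF e] by (auto simp: continuous_map_in_subtopology)
  have "subtopology ?X e = subtopology (space_of K) e"
    by (simp add: subtopology_subtopology partial_skel_def Int_absorb1 le_supI2)
  then show "homeomorphic_map (subtopology (unit_disk k) (open_disk k))
     (subtopology ?X (topspace ?X - partial_skel k F)) (char_map K e)"
    using char_map(2)[OF e] unfolding diff by simp
qed

text \<open>Uses the exact sequence of the triple formed by the new stage, the old stage and the
  (k-1)-skeleton: the new stage relative to the old one has homology freely generated by the class
  of the new cell in degree k, and none in degree k+1.\<close>

lemma zbasis_partial_skel:
  assumes "F \<subseteq> open_cells K k"
  shows "zbasis (relative_homology_group (int k) (subtopology (space_of K) (partial_skel k F)) (partial_skel k {})) F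
     (\<lambda>e. hom_induced (int k) (unit_disk k) (disk_boundary k)
        (subtopology (space_of K) (partial_skel k F)) (partial_skel k {}) (char_map K e) (disk_class k))"
  using finite_subset[OF assms finite_open_cells] assms
proof (induction F)
  case empty
  have "topspace (subtopology (space_of K) (partial_skel k {})) = partial_skel k {}"
    using partial_skel_subset[of "{}"] by (simp add: Int_absorb1)
  then have "trivial_group (relative_homology_group (int k)
      (subtopology (space_of K) (partial_skel k {})) (partial_skel k {}))"
    using trivial_relative_homology_group_topspace by metis
  then show ?case by (simp add: zbasis_trivial)
next
  case (insert e F)
  let ?X = "subtopology (space_of K) (partial_skel k (insert e F))"
  let ?S = "partial_skel k F" and ?T = "partial_skel k {}"
  let ?D = "unit_disk k" and ?B = "disk_boundary k"
  let ?Y = "subtopology (space_of K) ?S" and ?H = "relative_homology_group (int k)"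
  let ?f = "hom_induced (int k) ?Y ?T ?X ?T id" and ?g = "hom_induced (int k) ?X ?T ?X ?S id"
  let ?b = "\<lambda>Z i. hom_induced (int k) ?D ?B Z ?T (char_map K i) (disk_class k)"
  let ?c = "hom_induced (int k) ?D ?B ?X ?S (char_map K e) (disk_class k)"
  interpret cell_attachment ?X ?S k "char_map K e"
    using insert by (intro cell_attachment_insert) auto
  have TS: "?T \<subseteq> ?S" "?S \<subseteq> partial_skel k (insert e F)" by (auto simp: partial_skel_def)
  have sub: "subtopology ?X ?S = subtopology (space_of K) ?S"
    using TS by (simp add: subtopology_subtopology Int_absorb1)
  have cm: "continuous_map ?D ?Y (char_map K i)"
    "continuous_map ?D ?X (char_map K i)" "char_map K i \<in> ?B \<rightarrow> ?T" if "i \<in> F" for i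
  proof -
    interpret i: cell_attachment "subtopology (space_of K) (partial_skel k (insert i {}))" ?T k "char_map K i"
      using insert that by (intro cell_attachment_insert) auto
    show "char_map K i \<in> ?B \<rightarrow> ?T" using i.boundary by auto
    show "continuous_map ?D ?Y (char_map K i)"
      "continuous_map ?D ?X (char_map K i)"
      using i.cont that by (auto simp: continuous_map_in_subtopology partial_skel_def)
  qed
  have eT: "char_map K e \<in> ?B \<rightarrow> ?T"
    using char_map(3)[of e k] insert by (auto simp: partial_skel_def)
  show ?case
  proof (rule zbasis_extend[OF _ _ _ _ _ _ _ _ _ _ _ insert.IH])
    show "?f \<in> hom (?H ?Y ?T) (?H ?X ?T)"
      by (rule hom_induced_hom)
    show "?g \<in> hom (?H ?X ?T) (?H ?X ?S)"
      by (rule hom_induced_hom)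
    show "kernel (?H ?X ?T) (?H ?X ?S) ?g = ?f ` carrier (?H ?Y ?T)"
      using homology_exactness_triple_3[OF TS(1), of "int k" ?X] by (simp add: sub)
    have "trivial_group (relative_homology_group (int k + 1) ?X ?S)"
      using isomorphic_group_triviality1[OF is_isoI[OF iso_char_map]] trivial_relative_homology_disk
      by simp
    moreover have "kernel (?H ?Y ?T) (?H ?X ?T) ?f = hom_relboundary (int k + 1) ?X ?S ?T ` carrier (relative_homology_group (int k + 1) ?X ?S)"
      using homology_exactness_triple_2[OF TS(1), of "int k + 1" ?X] by (simp add: sub)
    moreover have "hom_relboundary (int k + 1) ?X ?S ?T \<one>\<^bsub>relative_homology_group (int k + 1) ?X ?S\<^esub>
        = \<one>\<^bsub>?H ?Y ?T\<^esub>"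
      using hom_one[OF group_homomorphism_hom_relboundary[of "int k + 1" ?X ?S ?T]] by (simp add: sub)
    ultimately have "kernel (?H ?Y ?T) (?H ?X ?T) ?f = {\<one>\<^bsub>?H ?Y ?T\<^esub>}"
      by (simp add: trivial_group_def)
    moreover have "group_hom (?H ?Y ?T) (?H ?X ?T) ?f"
      by (simp add: group_hom_def group_hom_axioms_def hom_induced_hom)
    ultimately show "inj_on ?f (carrier (?H ?Y ?T))"
      using group_hom.inj_iff_trivial_ker by blast
    have "?g (?b ?X e) = ?c"
      using TS eT cont by (subst hom_induced_compose') auto
    moreover have "free_generator (?H ?X ?S) ?c"
      using free_generator_iso[OF free_generator_disk_class iso_char_map] by simp
    ultimately show "free_generator (?H ?X ?S) (?g (?b ?X e))"
      by simp
    show "?b ?X e \<in> carrier (?H ?X ?T)"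
      by (rule hom_induced_carrier)
    fix i assume i: "i \<in> F"
    have "continuous_map ?Y ?X id"
      using TS by (auto simp: continuous_map_in_subtopology continuous_map_from_subtopology)
    then show "?b ?X i = ?f (?b ?Y i)"
      using cm[OF i] by (subst hom_induced_compose') auto
  qed (use insert in auto)
qed

lemma skel_space_eq: "skel_space K (int k) = subtopology (space_of K) (partial_skel k (open_cells K k))"
  by (simp add: skel_space_def partial_skel_def Union_skel_step)

lemma zbasis_skel_group: "zbasis (skel_group K (int k)) (open_cells K k) (cell_class K (int k))"
proof -
  have "partial_skel k {} = \<Union>(skel K (int k - 1))" by (simp add: partial_skel_def)
  then show ?thesis
    using zbasis_partial_skel[of "open_cells K k" k]
    unfolding skel_group_def cell_class_def skel_space_eq nat_int by simp
qed

lemma comm_group_skel_group: "comm_group (skel_group K k)"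
  by (simp add: skel_group_def)

lemma subtopology_skel_space: "i \<le> j \<Longrightarrow> subtopology (skel_space K j) (\<Union>(skel K i)) = skel_space K i"
proof -
  assume "i \<le> j"
  then have "{n. int n \<le> i} \<subseteq> {n. int n \<le> j}" by auto
  then have "\<Union>(skel K i) \<subseteq> \<Union>(skel K j)"
    unfolding Union_skel by blast
  then show ?thesis by (simp add: skel_space_def subtopology_subtopology Int_absorb1)
qed

text \<open>The basis property gives the existence and uniqueness that the description operator in
  \<open>incidence\<close> presupposes.\<close>

lemma incidence_spec:
  assumes "k \<ge> 1"
  shows "\<tau> \<notin> cells K (k - 1) \<Longrightarrow> incidence K k \<sigma> \<tau> = 0"
    and "hom_relboundary k (skel_space K k) (\<Union>(skel K (k - 1))) (\<Union>(skel K (k - 2))) (cell_class K k \<sigma>)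
       = comb (skel_group K (k - 1)) (cells K (k - 1)) (cell_class K (k - 1)) (incidence K k \<sigma>)"
proof -
  define n where "n = nat (k - 1)"
  have n: "k - 1 = int n" using assms by (simp add: n_def)
  let ?x = "hom_relboundary k (skel_space K k) (\<Union>(skel K (k - 1))) (\<Union>(skel K (k - 2))) (cell_class K k \<sigma>)"
  have "?x \<in> carrier (skel_group K (k - 1))"
    using hom_relboundary[of k "skel_space K k" "\<Union>(skel K (k - 1))" "\<Union>(skel K (k - 2))"]
    by (simp add: skel_group_def subtopology_skel_space)
  then have ex: "\<exists>!c. (\<forall>\<tau>. \<tau> \<notin> cells K (k - 1) \<longrightarrow> c \<tau> = 0) \<and>
      ?x = comb (skel_group K (k - 1)) (cells K (k - 1)) (cell_class K (k - 1)) c"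
    using zbasis_skel_group[of n] unfolding zbasis_def n cells_int by blast
  have "incidence K k \<sigma> = (THE c. (\<forall>\<tau>. \<tau> \<notin> cells K (k - 1) \<longrightarrow> c \<tau> = 0) \<and>
      ?x = comb (skel_group K (k - 1)) (cells K (k - 1)) (cell_class K (k - 1)) c)"
    using assms by (simp add: incidence_def comb_def)
  then have *: "(\<forall>\<tau>. \<tau> \<notin> cells K (k - 1) \<longrightarrow> incidence K k \<sigma> \<tau> = 0) \<and>
      ?x = comb (skel_group K (k - 1)) (cells K (k - 1)) (cell_class K (k - 1)) (incidence K k \<sigma>)"
    using theI'[OF ex] by simp
  show "\<tau> \<notin> cells K (k - 1) \<Longrightarrow> incidence K k \<sigma> \<tau> = 0" using * by blast
  show "?x = comb (skel_group K (k - 1)) (cells K (k - 1)) (cell_class K (k - 1)) (incidence K k \<sigma>)"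
    using * by blast
qed

lemma incidence_support: "\<tau> \<notin> cells K (k - 1) \<Longrightarrow> incidence K k \<sigma> \<tau> = 0"
proof -
  consider "k < 0" | "k = 0" | "k \<ge> 1" by linarith
  then show "\<tau> \<notin> cells K (k - 1) \<Longrightarrow> incidence K k \<sigma> \<tau> = 0"
    using incidence_spec(1)[of k \<tau> \<sigma>] by cases (simp_all add: incidence_def cells_def)
qed

lemma finite_cells: "finite (cells K k)"
  using finite_open_cells by (simp add: cells_def)

lemma cell_class_closed: "cell_class K k \<in> I \<rightarrow> carrier (skel_group K k)"
  by (auto simp: cell_class_def skel_group_def hom_induced_carrier)

text \<open>The composite contains two consecutive maps of the exact sequence of the pair (X_(k-1),
  X_(k-2)): from H_(k-1)(X_(k-1)) to the relative group and on to H_(k-2)(X_(k-2)).\<close>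

lemma relboundary_relboundary:
  assumes "k \<ge> 1"
  shows "hom_relboundary (k - 1) (skel_space K (k - 1)) (\<Union>(skel K (k - 2))) T
     (hom_relboundary k (skel_space K k) (\<Union>(skel K (k - 1))) (\<Union>(skel K (k - 2))) x)
     = \<one>\<^bsub>relative_homology_group (k - 2) (skel_space K (k - 2)) T\<^esub>"
proof -
  let ?A = "\<Union>(skel K (k - 1))" and ?B = "\<Union>(skel K (k - 2))" and ?Z = "skel_space K (k - 1)"
  have Z: "subtopology (skel_space K k) ?A = ?Z" "subtopology ?Z ?B = skel_space K (k - 2)"
    by (simp_all add: subtopology_skel_space)
  let ?y = "hom_boundary k (skel_space K k) ?A x"
  have "?y \<in> carrier (homology_group (k - 1) ?Z)"
    using hom_boundary_carrier[of k "skel_space K k" ?A x] by (simp add: Z)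
  moreover have "kernel (relative_homology_group (k - 1) ?Z ?B) (homology_group (k - 2) (skel_space K (k - 2)))
      (hom_boundary (k - 1) ?Z ?B) = hom_induced (k - 1) ?Z {} ?Z ?B id ` carrier (homology_group (k - 1) ?Z)"
    using homology_exactness_axiom_1[of "k - 1" ?Z ?B] by (simp add: Z)
  ultimately have "hom_boundary (k - 1) ?Z ?B (hom_induced (k - 1) ?Z {} ?Z ?B id ?y) =
      \<one>\<^bsub>homology_group (k - 2) (skel_space K (k - 2))\<^esub>"
    by (auto simp: kernel_def)
  moreover have "hom_induced (k - 2) (skel_space K (k - 2)) {} (skel_space K (k - 2)) T id
      \<one>\<^bsub>homology_group (k - 2) (skel_space K (k - 2))\<^esub>
      = \<one>\<^bsub>relative_homology_group (k - 2) (skel_space K (k - 2)) T\<^esub>"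
    by (rule hom_one[OF hom_induced_hom]) auto
  ultimately show ?thesis
    by (simp add: hom_relboundary_def Z)
qed

text \<open>The augmentation of the vertices factors through the homology of the 1-skeleton, where
  boundaries of edges vanish.\<close>

lemma boundary_vertices: "(\<Sum>\<tau>\<in>cells K 0. incidence K 1 \<sigma> \<tau>) = 0"
proof -
  let ?X0 = "skel_space K 0" and ?X1 = "skel_space K 1" and ?S = "\<Union>(skel K 0)"
  let ?D = "unit_disk 0" and ?o = "\<lambda>_ i. 0 :: real"
  let ?G = "homology_group 0 ?X0" and ?H = "homology_group 0 ?D"
  let ?aug = "hom_induced 0 ?X0 {} ?D {} ?o"
  have X0: "subtopology ?X1 ?S = ?X0" by (simp add: subtopology_skel_space)
  have skm: "\<Union>(skel K (-1)) = {}" by (simp add: Union_skel)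
  have G: "skel_group K 0 = ?G" by (simp add: skel_group_def skm)
  have cont: "continuous_map Z ?D ?o" for Z :: "'z topology"
    by (simp add: topspace_unit_disk_0)
  have gen: "free_generator ?H (disk_class 0)"
    using free_generator_disk_class[of 0] by (simp add: disk_boundary_0)
  then have dc: "disk_class 0 \<in> carrier ?H" by (simp add: free_generator_def)
  interpret H: comm_group ?H by simp
  let ?z = "hom_boundary 1 ?X1 ?S (cell_class K 1 \<sigma>)"
  have z: "?z = comb ?G (cells K 0) (cell_class K 0) (incidence K 1 \<sigma>)"
    using incidence_spec(2)[of 1 \<sigma>] by (simp add: skm hom_relboundary_empty G)
  have "hom_induced 0 ?X0 {} ?X1 {} id ?z = \<one>\<^bsub>homology_group 0 ?X1\<^esub>"
  proof -
    \<comment> \<open>Outside the carrier \<open>hom_boundary\<close> has the neutral element as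
      default value; in either case the image in the 1-skeleton is trivial.\<close>
    have "?z \<in> hom_boundary 1 ?X1 ?S ` carrier (relative_homology_group 1 ?X1 ?S)
        \<or> ?z = \<one>\<^bsub>?G\<^esub>"
      using hom_boundary_default[of "cell_class K 1 \<sigma>" 1 ?X1 ?S] by (auto simp: X0)
    moreover have "kernel ?G (homology_group 0 ?X1) (hom_induced 0 ?X0 {} ?X1 {} id) =
        hom_boundary 1 ?X1 ?S ` carrier (relative_homology_group 1 ?X1 ?S)"
      using homology_exactness_axiom_2[of 1 ?X1 ?S] by (simp add: X0)
    ultimately show ?thesis
      using hom_one[OF hom_induced_hom[of 0 ?X0 "{}" ?X1 "{}" id]] by (auto simp: kernel_def)
  qed
  moreover have "?aug ?z = hom_induced 0 ?X1 {} ?D {} ?o (hom_induced 0 ?X0 {} ?X1 {} id ?z)"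
    using cont X0 by (subst hom_induced_compose') (auto simp: o_def continuous_map_from_subtopology simp flip: X0)
  ultimately have "?aug ?z = \<one>\<^bsub>?H\<^esub>"
    using hom_one[OF hom_induced_hom[of 0 ?X1 "{}" ?D "{}" ?o]] by simp
  moreover have "?aug ?z = comb ?H (cells K 0) (?aug \<circ> cell_class K 0) (incidence K 1 \<sigma>)"
    unfolding z using cell_class_closed[of 0] by (intro comb_hom) (auto simp: hom_induced_hom finite_cells G)
  moreover have "?aug (cell_class K 0 e) = disk_class 0" if "e \<in> cells K 0" for e
  proof -
    have e: "e \<in> open_cells K 0" using that by (simp add: cells_def)
    then have "e \<subseteq> \<Union>(skel K 0)" by (auto simp: Union_skel)
    moreover have "char_map K e ` topspace ?D = e"
      using image_open_disk[OF e] disk_diff_boundary[of 0] by (simp add: disk_boundary_0)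
    ultimately have "continuous_map ?D ?X0 (char_map K e)"
      using char_map(1)[OF e] by (auto simp: skel_space_def continuous_map_in_subtopology)
    moreover have "cell_class K 0 e = hom_induced 0 ?D {} ?X0 {} (char_map K e) (disk_class 0)"
      by (simp add: cell_class_def disk_boundary_0 skm)
    ultimately have "?aug (cell_class K 0 e) = hom_induced 0 ?D {} ?D {} (?o \<circ> char_map K e) (disk_class 0)"
      by (simp only:) (rule hom_induced_compose', auto simp: topspace_unit_disk_0)
    also have "\<dots> = disk_class 0"
      using cont dc by (intro hom_induced_id_gen) (auto simp: o_def topspace_unit_disk_0)
    finally show ?thesis .
  qed
  ultimately have "\<one>\<^bsub>?H\<^esub> = comb ?H (cells K 0) (\<lambda>_. disk_class 0) (incidence K 1 \<sigma>)"
    using dc by (subst (asm) comb_cong[where b' = "\<lambda>_. disk_class 0"]) auto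
  \<comment> \<open>Writing the constant class as a combination over a one-point index set lets
    \<open>comb_comb\<close> collect the exponents into their sum.\<close>
  also have "\<dots> = comb ?H (cells K 0) (\<lambda>e. comb ?H {()} (\<lambda>_. disk_class 0) (\<lambda>_. 1)) (incidence K 1 \<sigma>)"
    using dc by (simp add: comb_def)
  also have "\<dots> = disk_class 0 [^]\<^bsub>?H\<^esub> (\<Sum>\<tau>\<in>cells K 0. incidence K 1 \<sigma> \<tau>)"
    using dc by (subst H.comb_comb) (auto simp: finite_cells comb_def)
  finally have "disk_class 0 [^]\<^bsub>?H\<^esub> (0::int) =
      disk_class 0 [^]\<^bsub>?H\<^esub> (\<Sum>\<tau>\<in>cells K 0. incidence K 1 \<sigma> \<tau>)"
    by simp
  then show ?thesis
    using gen dc H.int_pow_closed unfolding free_generator_def by metis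
qed

text \<open>For \<open>k \<ge> 2\<close> these sums are the coefficients of the doubled boundary in
  the basis of (k-2)-cells, hence zero by uniqueness. Degree 1 is separate because the boundary of a
  vertex is an augmentation, not a connecting map.\<close>

lemma incidence_incidence:
  "(\<Sum>\<tau>\<in>cells K (k - 1). incidence K k \<sigma> \<tau> * incidence K (k - 1) \<tau> \<rho>) = 0"
proof -
  consider "k \<le> 0" | "k = 1" | "k \<ge> 2" by linarith
  then show ?thesis
  proof cases
    case 1
    then show ?thesis by (simp add: incidence_def)
  next
    case 2
    then show ?thesis using boundary_vertices[of \<sigma>] by (simp add: incidence_def[of K 0])
  next
    case 3
    let ?G = "skel_group K (k - 1)" and ?H = "skel_group K (k - 2)"
    let ?h = "hom_relboundary (k - 1) (skel_space K (k - 1)) (\<Union>(skel K (k - 2))) (\<Union>(skel K (k - 3)))"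
    interpret G: comm_group ?G by (rule comm_group_skel_group)
    interpret H: comm_group ?H by (rule comm_group_skel_group)
    have hom: "?h \<in> hom ?G ?H"
      using group_homomorphism_hom_relboundary[of "k - 1" "skel_space K (k - 1)" "\<Union>(skel K (k - 2))" "\<Union>(skel K (k - 3))"]
      by (simp add: skel_group_def subtopology_skel_space)
    let ?m = "\<lambda>\<rho>. \<Sum>\<tau>\<in>cells K (k - 1). incidence K k \<sigma> \<tau> * incidence K (k - 1) \<tau> \<rho>"
    have "comb ?H (cells K (k - 2)) (cell_class K (k - 2)) ?m =
        comb ?H (cells K (k - 1)) (\<lambda>\<tau>. comb ?H (cells K (k - 2)) (cell_class K (k - 2)) (incidence K (k - 1) \<tau>))
          (incidence K k \<sigma>)"
      by (subst H.comb_comb) (auto simp: finite_cells cell_class_closed)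
    also have "\<dots> = comb ?H (cells K (k - 1)) (?h \<circ> cell_class K (k - 1)) (incidence K k \<sigma>)"
      using incidence_spec(2)[of "k - 1"] 3 H.comb_closed[OF cell_class_closed]
      by (intro comb_cong) (auto simp: comm_group_skel_group)
    also have "\<dots> = ?h (comb ?G (cells K (k - 1)) (cell_class K (k - 1)) (incidence K k \<sigma>))"
      by (rule comb_hom[symmetric, OF hom]) (auto simp: comm_group_skel_group finite_cells cell_class_closed)
    also have "\<dots> = ?h (hom_relboundary k (skel_space K k) (\<Union>(skel K (k - 1))) (\<Union>(skel K (k - 2))) (cell_class K k \<sigma>))"
      using 3 by (simp add: incidence_spec(2))
    also have "\<dots> = \<one>\<^bsub>?H\<^esub>"
      using 3 relboundary_relboundary[of k] by (simp add: skel_group_def)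
    also have "\<dots> = comb ?H (cells K (k - 2)) (cell_class K (k - 2)) (\<lambda>_. 0)"
      by (simp add: H.comb_zero cell_class_closed)
    finally have eq: "comb ?H (cells K (k - 2)) (cell_class K (k - 2)) ?m =
        comb ?H (cells K (k - 2)) (cell_class K (k - 2)) (\<lambda>_. 0)" .
    have "zbasis ?H (cells K (k - 2)) (cell_class K (k - 2))"
      using zbasis_skel_group[of "nat (k - 2)"] cells_int[of K "nat (k - 2)"] 3 by simp
    then have "?m = (\<lambda>_. 0)"
      by (rule zbasis_unique[OF _ comm_group_skel_group eq])
        (use incidence_support[of _ "k - 1"] in auto)
    then show ?thesis by metis
  qed
qed

end

section \<open>Lattice indices and determinants\<close>

lemma card_image_same_kernel:
  assumes "\<And>x y. x \<in> A \<Longrightarrow> y \<in> A \<Longrightarrow> p x = p y \<longleftrightarrow> q x = q y"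
  shows "card (p ` A) = card (q ` A)"
proof (rule bij_betw_same_card)
  have inv: "inv_into A p (p x) \<in> A" "p (inv_into A p (p x)) = p x" if "x \<in> A" for x
    using that by (auto intro: inv_into_into f_inv_into_f)
  then have "q (inv_into A p (p x)) = q x" if "x \<in> A" for x
    using that assms by metis
  then have "bij_betw (\<lambda>u. q (inv_into A p u)) (p ` A) (q ` A)"
    unfolding bij_betw_def inj_on_def
    using assms by (auto simp: image_image intro!: image_cong)
  then show "bij_betw (\<lambda>u. q (inv_into A p u)) (p ` A) (q ` A)" .
qed

definition add_subgroup :: "'g::ab_group_add set \<Rightarrow> bool"
  where "add_subgroup H \<longleftrightarrow> 0 \<in> H \<and> (\<forall>x\<in>H. \<forall>y\<in>H. x - y \<in> H)"

text \<open>An infinite index is recorded as 0, so positivity expresses finiteness, and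
  multiplicativity in towers holds in general.\<close>

definition coset_index :: "'g::ab_group_add set \<Rightarrow> 'g set \<Rightarrow> nat"
  where "coset_index G H = card ((\<lambda>x. (+) x ` H) ` G)"

lemma add_subgroupD:
  assumes "add_subgroup H"
  shows add_subgroup_0: "0 \<in> H" and add_subgroup_diff: "x \<in> H \<Longrightarrow> y \<in> H \<Longrightarrow> x - y \<in> H"
    and add_subgroup_uminus: "x \<in> H \<Longrightarrow> - x \<in> H" and add_subgroup_add: "x \<in> H \<Longrightarrow> y \<in> H \<Longrightarrow> x + y \<in> H"
proof -
  show 0: "0 \<in> H" and d: "x \<in> H \<Longrightarrow> y \<in> H \<Longrightarrow> x - y \<in> H" for x y
    using assms by (auto simp: add_subgroup_def)
  show u: "x \<in> H \<Longrightarrow> - x \<in> H" for x using d[OF 0, of x] by simp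
  show "x \<in> H \<Longrightarrow> y \<in> H \<Longrightarrow> x + y \<in> H" using d[OF _ u, of x y] by simp
qed

lemma coset_eq_iff:
  assumes "add_subgroup H" shows "(+) x ` H = (+) y ` H \<longleftrightarrow> x - y \<in> H"
proof
  assume "(+) x ` H = (+) y ` H"
  then have "x + 0 \<in> (+) y ` H" using add_subgroup_0[OF assms] by blast
  then show "x - y \<in> H" by auto
next
  assume d: "x - y \<in> H"
  have "(+) a ` H \<subseteq> (+) b ` H" if "a - b \<in> H" for a b
  proof
    fix z assume "z \<in> (+) a ` H"
    then obtain h where "h \<in> H" "z = b + ((a - b) + h)" by auto
    then show "z \<in> (+) b ` H" using that add_subgroup_add[OF assms] by blast
  qed
  from this[OF d] this[of y x] add_subgroup_uminus[OF assms d] show "(+) x ` H = (+) y ` H" by auto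
qed

lemma coset_index_card:
  assumes "add_subgroup H" "\<And>x y. x \<in> G \<Longrightarrow> y \<in> G \<Longrightarrow> q x = q y \<longleftrightarrow> x - y \<in> H"
  shows "coset_index G H = card (q ` G)"
  unfolding coset_index_def using assms by (intro card_image_same_kernel) (simp add: coset_eq_iff)

lemma coset_index_hom:
  assumes "add_subgroup H" "add_subgroup H'"
    and "\<And>x y. x \<in> G \<Longrightarrow> y \<in> G \<Longrightarrow> f x - f y \<in> H' \<longleftrightarrow> x - y \<in> H"
  shows "coset_index G H = coset_index (f ` G) H'"
proof -
  have "coset_index G H = card ((\<lambda>x. (+) (f x) ` H') ` G)"
    using assms by (intro coset_index_card) (auto simp: coset_eq_iff)
  then show ?thesis by (simp add: coset_index_def image_image)
qed

text \<open>The representative \<open>r x\<close> depends only on the coset modulo \<open>H\<close>.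
  Sending \<open>x\<close> to that coset and to the coset of \<open>x - r x\<close> modulo
  \<open>K\<close> identifies G/K with the product of G/H and H/K.\<close>

lemma coset_index_mult:
  assumes G: "add_subgroup G" and H: "add_subgroup H" and K: "add_subgroup K"
    and "H \<subseteq> G" "K \<subseteq> H"
  shows "coset_index G K = coset_index G H * coset_index H K"
proof -
  define r where "r x = (SOME z. z \<in> (+) x ` H)" for x
  have "r x \<in> (+) x ` H" for x
    unfolding r_def using add_subgroup_0[OF H] by (metis imageI someI_ex)
  then have "\<exists>h\<in>H. r x = x + h" for x by blast
  then have "- (x - r x) \<in> H" for x by (metis add_diff_cancel_left' minus_diff_eq)
  then have r: "x - r x \<in> H" for x using add_subgroup_uminus[OF H] by (metis minus_minus)
  have r_eq: "r x = r y" if "x - y \<in> H" for x y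
    using coset_eq_iff[OF H, of x y] that by (simp add: r_def)
  have r_iff: "(+) x ` H = (+) y ` H \<longleftrightarrow> r x = r y" for x y
  proof
    assume "r x = r y"
    then have "(x - r x) - (y - r y) = x - y" by simp
    then have "x - y \<in> H" using add_subgroup_diff[OF H r[of x] r[of y]] by simp
    then show "(+) x ` H = (+) y ` H" using coset_eq_iff[OF H] by blast
  qed (simp add: r_def)
  let ?p = "\<lambda>x. ((+) x ` H, (+) (x - r x) ` K)"
  have "coset_index G K = card (?p ` G)"
  proof (rule coset_index_card[OF K])
    fix x y
    show "?p x = ?p y \<longleftrightarrow> x - y \<in> K"
    proof
      assume "?p x = ?p y"
      then have "(x - r x) - (y - r y) \<in> K" "r x = r y" by (auto simp: coset_eq_iff K r_iff)
      then show "x - y \<in> K" by simp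
    next
      assume xy: "x - y \<in> K"
      then have "r x = r y" using r_eq \<open>K \<subseteq> H\<close> by blast
      then show "?p x = ?p y" using xy by (simp add: r_iff coset_eq_iff K)
    qed
  qed
  also have "?p ` G = ((\<lambda>x. (+) x ` H) ` G) \<times> ((\<lambda>x. (+) x ` K) ` H)"
  proof
    show "?p ` G \<subseteq> ((\<lambda>x. (+) x ` H) ` G) \<times> ((\<lambda>x. (+) x ` K) ` H)" using r by auto
    show "((\<lambda>x. (+) x ` H) ` G) \<times> ((\<lambda>x. (+) x ` K) ` H) \<subseteq> ?p ` G"
    proof clarify
      fix x h assume x: "x \<in> G" and h: "h \<in> H"
      let ?z = "r x + h"
      have "r x = x - (x - r x)" by simp
      then have rG: "r x \<in> G" using r x \<open>H \<subseteq> G\<close> add_subgroup_diff[OF G] by (metis subsetD)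
      then have "?z \<in> G" using h \<open>H \<subseteq> G\<close> add_subgroup_add[OF G] by blast
      moreover have "x - ?z \<in> H"
        using add_subgroup_diff[OF H r h, of x] by (simp add: algebra_simps)
      then have "r x = r ?z" using r_eq by blast
      then have "?p ?z = ((+) x ` H, (+) h ` K)" by (simp add: r_iff)
      ultimately show "((+) x ` H, (+) h ` K) \<in> ?p ` G" by (intro image_eqI[of _ ?p ?z]) (rule sym)
    qed
  qed
  finally show ?thesis by (simp add: card_cartesian_product coset_index_def)
qed

definition supported :: "'k set \<Rightarrow> ('k \<Rightarrow> 'b::zero) set"
  where "supported S = {x. \<forall>a. a \<notin> S \<longrightarrow> x a = 0}"

definition int_lattice :: "'i set \<Rightarrow> ('i \<Rightarrow> 'k \<Rightarrow> int) \<Rightarrow> ('k \<Rightarrow> int) set"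
  where "int_lattice I v = range (\<lambda>c x. \<Sum>j\<in>I. c j * v j x)"

lemma add_subgroup_supported: "add_subgroup (supported S :: ('k \<Rightarrow> 'b::ab_group_add) set)"
  by (auto simp: add_subgroup_def supported_def)

lemma add_subgroup_scale:
  assumes "add_subgroup H" "v \<in> H" shows "(\<lambda>x. n * v x :: int) \<in> H"
proof (induction n rule: int_induct[where k = 0])
  case base
  then show ?case using add_subgroup_0[OF assms(1)] by (simp add: zero_fun_def)
next
  case (step1 i)
  then show ?case using add_subgroup_add[OF assms(1) step1(2) assms(2)]
    by (simp add: plus_fun_def algebra_simps)
next
  case (step2 i)
  then show ?case using add_subgroup_diff[OF assms(1) step2(2) assms(2)]
    by (simp add: fun_diff_def algebra_simps)
qed

lemma add_subgroup_lattice: "add_subgroup (int_lattice I v)"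
  unfolding add_subgroup_def int_lattice_def
proof (intro conjI ballI)
  show "0 \<in> range (\<lambda>c x. \<Sum>j\<in>I. c j * v j x)"
    by (rule range_eqI[of _ _ "\<lambda>_. 0"]) (simp add: zero_fun_def)
  fix x y assume "x \<in> range (\<lambda>c x. \<Sum>j\<in>I. c j * v j x)" "y \<in> range (\<lambda>c x. \<Sum>j\<in>I. c j * v j x)"
  then obtain c c' where "x = (\<lambda>x. \<Sum>j\<in>I. c j * v j x)" "y = (\<lambda>x. \<Sum>j\<in>I. c' j * v j x)" by auto
  then show "x - y \<in> range (\<lambda>c x. \<Sum>j\<in>I. c j * v j x)"
    by (intro range_eqI[of _ _ "\<lambda>j. c j - c' j"]) (simp add: fun_eq_iff sum_subtractf algebra_simps)
qed

lemma lattice_subset: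
  assumes "finite I" "add_subgroup H" "\<And>j. j \<in> I \<Longrightarrow> v j \<in> H"
  shows "int_lattice I v \<subseteq> H"
proof -
  have "(\<lambda>x. \<Sum>j\<in>I. c j * v j x) \<in> H" for c
    using assms(1,3)
  proof (induction I)
    case empty
    then show ?case using add_subgroup_0[OF assms(2)] by (simp add: zero_fun_def)
  next
    case (insert i I)
    then show ?case
      using add_subgroup_add[OF assms(2) add_subgroup_scale[OF assms(2), of "v i" "c i"]]
      by (simp add: plus_fun_def)
  qed
  then show ?thesis by (auto simp: int_lattice_def)
qed

lemma lattice_generator:
  assumes "finite I" "j \<in> I" shows "v j \<in> int_lattice I v"
proof -
  have "v j x = (\<Sum>i\<in>I. (if i = j then 1 else 0) * v i x)" for x
    using assms by (simp add: if_distrib[of "\<lambda>t. t * _"] cong: if_cong)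
  then show ?thesis unfolding int_lattice_def by (intro range_eqI[of _ _ "\<lambda>i. if i = j then 1 else 0"]) auto
qed

lemma lattice_mono: "finite J \<Longrightarrow> I \<subseteq> J \<Longrightarrow> int_lattice I v \<subseteq> int_lattice J v"
  by (intro lattice_subset add_subgroup_lattice lattice_generator) (auto dest: finite_subset)

section \<open>The index of a full-rank lattice as a determinant\<close>

definition col_matrix :: "nat \<Rightarrow> (nat \<Rightarrow> nat \<Rightarrow> 'b) \<Rightarrow> 'b mat"
  where "col_matrix r v = mat r r (\<lambda>(a, b). v b a)"

lemma coset_index_dvd:
  fixes a :: int
  assumes "a \<noteq> 0" shows "coset_index UNIV {n. a dvd n} = nat \<bar>a\<bar>"
proof -
  have "coset_index UNIV {n. a dvd n} = card (range (\<lambda>n. n mod \<bar>a\<bar>))"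
    by (rule coset_index_card) (auto simp: add_subgroup_def mod_eq_dvd_iff)
  also have "range (\<lambda>n. n mod \<bar>a\<bar>) = {0..<\<bar>a\<bar>}"
    using assms by (auto intro!: range_eqI mod_pos_pos_trivial[symmetric])
  finally show ?thesis by simp
qed

lemma det_col_matrix_last_row:
  fixes v :: "nat \<Rightarrow> nat \<Rightarrow> 'b::comm_ring_1"
  assumes "\<And>j. j < r \<Longrightarrow> v j r = 0"
  shows "Determinant.det (col_matrix (Suc r) v) = v r r * Determinant.det (col_matrix r v)"
proof -
  let ?A = "col_matrix (Suc r) v"
  have "Determinant.det ?A = (\<Sum>j<Suc r. ?A $$ (r, j) * cofactor ?A r j)"
    by (rule laplace_expansion_row) (auto simp: col_matrix_def)
  also have "\<dots> = v r r * cofactor ?A r r"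
    using assms by (simp add: col_matrix_def)
  also have "mat_delete ?A r r = col_matrix r v"
    by (rule eq_matI) (auto simp: mat_delete_def col_matrix_def)
  then have "cofactor ?A r r = Determinant.det (col_matrix r v)"
    by (simp add: cofactor_def)
  finally show ?thesis .
qed

text \<open>The tower passes through the vectors whose last coordinate is divisible by
  \<open>v r r\<close>. On these, subtracting the multiple of \<open>v r\<close> that clears the
  last coordinate reduces the quotient to the problem of size \<open>r\<close>.\<close>

lemma coset_index_last_coordinate:
  assumes v: "\<And>j. j < Suc r \<Longrightarrow> v j \<in> supported {..<Suc r}"
    and 0: "\<And>j. j < r \<Longrightarrow> v j r = 0" and a: "v r r \<noteq> 0"
  shows "coset_index (supported {..<Suc r}) (int_lattice {..<Suc r} v) =
    nat \<bar>v r r\<bar> * coset_index (supported {..<r}) (int_lattice {..<r} v)"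
proof -
  let ?Z = "supported {..<Suc r} :: (nat \<Rightarrow> int) set" and ?L = "int_lattice {..<Suc r} v"
  let ?H = "{x \<in> ?Z. v r r dvd x r}"
  have sH: "add_subgroup ?H"
    using add_subgroup_supported[of "{..<Suc r}", where 'b = int] by (auto simp: add_subgroup_def)
  have LH: "?L \<subseteq> ?H"
  proof (rule lattice_subset[OF _ sH])
    fix j assume "j \<in> {..<Suc r}"
    then show "v j \<in> ?H" using v[of j] 0[of j] by (cases "j < r") (auto simp: less_Suc_eq)
  qed auto
  have "coset_index ?Z ?H = coset_index ((\<lambda>x. x r) ` ?Z) {n. v r r dvd n}"
    using add_subgroup_supported[of "{..<Suc r}", where 'b = int]
    by (intro coset_index_hom[OF sH]) (auto simp: add_subgroup_def)
  also have "(\<lambda>x. x r) ` ?Z = UNIV"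
  proof -
    have "n \<in> (\<lambda>x. x r) ` ?Z" for n
      by (rule image_eqI[of _ _ "\<lambda>i. if i = r then n else 0"]) (auto simp: supported_def)
    then show ?thesis by auto
  qed
  finally have 1: "coset_index ?Z ?H = nat \<bar>v r r\<bar>" using coset_index_dvd[OF a] by simp
  define f where "f x = (\<lambda>i. x i - (x r div v r r) * v r i)" for x
  have fdiff: "f x - f y = f (x - y)" if "x \<in> ?H" "y \<in> ?H" for x y
    using that by (auto simp: f_def fun_eq_iff div_diff algebra_simps)
  have fL: "f x \<in> int_lattice {..<r} v \<longleftrightarrow> x \<in> ?L" if x: "x \<in> ?H" for x
  proof
    assume "f x \<in> int_lattice {..<r} v"
    then have "f x \<in> ?L" using lattice_mono[of "{..<Suc r}" "{..<r}" v] by auto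
    moreover have "(\<lambda>i. (x r div v r r) * v r i) \<in> ?L"
      by (intro add_subgroup_scale add_subgroup_lattice lattice_generator) auto
    ultimately have "f x + (\<lambda>i. (x r div v r r) * v r i) \<in> ?L"
      by (rule add_subgroup_add[OF add_subgroup_lattice])
    then show "x \<in> ?L" by (simp add: f_def plus_fun_def)
  next
    assume "x \<in> ?L"
    then obtain c where c: "x = (\<lambda>i. \<Sum>j<Suc r. c j * v j i)" by (auto simp: int_lattice_def)
    then have "x r = c r * v r r" using 0 by simp
    then have "f x = (\<lambda>i. \<Sum>j<r. c j * v j i)"
      using a by (simp add: f_def fun_eq_iff) (simp add: c)
    then show "f x \<in> int_lattice {..<r} v" by (auto simp: int_lattice_def)
  qed
  have "coset_index ?H ?L = coset_index (f ` ?H) (int_lattice {..<r} v)"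
    using fdiff fL add_subgroup_diff[OF sH]
    by (intro coset_index_hom add_subgroup_lattice) auto
  also have "f ` ?H = supported {..<r}"
  proof
    show "f ` ?H \<subseteq> supported {..<r}"
    proof
      fix y assume "y \<in> f ` ?H"
      then obtain x where x: "x \<in> ?Z" "v r r dvd x r" "y = f x" by blast
      have "y i = 0" if "i \<ge> r" for i
      proof (cases "i = r")
        case False
        then have "i \<notin> {..<Suc r}" using that by simp
        then show ?thesis using x(1,3) v[of r] by (simp add: supported_def f_def)
      qed (use x in \<open>simp add: f_def\<close>)
      then show "y \<in> supported {..<r}" by (simp add: supported_def)
    qed
    show "supported {..<r} \<subseteq> f ` ?H"
    proof
      fix y :: "nat \<Rightarrow> int" assume "y \<in> supported {..<r}"
      then have "y \<in> ?H" "f y = y" by (auto simp: supported_def f_def)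
      then show "y \<in> f ` ?H" by (intro image_eqI[of y f y]) simp_all
    qed
  qed
  finally have 2: "coset_index ?H ?L = coset_index (supported {..<r}) (int_lattice {..<r} v)" .
  show ?thesis
    using coset_index_mult[OF add_subgroup_supported sH add_subgroup_lattice _ LH] 1 2 by auto
qed

lemma lattice_add_multiple:
  assumes "finite I" "k \<in> I" "j \<noteq> k"
  shows "int_lattice I (v(j := (\<lambda>x. v j x + q * v k x))) = int_lattice I v"
proof -
  have sub: "int_lattice I (w(j := (\<lambda>x. w j x + p * w k x))) \<subseteq> int_lattice I w" for w p
  proof (rule lattice_subset[OF assms(1) add_subgroup_lattice])
    fix i assume i: "i \<in> I"
    show "(w(j := (\<lambda>x. w j x + p * w k x))) i \<in> int_lattice I w"
    proof (cases "i = j")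
      case True
      have "w i + (\<lambda>x. p * w k x) \<in> int_lattice I w"
        using assms i by (intro add_subgroup_add add_subgroup_scale add_subgroup_lattice lattice_generator)
      then show ?thesis using True by (simp add: plus_fun_def)
    qed (use assms i in \<open>auto intro: lattice_generator\<close>)
  qed
  let ?w = "v(j := (\<lambda>x. v j x + q * v k x))"
  have "?w(j := (\<lambda>x. ?w j x + - q * ?w k x)) = v"
    using assms(3) by (auto simp: fun_eq_iff)
  then show ?thesis using sub[of v q] sub[of ?w "- q"] by auto
qed

lemma det_add_multiple:
  fixes v :: "nat \<Rightarrow> nat \<Rightarrow> 'b::comm_ring_1"
  assumes "k < r" "j < r" "j \<noteq> k"
  shows "Determinant.det (col_matrix r (v(j := (\<lambda>x. v j x + q * v k x)))) = Determinant.det (col_matrix r v)"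
proof -
  have "col_matrix r (v(j := (\<lambda>x. v j x + q * v k x))) = addcol q j k (col_matrix r v)"
    by (rule eq_matI) (use assms in \<open>auto simp: col_matrix_def add.commute\<close>)
  then show ?thesis using assms by (simp add: det_addcol[of _ r] col_matrix_def)
qed

text \<open>Euclid's algorithm on the last row brings the generators into block triangular form.\<close>

theorem coset_index_det:
  assumes "Determinant.det (col_matrix r v) \<noteq> (0::int)" "\<And>j. j < r \<Longrightarrow> v j \<in> supported {..<r}"
  shows "coset_index (supported {..<r}) (int_lattice {..<r} v) = nat \<bar>Determinant.det (col_matrix r v)\<bar>"
  using assms
proof (induction r arbitrary: v)
  case 0
  have "Determinant.det (col_matrix 0 v) = 1"
    by (rule det_dim_zero) (simp add: col_matrix_def)
  moreover have "int_lattice {} v = {0}" "(supported {} :: (nat \<Rightarrow> int) set) = {0}"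
    by (auto simp: int_lattice_def supported_def zero_fun_def)
  ultimately show ?case by (simp add: coset_index_def)
next
  case (Suc r)
  \<comment> \<open>The inner induction measures the sum of the absolute values in the last row,
    which every column operation below decreases.\<close>
  from Suc.prems show ?case
  proof (induction "\<Sum>j<Suc r. nat \<bar>v j r\<bar>" arbitrary: v rule: less_induct)
    case less
    show ?case
    proof (cases "\<exists>j<Suc r. \<exists>k<Suc r. j \<noteq> k \<and> v k r \<noteq> 0 \<and> \<bar>v k r\<bar> \<le> \<bar>v j r\<bar>")
      case True
      then obtain j k where jk: "j < Suc r" "k < Suc r" "j \<noteq> k" "v k r \<noteq> 0" "\<bar>v k r\<bar> \<le> \<bar>v j r\<bar>"
        by blast
      \<comment> \<open>The sign is chosen so that adding \<open>q\<close> times the smaller entry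
        reduces the larger one: a subtractive step of Euclid's algorithm.\<close>
      define q where "q = - sgn (v j r) * sgn (v k r)"
      let ?w = "v(j := (\<lambda>x. v j x + q * v k x))"
      have small: "nat \<bar>v j r + q * v k r\<bar> < nat \<bar>v j r\<bar>"
      proof -
        have "v j r > 0 \<or> v j r < 0" "v k r > 0 \<or> v k r < 0" using jk by linarith+
        then have "q = 1 \<and> (v j r > 0 \<longleftrightarrow> v k r < 0) \<or> q = -1 \<and> (v j r > 0 \<longleftrightarrow> v k r > 0)"
          by (auto simp: q_def)
        moreover have "\<bar>v j r\<bar> \<ge> \<bar>v k r\<bar>" "v k r \<noteq> 0" using jk by auto
        ultimately have "\<bar>v j r + q * v k r\<bar> < \<bar>v j r\<bar>"
          by (elim disjE conjE) (auto simp: abs_if split: if_splits)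
        then show ?thesis by simp
      qed
      have "(\<Sum>i<Suc r. nat \<bar>?w i r\<bar>) < (\<Sum>i<Suc r. nat \<bar>v i r\<bar>)"
      proof (rule sum_strict_mono_ex1)
        show "\<forall>i\<in>{..<Suc r}. nat \<bar>?w i r\<bar> \<le> nat \<bar>v i r\<bar>" using small by auto
        show "\<exists>i\<in>{..<Suc r}. nat \<bar>?w i r\<bar> < nat \<bar>v i r\<bar>"
          using small jk by (intro bexI[of _ j]) auto
      qed simp
      moreover have "Determinant.det (col_matrix (Suc r) ?w) = Determinant.det (col_matrix (Suc r) v)"
        using jk by (intro det_add_multiple) auto
      moreover have "int_lattice {..<Suc r} ?w = int_lattice {..<Suc r} v"
        using jk by (intro lattice_add_multiple) auto
      moreover have "?w i \<in> supported {..<Suc r}" if "i < Suc r" for i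
        using less.prems(2) that jk by (auto simp: supported_def)
      ultimately show ?thesis
        using less.hyps[of ?w] less.prems(1) by simp
    next
      \<comment> \<open>Now at most one entry of the last row is nonzero, and one must be since the
        determinant is nonzero; exchanging columns moves it into the corner.\<close>
      case False
      obtain k where k: "k < Suc r" "v k r \<noteq> 0"
      proof -
        have "Determinant.det (col_matrix (Suc r) v) = (\<Sum>j<Suc r. col_matrix (Suc r) v $$ (r, j) * cofactor (col_matrix (Suc r) v) r j)"
          by (rule laplace_expansion_row) (auto simp: col_matrix_def)
        then obtain j where "j < Suc r" "col_matrix (Suc r) v $$ (r, j) \<noteq> 0"
          using less.prems(1) by (metis (no_types, lifting) lessThan_iff mult_zero_left sum.neutral)
        then show ?thesis using that by (simp add: col_matrix_def)
      qed
      have z: "v j r = 0" if "j < Suc r" "j \<noteq> k" for j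
      proof (rule ccontr)
        assume "v j r \<noteq> 0"
        then show False using False k that by (metis linorder_le_cases)
      qed
      define w where "w = v(k := v r, r := v k)"
      have lat: "int_lattice {..<Suc r} w = int_lattice {..<Suc r} v"
      proof
        show "int_lattice {..<Suc r} w \<subseteq> int_lattice {..<Suc r} v"
          using k by (intro lattice_subset add_subgroup_lattice) (auto simp: w_def intro: lattice_generator)
        have "v j \<in> int_lattice {..<Suc r} w" if "j < Suc r" for j
        proof -
          let ?s = "if j = r then k else if j = k then r else j"
          have "w ?s = v j" by (auto simp: w_def)
          then show ?thesis using lattice_generator[of "{..<Suc r}" ?s w] k that by (auto split: if_splits)
        qed
        then show "int_lattice {..<Suc r} v \<subseteq> int_lattice {..<Suc r} w"
          by (intro lattice_subset add_subgroup_lattice) auto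
      qed
      have det: "\<bar>Determinant.det (col_matrix (Suc r) w)\<bar> = \<bar>Determinant.det (col_matrix (Suc r) v)\<bar>"
      proof (cases "k = r")
        case True
        then show ?thesis by (simp add: w_def)
      next
        case False
        have "col_matrix (Suc r) w = swapcols k r (col_matrix (Suc r) v)"
          by (rule eq_matI) (use k in \<open>auto simp: col_matrix_def w_def\<close>)
        then show ?thesis using False k by (simp add: det_swapcols[of _ "Suc r"] col_matrix_def)
      qed
      have w: "w j \<in> supported {..<Suc r}" if "j < Suc r" for j
        using less.prems(2) that k by (auto simp: w_def)
      have w0: "w j r = 0" if "j < r" for j
        using z[of j] z[of r] that k by (auto simp: w_def)
      have wr: "w r r \<noteq> 0" using k by (simp add: w_def)
      have d: "Determinant.det (col_matrix (Suc r) w) = w r r * Determinant.det (col_matrix r w)"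
        by (rule det_col_matrix_last_row) (rule w0)
      have "w j \<in> supported {..<r}" if "j < r" for j
        using w[of j] w0[OF that] that by (auto simp: supported_def) (metis less_antisym)
      moreover have "Determinant.det (col_matrix r w) \<noteq> 0"
        using d det less.prems(1) by auto
      ultimately have "coset_index (supported {..<r}) (int_lattice {..<r} w) = nat \<bar>Determinant.det (col_matrix r w)\<bar>"
        by (intro Suc.IH)
      then have "coset_index (supported {..<Suc r}) (int_lattice {..<Suc r} w) =
          nat \<bar>Determinant.det (col_matrix (Suc r) w)\<bar>"
        using coset_index_last_coordinate[where v = w and r = r, OF w w0 wr] by (simp add: d abs_mult nat_mult_distrib)
      then show ?thesis by (simp add: lat det)
    qed
  qed
qed

text \<open>The Cauchy--Binet formula for a Gram determinant, with each row subset counted once for each of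
  its enumerations.\<close>

lemma gram_expansion:
  fixes D :: "nat \<Rightarrow> 'k \<Rightarrow> 'b::comm_ring_1"
  assumes R: "finite R"
  shows "of_nat (fact r) * Determinant.det (mat r r (\<lambda>(a, b). \<Sum>x\<in>R. D a x * D b x)) =
    (\<Sum>f\<in>{0..<r} \<rightarrow>\<^sub>E R. (Determinant.det (col_matrix r (\<lambda>b a. D b (f a))))\<^sup>2)"
proof -
  let ?U = "{0..<r}" and ?P = "{p. p permutes {0..<r}}"
  let ?F = "?U \<rightarrow>\<^sub>E R"
  define E where "E f = Determinant.det (col_matrix r (\<lambda>b a. D b (f a)))" for f
  \<comment> \<open>In \<open>E1\<close> the permutation acts on the column index, in
    \<open>E2\<close> on the row index. The first form absorbs the permutations of the Gram
    determinant, the second those introduced by rearranging \<open>f\<close>.\<close>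
  have E1: "E f = (\<Sum>p\<in>?P. signof p * (\<Prod>a\<in>?U. D (p a) (f a)))" for f
    unfolding E_def
    by (subst det_def'[of _ r]) (auto simp: col_matrix_def permutes_in_image intro!: sum.cong prod.cong arg_cong2[where f = "times"])
  have E2: "E f = (\<Sum>p\<in>?P. signof p * (\<Prod>a\<in>?U. D a (f (p a))))" for f
    unfolding E_def
    by (subst mat_det_left_def[of _ r]) (auto simp: col_matrix_def permutes_in_image intro!: sum.cong prod.cong arg_cong2[where f = "times"])
  have E3: "E (f \<circ> q) = signof q * E f" if q: "q permutes ?U" for f q
  proof -
    have "col_matrix r (\<lambda>b a. D b ((f \<circ> q) a)) =
        mat r r (\<lambda>(i, j). col_matrix r (\<lambda>b a. D b (f a)) $$ (q i, j))"
      by (rule eq_matI) (use permutes_in_image[OF q] in \<open>auto simp: col_matrix_def\<close>)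
    then show ?thesis
      unfolding E_def using det_permute_rows[OF _ q, of "col_matrix r (\<lambda>b a. D b (f a))"]
      by (simp add: col_matrix_def)
  qed
  have "Determinant.det (mat r r (\<lambda>(a, b). \<Sum>x\<in>R. D a x * D b x)) =
      (\<Sum>p\<in>?P. signof p * (\<Prod>a\<in>?U. \<Sum>x\<in>R. D a x * D (p a) x))"
    by (subst det_def'[of _ r]) (auto simp: permutes_in_image intro!: sum.cong prod.cong arg_cong2[where f = "times"])
  also have "\<dots> = (\<Sum>p\<in>?P. \<Sum>f\<in>?F. signof p * (\<Prod>a\<in>?U. D a (f a) * D (p a) (f a)))"
    using R by (simp add: prod.distrib sum_distrib_left prod_sum_PiE)
  also have "\<dots> = (\<Sum>f\<in>?F. (\<Prod>a\<in>?U. D a (f a)) * E f)"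
    by (subst sum.swap) (simp add: E1 prod.distrib sum_distrib_left mult_ac)
  finally have det: "Determinant.det (mat r r (\<lambda>(a, b). \<Sum>x\<in>R. D a x * D b x)) =
      (\<Sum>f\<in>?F. (\<Prod>a\<in>?U. D a (f a)) * E f)" .
  \<comment> \<open>Rearranging all \<open>f\<close> along \<open>q\<close> leaves the total
    unchanged. Summing over all \<open>q\<close> produces the factorial on one side and completes
    the diagonal product to a second determinant on the other.\<close>
  have "(\<Sum>f\<in>?F. (\<Prod>a\<in>?U. D a (f a)) * E f) = (\<Sum>f\<in>?F. (\<Prod>a\<in>?U. D a (f (q a))) * (signof q * E f))"
    if q: "q permutes ?U" for q
  proof -
    have inv: "inv_into UNIV q permutes ?U" by (rule permutes_inv[OF q])
    have mem: "f \<circ> p \<in> ?F" if "f \<in> ?F" "p permutes ?U" for f p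
      using that permutes_in_image[OF that(2)] permutes_not_in[OF that(2)]
      by (auto simp: PiE_iff extensional_def)
    have "(\<Sum>f\<in>?F. (\<Prod>a\<in>?U. D a (f a)) * E f) = (\<Sum>f\<in>?F. (\<Prod>a\<in>?U. D a ((f \<circ> q) a)) * E (f \<circ> q))"
      by (rule sum.reindex_bij_witness[where i = "\<lambda>f. f \<circ> q" and j = "\<lambda>f. f \<circ> inv_into UNIV q"])
        (use mem q inv in \<open>auto simp: o_assoc[symmetric] permutes_inv_o\<close>)
    then show ?thesis by (simp add: E3[OF q])
  qed
  then have "(\<Sum>q\<in>?P. (\<Sum>f\<in>?F. (\<Prod>a\<in>?U. D a (f a)) * E f)) =
      (\<Sum>q\<in>?P. (\<Sum>f\<in>?F. (\<Prod>a\<in>?U. D a (f (q a))) * (signof q * E f)))"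
    by (rule sum.cong[OF refl]) simp
  also have "\<dots> = (\<Sum>f\<in>?F. \<Sum>q\<in>?P. (\<Prod>a\<in>?U. D a (f (q a))) * (signof q * E f))"
    by (rule sum.swap)
  also have "\<dots> = (\<Sum>f\<in>?F. (E f)\<^sup>2)"
  proof (rule sum.cong)
    fix f assume "f \<in> ?F"
    have "(\<Sum>q\<in>?P. (\<Prod>a\<in>?U. D a (f (q a))) * (signof q * E f)) =
        (\<Sum>q\<in>?P. signof q * (\<Prod>a\<in>?U. D a (f (q a)))) * E f"
      unfolding sum_distrib_right by (intro sum.cong) (simp_all add: mult_ac)
    then show "(\<Sum>q\<in>?P. (\<Prod>a\<in>?U. D a (f (q a))) * (signof q * E f)) = (E f)\<^sup>2"
      by (simp add: E2[symmetric] power2_eq_square)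
  qed simp
  finally show ?thesis
    by (simp add: det E_def card_permutations[of ?U r])
qed

lemma real_det_col_matrix:
  "Determinant.det (col_matrix r (\<lambda>b a. real_of_int (v b a))) = real_of_int (Determinant.det (col_matrix r v))"
proof -
  have "col_matrix r (\<lambda>b a. real_of_int (v b a)) = map_mat real_of_int (col_matrix r v)"
    by (rule eq_matI) (auto simp: col_matrix_def)
  then show ?thesis by simp
qed

lemma det_col_matrix_eq_0_iff:
  fixes v :: "nat \<Rightarrow> nat \<Rightarrow> 'b::field"
  shows "Determinant.det (col_matrix r v) = 0 \<longleftrightarrow>
    (\<exists>c. (\<exists>b<r. c b \<noteq> 0) \<and> (\<forall>a<r. (\<Sum>b<r. c b * v b a) = 0))"
proof -
  let ?A = "col_matrix r v"
  have A: "?A \<in> carrier_mat r r" by (simp add: col_matrix_def)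
  have mult: "?A *\<^sub>v y = 0\<^sub>v r \<longleftrightarrow> (\<forall>a<r. (\<Sum>b<r. y $ b * v b a) = 0)" if "y \<in> carrier_vec r" for y
    using that by (auto simp: vec_eq_iff col_matrix_def scalar_prod_def mult.commute atLeast0LessThan)
  show ?thesis
    unfolding det_0_iff_vec_prod_zero_field[OF A]
  proof
    assume "\<exists>y. y \<in> carrier_vec r \<and> y \<noteq> 0\<^sub>v r \<and> ?A *\<^sub>v y = 0\<^sub>v r"
    then obtain y where y: "y \<in> carrier_vec r" "y \<noteq> 0\<^sub>v r" "?A *\<^sub>v y = 0\<^sub>v r" by blast
    then show "\<exists>c. (\<exists>b<r. c b \<noteq> 0) \<and> (\<forall>a<r. (\<Sum>b<r. c b * v b a) = 0)"
      using mult[OF y(1)] by (intro exI[of _ "\<lambda>b. y $ b"]) (auto simp: vec_eq_iff)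
  next
    assume "\<exists>c. (\<exists>b<r. c b \<noteq> 0) \<and> (\<forall>a<r. (\<Sum>b<r. c b * v b a) = 0)"
    then obtain c b where c: "b < r" "c b \<noteq> 0" "\<forall>a<r. (\<Sum>b<r. c b * v b a) = 0" by blast
    then have "vec r c \<noteq> 0\<^sub>v r" by (auto simp: vec_eq_iff)
    moreover have "?A *\<^sub>v vec r c = 0\<^sub>v r" using c by (subst mult) auto
    ultimately show "\<exists>y. y \<in> carrier_vec r \<and> y \<noteq> 0\<^sub>v r \<and> ?A *\<^sub>v y = 0\<^sub>v r" by (metis vec_carrier)
  qed
qed

text \<open>Pairing a kernel vector of the Gram matrix with itself gives a sum of squares over the
  rows, so the same combination of the columns vanishes.\<close>

lemma det_gram_nonzero:
  fixes D :: "nat \<Rightarrow> 'k \<Rightarrow> real"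
  assumes R: "finite R"
    and indep: "\<And>c. (\<And>x. x \<in> R \<Longrightarrow> (\<Sum>b<r. c b * D b x) = 0) \<Longrightarrow> (\<And>b. b < r \<Longrightarrow> c b = 0)"
  shows "Determinant.det (mat r r (\<lambda>(a, b). \<Sum>x\<in>R. D a x * D b x)) \<noteq> 0"
proof
  assume "Determinant.det (mat r r (\<lambda>(a, b). \<Sum>x\<in>R. D a x * D b x)) = 0"
  then have "Determinant.det (col_matrix r (\<lambda>b a. \<Sum>x\<in>R. D a x * D b x)) = 0"
    by (simp add: col_matrix_def)
  then obtain c b where b: "b < r" "c b \<noteq> 0"
    and c: "\<And>a. a < r \<Longrightarrow> (\<Sum>b<r. c b * (\<Sum>x\<in>R. D a x * D b x)) = 0"
    unfolding det_col_matrix_eq_0_iff by blast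
  have "(\<Sum>x\<in>R. (\<Sum>b<r. c b * D b x)\<^sup>2) = (\<Sum>x\<in>R. \<Sum>a<r. \<Sum>b<r. c a * D a x * (c b * D b x))"
    by (simp add: power2_eq_square sum_product)
  also have "\<dots> = (\<Sum>a<r. \<Sum>x\<in>R. \<Sum>b<r. c a * D a x * (c b * D b x))"
    by (rule sum.swap)
  also have "\<dots> = (\<Sum>a<r. \<Sum>b<r. \<Sum>x\<in>R. c a * D a x * (c b * D b x))"
    by (intro sum.cong refl sum.swap)
  also have "\<dots> = (\<Sum>a<r. c a * (\<Sum>b<r. c b * (\<Sum>x\<in>R. D a x * D b x)))"
    by (simp add: sum_distrib_left mult_ac)
  also have "\<dots> = 0" using c by simp
  finally have "\<forall>x\<in>R. (\<Sum>b<r. c b * D b x)\<^sup>2 = 0"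
    using R by (subst (asm) sum_nonneg_eq_0_iff) auto
  then have "(\<Sum>b<r. c b * D b x) = 0" if "x \<in> R" for x using that by simp
  from indep[OF this b(1)] b(2) show False by simp
qed

section \<open>Column bases of integer matrices\<close>

text \<open>Two enumerations differ by a permutation of the positions, so a fixed one composed with
  all permutations yields each exactly once; \<open>restrict\<close> keeps the functions
  extensional.\<close>

lemma card_enumerations:
  assumes "finite S" "card S = r" "S \<subseteq> R"
  shows "card {f \<in> {0..<r} \<rightarrow>\<^sub>E R. f ` {0..<r} = S} = fact r"
proof -
  let ?U = "{0..<r}"
  obtain g where g: "bij_betw g ?U S"
    using ex_bij_betw_nat_finite[OF assms(1)] assms(2) by blast
  have "bij_betw (\<lambda>p. restrict (g \<circ> p) ?U) {p. p permutes ?U} {f \<in> ?U \<rightarrow>\<^sub>E R. f ` ?U = S}"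
  proof (rule bij_betwI')
    fix p q assume "p \<in> {p. p permutes ?U}" "q \<in> {p. p permutes ?U}"
    then have pq: "p permutes ?U" "q permutes ?U" by auto
    show "restrict (g \<circ> p) ?U = restrict (g \<circ> q) ?U \<longleftrightarrow> p = q"
    proof
      assume eq: "restrict (g \<circ> p) ?U = restrict (g \<circ> q) ?U"
      have "p a = q a" for a
      proof (cases "a \<in> ?U")
        case True
        then have "g (p a) = g (q a)" using fun_cong[OF eq, of a] by simp
        then show ?thesis
          using True pq by (intro inj_onD[OF bij_betw_imp_inj_on[OF g]]) (simp_all only: permutes_in_image)
      qed (use pq in \<open>simp add: permutes_not_in\<close>)
      then show "p = q" by blast
    qed simp
  next
    fix p assume "p \<in> {p. p permutes ?U}"
    then have "p ` ?U = ?U" by (simp add: permutes_image)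
    moreover have "restrict (g \<circ> p) ?U ` ?U = g ` p ` ?U"
      by (auto simp: image_image)
    ultimately have "restrict (g \<circ> p) ?U ` ?U = S"
      using g by (simp only: bij_betw_def)
    then show "restrict (g \<circ> p) ?U \<in> {f \<in> ?U \<rightarrow>\<^sub>E R. f ` ?U = S}"
      using assms(3) by auto
  next
    fix f assume "f \<in> {f \<in> ?U \<rightarrow>\<^sub>E R. f ` ?U = S}"
    then have f: "f \<in> ?U \<rightarrow>\<^sub>E R" "f ` ?U = S" by auto
    then have "bij_betw f ?U S"
      using assms by (simp add: bij_betw_def eq_card_imp_inj_on)
    then have "bij_betw (inv_into ?U g \<circ> f) ?U ?U"
      using g by (intro bij_betw_trans bij_betw_inv_into)
    then have "bij_betw (\<lambda>a. if a \<in> ?U then inv_into ?U g (f a) else a) ?U ?U"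
      by (rule bij_betw_cong[THEN iffD1, rotated]) simp
    then have "(\<lambda>a. if a \<in> ?U then inv_into ?U g (f a) else a) permutes ?U"
      by (intro bij_imp_permutes) auto
    moreover have "g (inv_into ?U g (f a)) = f a" if "a \<in> ?U" for a
      using that f g by (intro f_inv_into_f) (auto simp: bij_betw_def)
    then have "f = restrict (g \<circ> (\<lambda>a. if a \<in> ?U then inv_into ?U g (f a) else a)) ?U"
      using f(1) by (auto simp: fun_eq_iff PiE_iff extensional_def)
    ultimately show "\<exists>p\<in>{p. p permutes ?U}. f = restrict (g \<circ> p) ?U" by blast
  qed
  then show ?thesis
    using bij_betw_same_card card_permutations[of ?U r] by fastforce
qed

text \<open>The linear algebra with the complex forgotten: an integer matrix with rows
  \<open>R\<close> and columns \<open>F\<close>, and a real column basis, which is a list because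
  determinants need an order. Columns vanish off \<open>R\<close>, so equations can range over all
  \<open>x\<close>.\<close>

locale col_basis =
  fixes R :: "'k set" and F :: "'i set" and v :: "'i \<Rightarrow> 'k \<Rightarrow> int" and \<Upsilon> :: "'i list"
  assumes finite_rows: "finite R" and finite_cols: "finite F"
    and col_supported: "j \<in> F \<Longrightarrow> v j \<in> supported R"
    and basis_subset: "set \<Upsilon> \<subseteq> F" and distinct_basis: "distinct \<Upsilon>"
    and basis_indep: "(\<And>x. (\<Sum>i\<in>set \<Upsilon>. c i * real_of_int (v i x)) = 0) \<Longrightarrow> i \<in> set \<Upsilon> \<Longrightarrow> c i = 0"
    and basis_span: "j \<in> F \<Longrightarrow> \<exists>c. \<forall>x. real_of_int (v j x) = (\<Sum>i\<in>set \<Upsilon>. c i * real_of_int (v i x))"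
begin

abbreviation r :: nat where "r \<equiv> length \<Upsilon>"

definition minor :: "(nat \<Rightarrow> 'k) \<Rightarrow> int"
  where "minor f = Determinant.det (col_matrix r (\<lambda>b a. v (\<Upsilon> ! b) (f a)))"

text \<open>For the boundary matrix these sets are the ridges missing from relatively acyclic
  subcomplexes, see \<open>relatively_acyclic_row_basis\<close>.\<close>

definition row_basis :: "'k set \<Rightarrow> bool"
  where "row_basis S \<longleftrightarrow> S \<subseteq> R \<and> card S = r \<and>
    (\<forall>c. (\<forall>x\<in>S. (\<Sum>i\<in>set \<Upsilon>. c i * real_of_int (v i x)) = 0) \<longrightarrow> (\<forall>i\<in>set \<Upsilon>. c i = 0))"

definition real_span :: "('k \<Rightarrow> real) set"
  where "real_span = range (\<lambda>c x. \<Sum>i\<in>set \<Upsilon>. c i * real_of_int (v i x))"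

lemma sum_basis: "(\<Sum>i\<in>set \<Upsilon>. g i) = (\<Sum>b<r. g (\<Upsilon> ! b))"
  using sum.reindex_bij_betw[OF bij_betw_nth[OF distinct_basis refl refl], of g] by simp

lemma basis_coeffs: obtains c' where "\<And>b. b < r \<Longrightarrow> c' (\<Upsilon> ! b) = c b"
  using that[of "\<lambda>i. c (inv_into {..<r} ((!) \<Upsilon>) i)"] distinct_basis
  by (simp add: inv_into_f_f inj_on_nth)

lemma real_spanI: "(\<And>x. y x = (\<Sum>i\<in>set \<Upsilon>. c i * real_of_int (v i x))) \<Longrightarrow> y \<in> real_span"
  unfolding real_span_def by (intro range_eqI[of _ _ c]) auto

lemma real_span_sum:
  assumes "finite J" "\<And>j. j \<in> J \<Longrightarrow> y j \<in> real_span"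
  shows "(\<lambda>x. \<Sum>j\<in>J. a j * y j x) \<in> real_span"
proof -
  have "\<forall>j\<in>J. \<exists>c. \<forall>x. y j x = (\<Sum>i\<in>set \<Upsilon>. c i * real_of_int (v i x))"
    using assms(2) by (fastforce simp: real_span_def)
  then obtain c where c: "\<And>j x. j \<in> J \<Longrightarrow> y j x = (\<Sum>i\<in>set \<Upsilon>. c j i * real_of_int (v i x))"
    by metis
  show ?thesis
  proof (rule real_spanI)
    fix x
    have "(\<Sum>j\<in>J. a j * y j x) = (\<Sum>j\<in>J. \<Sum>i\<in>set \<Upsilon>. a j * c j i * real_of_int (v i x))"
      by (rule sum.cong) (simp_all add: c sum_distrib_left mult.assoc)
    also have "\<dots> = (\<Sum>i\<in>set \<Upsilon>. (\<Sum>j\<in>J. a j * c j i) * real_of_int (v i x))"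
      by (subst sum.swap) (simp add: sum_distrib_right)
    finally show "(\<Sum>j\<in>J. a j * y j x) = (\<Sum>i\<in>set \<Upsilon>. (\<Sum>j\<in>J. a j * c j i) * real_of_int (v i x))" .
  qed
qed

lemma col_in_real_span: "j \<in> F \<Longrightarrow> (\<lambda>x. real_of_int (v j x)) \<in> real_span"
  using basis_span by (blast intro: real_spanI)

lemma real_span_zero:
  assumes "y \<in> real_span" "row_basis S" "\<And>x. x \<in> S \<Longrightarrow> y x = 0"
  shows "y x = 0"
proof -
  obtain c where c: "y = (\<lambda>x. \<Sum>i\<in>set \<Upsilon>. c i * real_of_int (v i x))"
    using assms(1) by (auto simp: real_span_def)
  then have "\<forall>i\<in>set \<Upsilon>. c i = 0" using assms(2,3) unfolding row_basis_def by blast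
  then show ?thesis by (simp add: c)
qed

text \<open>Here \<open>f\<close> may repeat rows, but then the minor is zero; so a nonzero minor
  also forces the right cardinality. The rest is triviality of the kernel.\<close>

lemma minor_nonzero_iff:
  assumes f: "f \<in> {0..<r} \<rightarrow> R"
  shows "minor f \<noteq> 0 \<longleftrightarrow> row_basis (f ` {0..<r})"
proof -
  have "real_of_int (minor f) = Determinant.det (col_matrix r (\<lambda>b a. real_of_int (v (\<Upsilon> ! b) (f a))))"
    unfolding minor_def by (rule real_det_col_matrix[symmetric])
  then have iff: "minor f = 0 \<longleftrightarrow>
      (\<exists>c. (\<exists>b<r. c b \<noteq> 0) \<and> (\<forall>a<r. (\<Sum>b<r. c b * real_of_int (v (\<Upsilon> ! b) (f a))) = 0))"
    unfolding det_col_matrix_eq_0_iff[symmetric] by (metis of_int_eq_0_iff)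
  show ?thesis
  proof
    assume nz: "minor f \<noteq> 0"
    have "inj_on f {0..<r}"
    proof (rule inj_onI, rule ccontr)
      fix a a' assume *: "a \<in> {0..<r}" "a' \<in> {0..<r}" "f a = f a'" "a \<noteq> a'"
      then have "minor f = 0"
        unfolding minor_def
        by (intro det_identical_rows[of _ r a a']) (auto simp: col_matrix_def vec_eq_iff)
      then show False using nz by simp
    qed
    then have "card (f ` {0..<r}) = r" by (simp add: card_image)
    moreover have "c i = 0"
      if c: "\<forall>x\<in>f ` {0..<r}. (\<Sum>i\<in>set \<Upsilon>. c i * real_of_int (v i x)) = 0" and i: "i \<in> set \<Upsilon>" for c i
    proof -
      obtain b where b: "b < r" "i = \<Upsilon> ! b" using i by (auto simp: in_set_conv_nth)
      have "\<forall>a<r. (\<Sum>b<r. c (\<Upsilon> ! b) * real_of_int (v (\<Upsilon> ! b) (f a))) = 0"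
        using c by (auto simp: sum_basis)
      show ?thesis
      proof (rule ccontr)
        assume "c i \<noteq> 0"
        then have "\<exists>c. (\<exists>b<r. c b \<noteq> 0) \<and> (\<forall>a<r. (\<Sum>b<r. c b * real_of_int (v (\<Upsilon> ! b) (f a))) = 0)"
          using b \<open>\<forall>a<r. _ = 0\<close> by (intro exI[of _ "\<lambda>b. c (\<Upsilon> ! b)"]) auto
        then show False using iff nz by blast
      qed
    qed
    ultimately show "row_basis (f ` {0..<r})" using f by (auto simp: row_basis_def)
  next
    assume rb: "row_basis (f ` {0..<r})"
    show "minor f \<noteq> 0"
    proof
      assume "minor f = 0"
      then obtain c b where b: "b < r" "c b \<noteq> 0"
        and c: "\<And>a. a < r \<Longrightarrow> (\<Sum>b<r. c b * real_of_int (v (\<Upsilon> ! b) (f a))) = 0"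
        unfolding iff by blast
      obtain c' where c': "\<And>b. b < r \<Longrightarrow> c' (\<Upsilon> ! b) = c b"
        using basis_coeffs[of c] by blast
      then have "\<forall>x\<in>f ` {0..<r}. (\<Sum>i\<in>set \<Upsilon>. c' i * real_of_int (v i x)) = 0"
        using c by (auto simp: sum_basis)
      then have "\<forall>i\<in>set \<Upsilon>. c' i = 0" using rb by (simp add: row_basis_def)
      then show False using b c' by (metis nth_mem)
    qed
  qed
qed

lemma det_gram:
  "Determinant.det (mat r r (\<lambda>(a, b). \<Sum>x\<in>R. real_of_int (v (\<Upsilon> ! a) x) * real_of_int (v (\<Upsilon> ! b) x))) \<noteq> 0"
proof (rule det_gram_nonzero[OF finite_rows])
  fix c :: "nat \<Rightarrow> real" and b
  assume 0: "\<And>x. x \<in> R \<Longrightarrow> (\<Sum>b<r. c b * real_of_int (v (\<Upsilon> ! b) x)) = 0" and b: "b < r"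
  obtain c' where c': "\<And>b. b < r \<Longrightarrow> c' (\<Upsilon> ! b) = c b"
    using basis_coeffs[of c] by blast
  have "(\<Sum>i\<in>set \<Upsilon>. c' i * real_of_int (v i x)) = 0" for x
  proof (cases "x \<in> R")
    case True
    then show ?thesis using 0 c' by (simp add: sum_basis)
  next
    case False
    then have "v i x = 0" if "i \<in> set \<Upsilon>" for i
      using col_supported basis_subset that by (auto simp: supported_def)
    then show ?thesis by simp
  qed
  then have "c' (\<Upsilon> ! b) = 0" by (rule basis_indep[OF _ nth_mem[OF b]])
  then show "c b = 0" using b c' by simp
qed

lemma gram_minors:
  "real (fact r) * Determinant.det (mat r r (\<lambda>(a, b). \<Sum>x\<in>R. real_of_int (v (\<Upsilon> ! a) x) * real_of_int (v (\<Upsilon> ! b) x)))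
   = (\<Sum>f\<in>{0..<r} \<rightarrow>\<^sub>E R. (real_of_int (minor f))\<^sup>2)"
  using gram_expansion[OF finite_rows, of r "\<lambda>b x. real_of_int (v (\<Upsilon> ! b) x)"]
    real_det_col_matrix[of r "\<lambda>b a. v (\<Upsilon> ! b) (_ a)"]
  by (simp add: minor_def)

text \<open>By Cauchy-Binet the squared minors add up to a nonzero multiple of the Gram determinant,
  so they cannot all vanish.\<close>

lemma exists_minor: obtains f where "f \<in> {0..<r} \<rightarrow> R" "minor f \<noteq> 0"
proof -
  have "(\<Sum>f\<in>{0..<r} \<rightarrow>\<^sub>E R. (real_of_int (minor f))\<^sup>2) \<noteq> 0"
    using det_gram by (simp flip: gram_minors)
  then obtain f where "f \<in> {0..<r} \<rightarrow>\<^sub>E R" "minor f \<noteq> 0"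
    by (metis (no_types, lifting) of_int_0 power_zero_numeral sum.neutral)
  then show ?thesis using that by (auto simp: PiE_iff)
qed

text \<open>Modulo the column lattice this is the torsion subgroup of the cokernel of the
  matrix.\<close>

definition saturation :: "('k \<Rightarrow> int) set"
  where "saturation = {x \<in> supported R. \<exists>m::nat. m > 0 \<and> (\<lambda>a. int m * x a) \<in> int_lattice F v}"

text \<open>By Cramer's rule, the determinant of a nonsingular minor of the basis clears denominators.\<close>

lemma col_multiple:
  assumes "j \<in> F" "f \<in> {0..<r} \<rightarrow> R" "minor f \<noteq> 0"
  shows "(\<lambda>x. minor f * v j x) \<in> int_lattice (set \<Upsilon>) v"
proof -
  let ?A = "col_matrix r (\<lambda>b a. v (\<Upsilon> ! b) (f a))"
  have A: "?A \<in> carrier_mat r r" by (simp add: col_matrix_def)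
  define y where "y = vec r (\<lambda>a. v j (f a))"
  define n where "n = adj_mat ?A *\<^sub>v y"
  have y: "y \<in> carrier_vec r" by (simp add: y_def)
  have n: "n \<in> carrier_vec r"
    unfolding n_def by (rule mult_mat_vec_carrier[OF adj_mat(1)[OF A] y])
  have "?A *\<^sub>v n = (?A * adj_mat ?A) *\<^sub>v y"
    unfolding n_def using A adj_mat(1)[OF A] y by (simp add: assoc_mult_mat_vec)
  also have "\<dots> = minor f \<cdot>\<^sub>v y"
  proof (rule eq_vecI)
    fix a assume "a < dim_vec (minor f \<cdot>\<^sub>v y)"
    then have a: "a < r" using y by simp
    have "((?A * adj_mat ?A) *\<^sub>v y) $ a = (\<Sum>b<r. minor f * (if a = b then y $ b else 0))"
      unfolding adj_mat(2)[OF A] using a y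
      by (auto simp: scalar_prod_def minor_def atLeast0LessThan intro!: sum.cong)
    then show "((?A * adj_mat ?A) *\<^sub>v y) $ a = (minor f \<cdot>\<^sub>v y) $ a"
      using a y by (simp flip: sum_distrib_left)
  qed (use A y in simp)
  finally have An: "?A *\<^sub>v n = minor f \<cdot>\<^sub>v y" .
  have n_row: "(\<Sum>b<r. n $ b * v (\<Upsilon> ! b) (f a)) = minor f * v j (f a)" if "a < r" for a
  proof -
    have "(?A *\<^sub>v n) $ a = (\<Sum>b<r. n $ b * v (\<Upsilon> ! b) (f a))"
      using that n by (simp add: col_matrix_def scalar_prod_def atLeast0LessThan mult.commute)
    then show ?thesis using that An by (simp add: y_def)
  qed
  obtain c where c: "\<And>b. b < r \<Longrightarrow> c (\<Upsilon> ! b) = n $ b"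
    using basis_coeffs[of "($) n"] by blast
  \<comment> \<open>The option type keeps column \<open>j\<close>, represented by
    \<open>None\<close>, apart from the basis columns, among which it may occur. The combination
    vanishes on the rows \<open>f\<close>, hence everywhere.\<close>
  let ?z = "\<lambda>x. \<Sum>i\<in>insert None (Some ` set \<Upsilon>). (case i of None \<Rightarrow> - real_of_int (minor f) | Some i \<Rightarrow> real_of_int (c i)) *
      (case i of None \<Rightarrow> real_of_int (v j x) | Some i \<Rightarrow> real_of_int (v i x))"
  have z: "?z x = (\<Sum>i\<in>set \<Upsilon>. real_of_int (c i) * real_of_int (v i x)) - real_of_int (minor f) * real_of_int (v j x)" for x
    by (simp add: sum.reindex)
  have "?z \<in> real_span"
    by (rule real_span_sum[where y = "\<lambda>i x. case i of None \<Rightarrow> real_of_int (v j x) | Some i \<Rightarrow> real_of_int (v i x)"])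
      (use col_in_real_span assms(1) basis_subset in auto)
  moreover have "?z x = 0" if x: "x \<in> f ` {0..<r}" for x
  proof -
    obtain a where a: "a < r" "x = f a" using x by auto
    have "(\<Sum>i\<in>set \<Upsilon>. c i * v i x) = minor f * v j x"
      using n_row[OF a(1)] by (simp add: sum_basis c a(2))
    then show ?thesis unfolding z by (metis (no_types, lifting) diff_self of_int_mult of_int_sum sum.cong)
  qed
  ultimately have "?z x = 0" for x
    using real_span_zero minor_nonzero_iff assms(2,3) by blast
  then have "real_of_int (minor f * v j x) = real_of_int (\<Sum>i\<in>set \<Upsilon>. c i * v i x)" for x
    unfolding z by simp
  then have "minor f * v j x = (\<Sum>i\<in>set \<Upsilon>. c i * v i x)" for x
    by (simp only: of_int_eq_iff)
  then show ?thesis by (simp add: int_lattice_def)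
qed

lemma lattice_basis_subset: "int_lattice (set \<Upsilon>) v \<subseteq> int_lattice F v"
  by (rule lattice_mono[OF finite_cols basis_subset])

lemma lattice_supported: "int_lattice F v \<subseteq> supported R"
  by (intro lattice_subset finite_cols add_subgroup_supported col_supported)

text \<open>A nonzero minor is a common denominator for expressing all columns by basis columns, so
  the basis lattice and the full lattice have the same saturation.\<close>

lemma saturation_basis:
  "saturation = {x \<in> supported R. \<exists>m::nat. m > 0 \<and> (\<lambda>a. int m * x a) \<in> int_lattice (set \<Upsilon>) v}"
proof -
  obtain f where f: "f \<in> {0..<r} \<rightarrow> R" "minor f \<noteq> 0" by (rule exists_minor)
  let ?H = "{x. (\<lambda>a. minor f * x a) \<in> int_lattice (set \<Upsilon>) v}"
  have "add_subgroup ?H"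
    using add_subgroup_lattice[of "set \<Upsilon>" v]
    by (auto simp: add_subgroup_def zero_fun_def fun_diff_def algebra_simps)
  then have H: "int_lattice F v \<subseteq> ?H"
    using col_multiple[OF _ f] by (intro lattice_subset finite_cols) auto
  have "\<exists>m::nat. m > 0 \<and> (\<lambda>a. int m * x a) \<in> int_lattice (set \<Upsilon>) v"
    if "m > 0" "(\<lambda>a. int m * x a) \<in> int_lattice F v" for m :: nat and x
  proof -
    have "(\<lambda>a. minor f * (int m * x a)) \<in> int_lattice (set \<Upsilon>) v"
      using subsetD[OF H that(2)] by simp
    then have "(\<lambda>a. sgn (minor f) * (minor f * (int m * x a))) \<in> int_lattice (set \<Upsilon>) v"
      by (rule add_subgroup_scale[OF add_subgroup_lattice])
    \<comment> \<open>Multiplying by the sign makes the multiplier a positive natural number, as the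
      claim demands.\<close>
    moreover obtain N where N: "sgn (minor f) * minor f = int N" "N > 0"
      using f(2) by (metis abs_sgn mult.commute of_nat_0_less_iff zero_less_abs_iff zero_le_imp_eq_int abs_ge_zero)
    have "sgn (minor f) * (minor f * (int m * x a)) = int (N * m) * x a" for a
      by (simp add: mult.assoc[symmetric] N)
    ultimately show ?thesis using that N by (intro exI[of _ "N * m"]) simp
  qed
  then show ?thesis using lattice_basis_subset unfolding saturation_def by blast
qed

lemma add_subgroup_saturation: "add_subgroup saturation"
  unfolding add_subgroup_def
proof (intro conjI ballI)
  show "0 \<in> saturation"
    using add_subgroup_0[OF add_subgroup_lattice, of F v]
    by (auto simp: saturation_def supported_def zero_fun_def intro: exI[of _ 1])
  fix x y assume "x \<in> saturation" "y \<in> saturation"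
  then obtain m n :: nat where *: "m > 0" "(\<lambda>a. int m * x a) \<in> int_lattice F v"
    "n > 0" "(\<lambda>a. int n * y a) \<in> int_lattice F v" "x \<in> supported R" "y \<in> supported R"
    by (auto simp: saturation_def)
  have "(\<lambda>a. int n * (int m * x a)) - (\<lambda>a. int m * (int n * y a)) \<in> int_lattice F v"
    by (intro add_subgroup_diff add_subgroup_scale add_subgroup_lattice *)
  then have "(\<lambda>a. int (m * n) * (x - y) a) \<in> int_lattice F v"
    by (simp add: fun_diff_def algebra_simps)
  then show "x - y \<in> saturation"
    using * add_subgroup_diff[OF add_subgroup_supported, of x R y] 
    by (auto simp: saturation_def intro!: exI[of _ "m * n"])
qed

lemma lattice_saturation: "int_lattice F v \<subseteq> saturation"
  using lattice_supported by (auto simp: saturation_def intro!: exI[of _ 1])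

lemma saturation_real_span: "x \<in> saturation \<Longrightarrow> (\<lambda>a. real_of_int (x a)) \<in> real_span"
proof -
  assume "x \<in> saturation"
  then obtain m :: nat and c where m: "m > 0" "(\<lambda>a. int m * x a) = (\<lambda>a. \<Sum>j\<in>F. c j * v j a)"
    by (auto simp: saturation_def int_lattice_def)
  have "real_of_int (x a) = (\<Sum>j\<in>F. (real_of_int (c j) / real m) * real_of_int (v j a))" for a
  proof -
    have "real m * real_of_int (x a) = (\<Sum>j\<in>F. real_of_int (c j) * real_of_int (v j a))"
      using arg_cong[OF fun_cong[OF m(2), of a], of real_of_int] by simp
    then show ?thesis using m(1) by (simp add: field_simps sum_divide_distrib[symmetric])
  qed
  then show ?thesis
    using real_span_sum[OF finite_cols col_in_real_span, where a = "\<lambda>j. real_of_int (c j) / real m"]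
    by simp
qed

section \<open>Factorisation of maximal minors into lattice indices\<close>

definition proj :: "(nat \<Rightarrow> 'k) \<Rightarrow> ('k \<Rightarrow> int) \<Rightarrow> nat \<Rightarrow> int"
  where "proj f x = (\<lambda>a. if a < r then x (f a) else 0)"

lemma proj_diff: "proj f (x - y) = proj f x - proj f y"
  by (auto simp: proj_def fun_eq_iff)

lemma add_subgroup_proj: "add_subgroup H \<Longrightarrow> add_subgroup (proj f ` H)"
proof -
  assume H: "add_subgroup H"
  have "proj f 0 = 0" by (auto simp: proj_def fun_eq_iff)
  then have "0 \<in> proj f ` H" using add_subgroup_0[OF H] by (metis imageI)
  then show ?thesis
    using add_subgroup_diff[OF H] by (auto simp: add_subgroup_def simp flip: proj_diff)
qed

lemma proj_lattice:
  "proj f ` int_lattice (set \<Upsilon>) v = int_lattice {..<r} (\<lambda>b. proj f (v (\<Upsilon> ! b)))"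
proof
  have "proj f (\<lambda>x. \<Sum>i\<in>set \<Upsilon>. c i * v i x) = (\<lambda>a. \<Sum>b<r. c (\<Upsilon> ! b) * proj f (v (\<Upsilon> ! b)) a)" for c
    by (auto simp: proj_def sum_basis)
  then show "proj f ` int_lattice (set \<Upsilon>) v \<subseteq> int_lattice {..<r} (\<lambda>b. proj f (v (\<Upsilon> ! b)))"
    by (auto simp: int_lattice_def)
  show "int_lattice {..<r} (\<lambda>b. proj f (v (\<Upsilon> ! b))) \<subseteq> proj f ` int_lattice (set \<Upsilon>) v"
    by (intro lattice_subset add_subgroup_proj add_subgroup_lattice imageI lattice_generator) auto
qed

text \<open>If \<open>R - S\<close> consists of the ridges of a subcomplex Gamma, these are the
  relative boundaries of the pair (Sigma, Gamma) in degree d-1.\<close>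

definition row_lattice :: "'k set \<Rightarrow> ('k \<Rightarrow> int) set"
  where "row_lattice S = {x + y |x y. x \<in> int_lattice F v \<and> y \<in> supported (R - S)}"

lemma add_subgroup_row_lattice: "add_subgroup (row_lattice S)"
  unfolding add_subgroup_def
  proof (intro conjI ballI)
  show "0 \<in> row_lattice S"
    using add_subgroup_0[OF add_subgroup_lattice, of F v]
      add_subgroup_0[OF add_subgroup_supported, of "R - S"]
    unfolding row_lattice_def by (intro CollectI exI[of _ 0]) auto
  fix x y assume "x \<in> row_lattice S" "y \<in> row_lattice S"
  then obtain a b a' b' where "x = a + b" "y = a' + b'" "a \<in> int_lattice F v" "a' \<in> int_lattice F v"
    "b \<in> supported (R - S)" "b' \<in> supported (R - S)"
    by (auto simp: row_lattice_def)
  moreover from this have "a - a' \<in> int_lattice F v" "b - b' \<in> supported (R - S)"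
    by (auto intro: add_subgroup_diff add_subgroup_lattice add_subgroup_supported)
  moreover have "x - y = (a - a') + (b - b')" using calculation by simp
  ultimately show "x - y \<in> row_lattice S" unfolding row_lattice_def by blast
  qed

context
  fixes f assumes f: "f \<in> {0..<r} \<rightarrow> R" and nz: "minor f \<noteq> 0"
begin

text \<open>A vector of the real span is determined by its entries on a row basis, so the projection
  is injective on the saturation.\<close>

lemma proj_mem_iff:
  assumes "x \<in> saturation" "H \<subseteq> saturation"
  shows "proj f x \<in> proj f ` H \<longleftrightarrow> x \<in> H"
proof
  assume "proj f x \<in> proj f ` H"
  then obtain y where y: "y \<in> H" "proj f x = proj f y" by blast
  have "x - y \<in> saturation"
    using assms y add_subgroup_diff[OF add_subgroup_saturation] by blast
  moreover have "(x - y) (f a) = 0" if "a < r" for a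
    using fun_cong[OF y(2), of a] that by (simp add: proj_def)
  ultimately have "real_of_int ((x - y) a) = 0" for a
    using real_span_zero[OF saturation_real_span minor_nonzero_iff[OF f, THEN iffD1, OF nz]] by fastforce
  then have "x = y" by (simp add: fun_eq_iff)
  then show "x \<in> H" using y by simp
qed simp

lemma coset_index_proj:
  assumes "add_subgroup H" "H \<subseteq> saturation"
  shows "coset_index (supported {..<r}) (proj f ` H) =
    coset_index (supported {..<r}) (proj f ` saturation) * coset_index saturation H"
proof -
  have "coset_index saturation H = coset_index (proj f ` saturation) (proj f ` H)"
    using assms add_subgroup_diff[OF add_subgroup_saturation]
    by (intro coset_index_hom add_subgroup_proj) (auto simp: proj_mem_iff simp flip: proj_diff)
  moreover have "proj f ` saturation \<subseteq> supported {..<r}" by (auto simp: proj_def supported_def)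
  ultimately show ?thesis
    using coset_index_mult[OF add_subgroup_supported add_subgroup_proj[OF add_subgroup_saturation]
        add_subgroup_proj[OF assms(1)]] assms(2) by (simp add: image_mono)
qed

text \<open>The determinant is, up to sign, the index of the projected basis lattice, and
  injectivity of the projection allows the projected saturation to be inserted into the
  tower.\<close>

lemma minor_index:
  "nat \<bar>minor f\<bar> = coset_index (supported {..<r}) (proj f ` saturation) *
     coset_index saturation (int_lattice (set \<Upsilon>) v)"
proof -
  have "col_matrix r (\<lambda>b. proj f (v (\<Upsilon> ! b))) = col_matrix r (\<lambda>b a. v (\<Upsilon> ! b) (f a))"
    by (rule eq_matI) (auto simp: col_matrix_def proj_def)
  then have "coset_index (supported {..<r}) (proj f ` int_lattice (set \<Upsilon>) v) = nat \<bar>minor f\<bar>"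
    unfolding proj_lattice using nz
    by (subst coset_index_det) (auto simp: minor_def proj_def supported_def)
  then show ?thesis
    using coset_index_proj[OF add_subgroup_lattice] lattice_basis_subset lattice_saturation by force
qed

text \<open>Projection kills the vectors supported off the chosen rows, turning the quotient into
  that of Z^r by the projected column lattice. The tower then has the same first factor as in
  \<open>minor_index\<close>.\<close>

lemma coset_index_row_lattice:
  "coset_index (supported R) (row_lattice (f ` {0..<r})) =
     coset_index (supported {..<r}) (proj f ` saturation) * coset_index saturation (int_lattice F v)"
proof -
  let ?S = "f ` {0..<r}"
  have inj: "inj_on f {0..<r}"
    using minor_nonzero_iff[OF f, THEN iffD1, OF nz] by (simp add: row_basis_def eq_card_imp_inj_on)
  have "coset_index (supported R) (row_lattice ?S) = coset_index (proj f ` supported R) (proj f ` int_lattice F v)"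
  proof (rule coset_index_hom[OF add_subgroup_row_lattice add_subgroup_proj[OF add_subgroup_lattice]])
    fix x y :: "'k \<Rightarrow> int" assume xy: "x \<in> supported R" "y \<in> supported R"
    show "proj f x - proj f y \<in> proj f ` int_lattice F v \<longleftrightarrow> x - y \<in> row_lattice ?S"
      unfolding proj_diff[symmetric]
    proof
      assume "proj f (x - y) \<in> proj f ` int_lattice F v"
      then obtain z where z: "z \<in> int_lattice F v" "proj f (x - y) = proj f z" by blast
      have "(x - y) a = z a" if a: "a \<in> ?S" for a
      proof -
        obtain b where "b < r" "a = f b" using a by auto
        then show ?thesis using fun_cong[OF z(2), of b] by (simp add: proj_def)
      qed
      moreover have "z \<in> supported R" using z lattice_supported by blast
      ultimately have "x - y - z \<in> supported (R - ?S)"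
        using xy by (auto simp: supported_def)
      moreover have "x - y = z + (x - y - z)" by simp
      ultimately show "x - y \<in> row_lattice ?S" using z unfolding row_lattice_def by blast
    next
      assume "x - y \<in> row_lattice ?S"
      then obtain a b where "x - y = a + b" "a \<in> int_lattice F v" "b \<in> supported (R - ?S)"
        by (auto simp: row_lattice_def)
      moreover from this have "proj f (x - y) = proj f a"
        by (auto simp: proj_def fun_eq_iff supported_def)
      ultimately show "proj f (x - y) \<in> proj f ` int_lattice F v" by auto
    qed
  qed
  also have "proj f ` supported R = supported {..<r}"
  proof
    show "proj f ` supported R \<subseteq> supported {..<r}" by (auto simp: proj_def supported_def)
    show "supported {..<r} \<subseteq> proj f ` supported R"
    proof
      fix y :: "nat \<Rightarrow> int" assume y: "y \<in> supported {..<r}"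
      let ?x = "\<lambda>k. if k \<in> ?S then y (inv_into {0..<r} f k) else 0"
      have "?x \<in> supported R" using f by (auto simp: supported_def)
      moreover have "proj f ?x = y"
        using y inj by (auto simp: proj_def fun_eq_iff supported_def inv_into_f_f)
      ultimately show "y \<in> proj f ` supported R" by (intro image_eqI[of y "proj f" ?x]) simp_all
    qed
  qed
  also have "coset_index (supported {..<r}) (proj f ` int_lattice F v) =
      coset_index (supported {..<r}) (proj f ` saturation) * coset_index saturation (int_lattice F v)"
    by (rule coset_index_proj[OF add_subgroup_lattice lattice_saturation])
  finally show ?thesis .
qed

lemma coset_index_basis:
  "coset_index saturation (int_lattice (set \<Upsilon>) v) =
   coset_index saturation (int_lattice F v) * coset_index (int_lattice F v) (int_lattice (set \<Upsilon>) v)"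
  by (intro coset_index_mult add_subgroup_saturation add_subgroup_lattice lattice_saturation lattice_basis_subset)

end

text \<open>A nonzero minor is a product of such indices, so none of them is infinite.\<close>

lemma coset_index_pos: "coset_index saturation (int_lattice F v) > 0" "coset_index saturation (int_lattice (set \<Upsilon>) v) > 0"
proof -
  obtain f where f: "f \<in> {0..<r} \<rightarrow> R" "minor f \<noteq> 0" by (rule exists_minor)
  have "nat \<bar>minor f\<bar> > 0" using f by simp
  then show "coset_index saturation (int_lattice (set \<Upsilon>) v) > 0" by (simp add: minor_index[OF f])
  then show "coset_index saturation (int_lattice F v) > 0" by (simp add: coset_index_basis[OF f])
qed

text \<open>Comparing \<open>minor_index\<close> with \<open>coset_index_row_lattice\<close>
  eliminates the index of the projected saturation. The factorial of \<open>gram_minors\<close>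
  cancels against the number of enumerations of each row basis.\<close>

theorem gram_index:
  "Determinant.det (mat r r (\<lambda>(a, b). \<Sum>x\<in>R. real_of_int (v (\<Upsilon> ! a) x) * real_of_int (v (\<Upsilon> ! b) x))) =
   (real (coset_index saturation (int_lattice (set \<Upsilon>) v)))\<^sup>2 *
   (\<Sum>S | row_basis S. (real (coset_index (supported R) (row_lattice S)))\<^sup>2 /
      (real (coset_index saturation (int_lattice F v)))\<^sup>2)"
   (is "?det = (real ?t)\<^sup>2 * (\<Sum>S | row_basis S. (real (?i S))\<^sup>2 / (real ?s)\<^sup>2)")
proof -
  let ?U = "{0..<r}" let ?E = "?U \<rightarrow>\<^sub>E R" let ?rb = "{S. row_basis S}"
  have fin: "finite ?rb" using finite_rows by (rule finite_subset[rotated, OF finite_Pow_iff[THEN iffD2]]) (auto simp: row_basis_def)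
  have minor: "(real_of_int (minor f))\<^sup>2 = (real ?t)\<^sup>2 * ((real (?i S))\<^sup>2 / (real ?s)\<^sup>2)"
    if "f \<in> ?E" "f ` ?U = S" "row_basis S" for f S
  proof -
    have f: "f \<in> ?U \<rightarrow> R" "minor f \<noteq> 0"
      using that minor_nonzero_iff[of f] by (auto simp: PiE_iff)
    let ?c = "coset_index (supported {..<r}) (proj f ` saturation)"
    have "(real_of_int (minor f))\<^sup>2 = (real (nat \<bar>minor f\<bar>))\<^sup>2" by simp
    also have "\<dots> = (real ?c * real ?t)\<^sup>2" by (simp add: minor_index[OF f])
    also have "real ?c = real (?i S) / real ?s"
      using coset_index_row_lattice[OF f] coset_index_pos that(2) by simp
    finally show ?thesis by (simp add: power_mult_distrib power_divide)
  qed
  have "real (fact r) * ?det = (\<Sum>f\<in>?E. (real_of_int (minor f))\<^sup>2)"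
    by (rule gram_minors)
  also have "\<dots> = (\<Sum>f\<in>{f \<in> ?E. f ` ?U \<in> ?rb}. (real_of_int (minor f))\<^sup>2)"
  proof (rule sum.mono_neutral_right)
    show "finite ?E" using finite_rows by (simp add: finite_PiE)
    show "\<forall>f\<in>?E - {f \<in> ?E. f ` ?U \<in> ?rb}. (real_of_int (minor f))\<^sup>2 = 0"
      using minor_nonzero_iff by (auto simp: PiE_iff)
  qed auto
  also have "\<dots> = (\<Sum>S\<in>?rb. \<Sum>f\<in>{f \<in> {f \<in> ?E. f ` ?U \<in> ?rb}. f ` ?U = S}. (real_of_int (minor f))\<^sup>2)"
    using finite_rows fin by (intro sum.group[symmetric]) (auto simp: finite_PiE)
  also have "\<dots> = (\<Sum>S\<in>?rb. real (fact r) * ((real ?t)\<^sup>2 * ((real (?i S))\<^sup>2 / (real ?s)\<^sup>2)))"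
  proof (rule sum.cong)
    fix S assume S: "S \<in> ?rb"
    then have eq: "{f \<in> {f \<in> ?E. f ` ?U \<in> ?rb}. f ` ?U = S} = {f \<in> ?E. f ` ?U = S}" by auto
    have "card {f \<in> ?E. f ` ?U = S} = fact r"
      using S finite_subset[OF _ finite_rows] by (intro card_enumerations) (auto simp: row_basis_def)
    then show "(\<Sum>f\<in>{f \<in> {f \<in> ?E. f ` ?U \<in> ?rb}. f ` ?U = S}. (real_of_int (minor f))\<^sup>2) =
        real (fact r) * ((real ?t)\<^sup>2 * ((real (?i S))\<^sup>2 / (real ?s)\<^sup>2))"
      unfolding eq using S minor by (simp add: sum.cong[OF refl, of _ _ "\<lambda>_. (real ?t)\<^sup>2 * ((real (?i S))\<^sup>2 / (real ?s)\<^sup>2)"])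
  qed simp
  also have "\<dots> = real (fact r) * ((real ?t)\<^sup>2 * (\<Sum>S\<in>?rb. (real (?i S))\<^sup>2 / (real ?s)\<^sup>2))"
    by (simp only: sum_distrib_left)
  finally show ?thesis by simp
qed

end

section \<open>Cellular homology and torsion\<close>

definition additive_group :: "'g::ab_group_add set \<Rightarrow> 'g monoid"
  where "additive_group Z = \<lparr>carrier = Z, monoid.mult = (+), one = 0\<rparr>"

lemma additive_group_simps [simp]:
  "carrier (additive_group Z) = Z" "x \<otimes>\<^bsub>additive_group Z\<^esub> y = x + y" "\<one>\<^bsub>additive_group Z\<^esub> = 0"
  by (simp_all add: additive_group_def)

lemma comm_group_additive_group:
  assumes "add_subgroup Z" shows "comm_group (additive_group Z)"
proof (rule comm_groupI)
  fix x assume "x \<in> carrier (additive_group Z)"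
  then show "\<exists>y\<in>carrier (additive_group Z). y \<otimes>\<^bsub>additive_group Z\<^esub> x = \<one>\<^bsub>additive_group Z\<^esub>"
    using add_subgroup_uminus[OF assms] by (intro bexI[of _ "- x"]) auto
qed (use add_subgroup_0[OF assms] add_subgroup_add[OF assms] in \<open>auto simp: add_ac\<close>)

lemma r_coset_additive_group: "r_coset (additive_group Z) B a = (+) a ` B"
  by (auto simp: r_coset_def add.commute)

lemma normal_additive_group:
  assumes "add_subgroup Z" "add_subgroup B" "B \<subseteq> Z"
  shows "B \<lhd> additive_group Z"
proof -
  interpret comm_group "additive_group Z" by (rule comm_group_additive_group[OF assms(1)])
  have "inv\<^bsub>additive_group Z\<^esub> x = - x" if "x \<in> Z" for x
    using that add_subgroup_uminus[OF assms(1)] by (intro inv_equality) auto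
  then have "subgroup B (additive_group Z)"
    using assms add_subgroup_uminus[OF assms(2)] add_subgroup_0[OF assms(2)] add_subgroup_add[OF assms(2)]
    by (intro subgroup.intro) auto
  then show ?thesis by (rule subgroup_imp_normal)
qed

lemma carrier_quotient: "carrier (additive_group Z Mod B) = (\<lambda>a. (+) a ` B) ` Z"
  by (auto simp: FactGroup_def RCOSETS_def r_coset_additive_group)

lemma torsion_quotient:
  fixes Z B :: "('k \<Rightarrow> int) set"
  assumes Z: "add_subgroup Z" and B: "add_subgroup B" and "B \<subseteq> Z"
  shows "card {x \<in> carrier (additive_group Z Mod B).
      \<exists>m::nat. m > 0 \<and> x [^]\<^bsub>additive_group Z Mod B\<^esub> m = \<one>\<^bsub>additive_group Z Mod B\<^esub>}
    = coset_index {a \<in> Z. \<exists>m::nat. m > 0 \<and> (\<lambda>i. int m * a i) \<in> B} B"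
proof -
  let ?G = "additive_group Z"
  interpret G: comm_group ?G by (rule comm_group_additive_group[OF Z])
  interpret N: normal B ?G by (rule normal_additive_group[OF assms])
  interpret Q: group "?G Mod B" by (rule N.factorgroup_is_group)
  interpret h: group_hom ?G "?G Mod B" "\<lambda>a. (+) a ` B"
    using N.r_coset_hom_Mod by unfold_locales (simp add: r_coset_additive_group)
  have pow: "a [^]\<^bsub>?G\<^esub> m = (\<lambda>i. int m * a i)" for a and m :: nat
    by (induction m) (auto simp: fun_eq_iff algebra_simps)
  have "(+) a ` B [^]\<^bsub>?G Mod B\<^esub> m = \<one>\<^bsub>?G Mod B\<^esub> \<longleftrightarrow> (\<lambda>i. int m * a i) \<in> B"
    if "a \<in> Z" for a and m :: nat
  proof -
    have "(+) a ` B [^]\<^bsub>?G Mod B\<^esub> m = (+) (\<lambda>i. int m * a i) ` B"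
      using h.hom_nat_pow[of a m] that by (simp add: pow)
    moreover have "\<one>\<^bsub>?G Mod B\<^esub> = (+) 0 ` B" by (simp add: FactGroup_def)
    ultimately show ?thesis using coset_eq_iff[OF B, of "\<lambda>i. int m * a i" 0] by simp
  qed
  then have "{x \<in> carrier (?G Mod B). \<exists>m::nat. m > 0 \<and> x [^]\<^bsub>?G Mod B\<^esub> m = \<one>\<^bsub>?G Mod B\<^esub>}
      = (\<lambda>a. (+) a ` B) ` {a \<in> Z. \<exists>m::nat. m > 0 \<and> (\<lambda>i. int m * a i) \<in> B}"
    by (auto simp: carrier_quotient)
  then show ?thesis by (simp add: coset_index_def)
qed

text \<open>Evaluates on representatives the products of sets by which \<open>incl_induced\<close>
  is defined.\<close>

lemma set_mult_coset:
  assumes "add_subgroup B" "0 \<in> B'" "B' \<subseteq> B"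
  shows "((+) a ` B') <#>\<^bsub>additive_group Z\<^esub> B = (+) a ` B"
proof -
  have "((+) a ` B') <#>\<^bsub>additive_group Z\<^esub> B = {(a + b') + b |b' b. b' \<in> B' \<and> b \<in> B}"
    by (auto simp: set_mult_def)
  also have "\<dots> = (+) a ` B"
  proof
    show "{(a + b') + b |b' b. b' \<in> B' \<and> b \<in> B} \<subseteq> (+) a ` B"
      using add_subgroup_add[OF assms(1)] assms(3) by (auto simp: add.assoc)
    show "(+) a ` B \<subseteq> {(a + b') + b |b' b. b' \<in> B' \<and> b \<in> B}"
      using assms(2) by (force simp: image_iff intro: exI[of _ 0])
  qed
  finally show ?thesis .
qed

lemma inclusion_iso_iff:
  assumes Z: "add_subgroup Z" "add_subgroup Z'" and B: "add_subgroup B" "add_subgroup B'"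
    and sub: "B' \<subseteq> Z'" "B \<subseteq> Z" "Z' \<subseteq> Z" "B' \<subseteq> B"
  shows "(\<lambda>C. C <#>\<^bsub>additive_group Z\<^esub> B) \<in> iso (additive_group Z' Mod B') (additive_group Z Mod B) \<longleftrightarrow>
    Z' \<inter> B \<subseteq> B' \<and> (\<forall>z\<in>Z. \<exists>a\<in>Z'. z - a \<in> B)"
proof -
  let ?f = "\<lambda>C. C <#>\<^bsub>additive_group Z\<^esub> B"
  have f: "?f ((+) a ` B') = (+) a ` B" for a
    using set_mult_coset[OF B(1) add_subgroup_0[OF B(2)] sub(4)] .
  have mult: "((+) a ` H) <#>\<^bsub>additive_group Y\<^esub> ((+) b ` H) = (+) (a + b) ` H"
    if "add_subgroup H" for a b H and Y :: "'a set"
  proof -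
    have "((+) a ` H) <#>\<^bsub>additive_group Y\<^esub> ((+) b ` H) = (+) b ` (((+) a ` H) <#>\<^bsub>additive_group Y\<^esub> H)"
      by (force simp: set_mult_def image_iff add_ac)
    also have "((+) a ` H) <#>\<^bsub>additive_group Y\<^esub> H = (+) a ` H"
      by (rule set_mult_coset[OF that add_subgroup_0[OF that] subset_refl])
    also have "(+) b ` (+) a ` H = (+) (a + b) ` H"
      by (auto simp: image_image add_ac)
    finally show ?thesis .
  qed
  have hom: "?f \<in> hom (additive_group Z' Mod B') (additive_group Z Mod B)"
    unfolding hom_def
  proof (intro CollectI conjI funcsetI ballI)
    fix x assume "x \<in> carrier (additive_group Z' Mod B')"
    then show "?f x \<in> carrier (additive_group Z Mod B)"
      using sub(3) by (auto simp: carrier_quotient f)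
  next
    fix x y assume "x \<in> carrier (additive_group Z' Mod B')" "y \<in> carrier (additive_group Z' Mod B')"
    then obtain a b where "x = (+) a ` B'" "y = (+) b ` B'" by (auto simp: carrier_quotient)
    then show "?f (x \<otimes>\<^bsub>additive_group Z' Mod B'\<^esub> y) = ?f x \<otimes>\<^bsub>additive_group Z Mod B\<^esub> ?f y"
      by (simp add: mult_FactGroup mult[OF B(1)] mult[OF B(2)] f)
  qed
  have inj: "inj_on ?f (carrier (additive_group Z' Mod B')) \<longleftrightarrow> Z' \<inter> B \<subseteq> B'"
  proof
    assume inj: "inj_on ?f (carrier (additive_group Z' Mod B'))"
    show "Z' \<inter> B \<subseteq> B'"
    proof
      fix a assume a: "a \<in> Z' \<inter> B"
      then have "?f ((+) a ` B') = ?f ((+) 0 ` B')"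
        unfolding f coset_eq_iff[OF B(1)] by simp
      then have "(+) a ` B' = (+) 0 ` B'"
      proof (rule inj_onD[OF inj])
        show "(+) a ` B' \<in> carrier (additive_group Z' Mod B')"
          unfolding carrier_quotient using a by (intro imageI) blast
        show "(+) 0 ` B' \<in> carrier (additive_group Z' Mod B')"
          unfolding carrier_quotient by (rule imageI[OF add_subgroup_0[OF Z(2)]])
      qed
      then have "a - 0 \<in> B'" unfolding coset_eq_iff[OF B(2)] .
      then show "a \<in> B'" by simp
    qed
  next
    assume "Z' \<inter> B \<subseteq> B'"
    then show "inj_on ?f (carrier (additive_group Z' Mod B'))"
      using add_subgroup_diff[OF Z(2)]
      by (auto simp: inj_on_def carrier_quotient f coset_eq_iff[OF B(1)] coset_eq_iff[OF B(2)] simp del: image_add_0)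
  qed
  have surj: "?f ` carrier (additive_group Z' Mod B') = carrier (additive_group Z Mod B) \<longleftrightarrow>
      (\<forall>z\<in>Z. \<exists>a\<in>Z'. z - a \<in> B)"
  proof -
    have "?f ` carrier (additive_group Z' Mod B') = (\<lambda>a. (+) a ` B) ` Z'"
      by (simp add: carrier_quotient image_image f)
    moreover have "(\<lambda>a. (+) a ` B) ` Z' \<subseteq> (\<lambda>a. (+) a ` B) ` Z" using sub(3) by (rule image_mono)
    moreover have "(\<lambda>a. (+) a ` B) ` Z \<subseteq> (\<lambda>a. (+) a ` B) ` Z' \<longleftrightarrow> (\<forall>z\<in>Z. \<exists>a\<in>Z'. z - a \<in> B)"
      by (simp only: image_subset_iff image_iff coset_eq_iff[OF B(1)])
    ultimately show ?thesis by (auto simp: carrier_quotient)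
  qed
  show ?thesis
    using hom by (simp add: iso_def bij_betw_def inj surj)
qed

text \<open>Pigeonhole: two multiples of \<open>x\<close> lie in the same coset, and their
  difference is a positive multiple in \<open>H\<close>.\<close>

lemma coset_index_pos_imp_multiple:
  fixes x :: "'k \<Rightarrow> int"
  assumes G: "add_subgroup G" and H: "add_subgroup H" and pos: "coset_index G H > 0" and x: "x \<in> G"
  obtains m :: nat where "m > 0" "(\<lambda>a. int m * x a) \<in> H"
proof -
  let ?q = "\<lambda>n::nat. (+) (\<lambda>a. int n * x a) ` H"
  have "range ?q \<subseteq> (\<lambda>x. (+) x ` H) ` G"
    using add_subgroup_scale[OF G x] by auto
  moreover have "finite ((\<lambda>x. (+) x ` H) ` G)"
    using pos unfolding coset_index_def by (rule card_ge_0_finite)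
  ultimately have "finite (range ?q)" by (rule finite_subset)
  then have "\<not> inj ?q" using finite_imageD infinite_UNIV_nat by blast
  then obtain m n where "m \<noteq> n" "?q m = ?q n" by (auto simp: inj_on_def)
  then obtain m n where mn: "m < n" "?q n = ?q m" by (metis linorder_neqE_nat)
  then have "(\<lambda>a. int n * x a) - (\<lambda>a. int m * x a) \<in> H" by (simp add: coset_eq_iff[OF H])
  moreover have "(\<lambda>a. int n * x a) - (\<lambda>a. int m * x a) = (\<lambda>a. int (n - m) * x a)"
    using mn(1) by (auto simp: fun_eq_iff of_nat_diff algebra_simps)
  ultimately show ?thesis using that[of "n - m"] mn(1) by simp
qed

section \<open>Cellular chains and relative acyclicity\<close>

context finite_CW
begin

lemma cells_disjoint: "i \<noteq> j \<Longrightarrow> cells K i \<inter> cells K j = {}"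
proof -
  have "{} \<notin> open_cells K n" for n using cell_nonempty by blast
  moreover have "open_cells K m \<inter> open_cells K n = {}" if "m \<noteq> n" for m n
    using disjoint_family_onD[OF disjoint_dims, of m n] that by simp
  ultimately show "i \<noteq> j \<Longrightarrow> cells K i \<inter> cells K j = {}"
    by (auto simp: cells_def)
qed

lemma cells_subset_skel: "k \<le> j \<Longrightarrow> cells K k \<subseteq> skel K j"
proof -
  assume "k \<le> j"
  then have "k \<in> {-1..j}" if "cells K k \<noteq> {}" using that by (auto simp: cells_def split: if_splits)
  then show ?thesis unfolding skel_def by blast
qed

lemma cells_Int_skel: "j < k \<Longrightarrow> cells K k \<inter> skel K j = {}"
proof -
  assume "j < k"
  have "x \<notin> cells K k" if "x \<in> skel K j" for x
  proof -
    obtain i where "i \<le> j" "x \<in> cells K i" using \<open>x \<in> skel K j\<close> by (auto simp: skel_def)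
    then show ?thesis using cells_disjoint[of i k] \<open>j < k\<close> by auto
  qed
  then show ?thesis by blast
qed

lemma skel_step: "j \<ge> -1 \<Longrightarrow> skel K j = skel K (j - 1) \<union> cells K j"
proof -
  assume "j \<ge> -1"
  then have "{-1..j} = insert j {-1..j - 1}" by auto
  then show ?thesis by (simp add: skel_def Un_commute)
qed

lemma chains_eq: "chains K k Y = supported (cells K k \<inter> Y)"
  by (simp add: chains_def supported_def)

lemma bdry_supported: "bdry K k c \<in> supported (cells K (k - 1))"
  by (simp add: supported_def bdry_def incidence_support)

lemma bdry_diff: "bdry K k (b - c) = bdry K k b - bdry K k c"
  by (simp add: bdry_def fun_eq_iff algebra_simps sum_subtractf)

lemma bdry_0: "bdry K k 0 = 0"
  by (simp add: bdry_def fun_eq_iff)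

lemma bdry_bdry: "bdry K (k - 1) (bdry K k c) = (0 :: _ \<Rightarrow> 'r::comm_ring_1)"
proof
  fix \<rho>
  have "bdry K (k - 1) (bdry K k c) \<rho> = (\<Sum>\<tau>\<in>cells K (k - 1). \<Sum>\<sigma>\<in>cells K k.
      of_int (incidence K k \<sigma> \<tau> * incidence K (k - 1) \<tau> \<rho>) * c \<sigma>)"
    by (simp add: bdry_def sum_distrib_left mult_ac)
  also have "\<dots> = (\<Sum>\<sigma>\<in>cells K k. of_int (\<Sum>\<tau>\<in>cells K (k - 1). incidence K k \<sigma> \<tau> * incidence K (k - 1) \<tau> \<rho>) * c \<sigma>)"
    by (subst sum.swap) (simp add: sum_distrib_right)
  also have "\<dots> = 0" by (simp only: incidence_incidence) simp
  finally show "bdry K (k - 1) (bdry K k c) \<rho> = (0 :: _ \<Rightarrow> 'r) \<rho>" by simp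
qed

definition cyc :: "int \<Rightarrow> 'a set set \<Rightarrow> ('a set \<Rightarrow> 'r::comm_ring_1) set"
  where "cyc k U = {c \<in> supported U. bdry K k c = 0}"

definition bnd :: "int \<Rightarrow> 'a set set \<Rightarrow> ('a set \<Rightarrow> 'r::comm_ring_1) set"
  where "bnd k U = bdry K k ` supported U"

lemma add_subgroup_cyc: "add_subgroup (cyc k U :: ('a set \<Rightarrow> 'r::comm_ring_1) set)"
  using add_subgroup_supported[of U, where 'b = 'r]
  by (auto simp: add_subgroup_def cyc_def bdry_diff bdry_0)

lemma add_subgroup_bnd: "add_subgroup (bnd k U :: ('a set \<Rightarrow> 'r::comm_ring_1) set)"
proof -
  have "(0 :: 'a set \<Rightarrow> 'r) \<in> bnd k U"
    unfolding bnd_def using add_subgroup_0[OF add_subgroup_supported] by (rule rev_image_eqI) (simp add: bdry_0)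
  moreover have "bdry K k b - bdry K k c \<in> bnd k U" if "b \<in> supported U" "c \<in> supported U" for b c :: "'a set \<Rightarrow> 'r"
    using add_subgroup_diff[OF add_subgroup_supported that] by (auto simp: bnd_def simp flip: bdry_diff)
  ultimately show ?thesis by (auto simp: add_subgroup_def bnd_def)
qed

lemma bnd_empty: "bnd k {} = {0 :: 'a set \<Rightarrow> 'r::comm_ring_1}"
proof -
  have "supported {} = {0 :: 'a set \<Rightarrow> 'r}" by (auto simp: supported_def)
  then show "bnd k {} = {0 :: 'a set \<Rightarrow> 'r}" by (simp add: bnd_def bdry_0)
qed

lemma bnd_subset_cyc:
  assumes "cells K k \<subseteq> V" shows "bnd (k + 1) U \<subseteq> (cyc k V :: ('a set \<Rightarrow> 'r::comm_ring_1) set)"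
proof
  fix x :: "'a set \<Rightarrow> 'r" assume "x \<in> bnd (k + 1) U"
  then obtain b where b: "x = bdry K (k + 1) b" by (auto simp: bnd_def)
  have "bdry K k x = 0" using bdry_bdry[of "k + 1" b] by (simp add: b)
  moreover have "x \<in> supported V" using bdry_supported[of "k + 1" b] assms by (auto simp: b supported_def)
  ultimately show "x \<in> cyc k V" by (simp add: cyc_def)
qed

lemma cell_homology_absolute:
  "(cell_homology K k Y {} :: ('a set \<Rightarrow> 'r::comm_ring_1) set monoid) =
    additive_group (cyc k (cells K k \<inter> Y)) Mod bnd (k + 1) (cells K (k + 1) \<inter> Y)"
  and rel_boundaries_absolute:
  "rel_boundaries K k Y {} = (bnd (k + 1) (cells K (k + 1) \<inter> Y) :: ('a set \<Rightarrow> 'r::comm_ring_1) set)"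
  and rel_cycles_absolute:
  "(rel_cycles K k Y {} :: ('a set \<Rightarrow> 'r::comm_ring_1) monoid) = additive_group (cyc k (cells K k \<inter> Y))"
proof -
  have z: "supported {} = {0 :: 'a set \<Rightarrow> 'r}" by (auto simp: supported_def)
  show b: "rel_boundaries K k Y {} = (bnd (k + 1) (cells K (k + 1) \<inter> Y) :: ('a set \<Rightarrow> 'r) set)"
    by (auto simp: rel_boundaries_def bnd_def chains_eq z)
  show c: "(rel_cycles K k Y {} :: ('a set \<Rightarrow> 'r) monoid) = additive_group (cyc k (cells K k \<inter> Y))"
    by (simp add: rel_cycles_def additive_group_def cyc_def chains_eq z)
  show "(cell_homology K k Y {} :: ('a set \<Rightarrow> 'r) set monoid) =
    additive_group (cyc k (cells K k \<inter> Y)) Mod bnd (k + 1) (cells K (k + 1) \<inter> Y)"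
    by (simp add: cell_homology_def b c)
qed

abbreviation ridges :: "'a set set" where "ridges \<equiv> cells K (int d - 1)"
abbreviation facets :: "'a set set" where "facets \<equiv> cells K (int d)"

lemma bnd_lattice:
  assumes "U \<subseteq> facets"
  shows "bnd (int d) U = int_lattice U (incidence K (int d))"
proof
  have eq: "bdry K (int d) b = (\<lambda>\<tau>. \<Sum>\<sigma>\<in>U. b \<sigma> * incidence K (int d) \<sigma> \<tau>)" if "b \<in> supported U" for b :: "'a set \<Rightarrow> int"
  proof
    fix \<tau>
    have "(\<Sum>\<sigma>\<in>facets. incidence K (int d) \<sigma> \<tau> * b \<sigma>) = (\<Sum>\<sigma>\<in>U. incidence K (int d) \<sigma> \<tau> * b \<sigma>)"
      using that assms by (intro sum.mono_neutral_right finite_cells) (auto simp: supported_def)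
    then show "bdry K (int d) b \<tau> = (\<Sum>\<sigma>\<in>U. b \<sigma> * incidence K (int d) \<sigma> \<tau>)"
      by (simp add: bdry_def mult.commute)
  qed
  then show "bnd (int d) U \<subseteq> int_lattice U (incidence K (int d))"
    by (auto simp: bnd_def int_lattice_def)
  show "int_lattice U (incidence K (int d)) \<subseteq> bnd (int d) U"
  proof
    fix x assume "x \<in> int_lattice U (incidence K (int d))"
    then obtain c where c: "x = (\<lambda>\<tau>. \<Sum>\<sigma>\<in>U. c \<sigma> * incidence K (int d) \<sigma> \<tau>)" by (auto simp: int_lattice_def)
    let ?b = "\<lambda>\<sigma>. if \<sigma> \<in> U then c \<sigma> else 0"
    have b: "?b \<in> supported U" by (simp add: supported_def)
    have "bdry K (int d) ?b = x" unfolding eq[OF b] c by (auto intro!: sum.cong)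
    then show "x \<in> bnd (int d) U" using b by (auto simp: bnd_def)
  qed
qed

text \<open>A chain with a nonzero multiple among the boundaries is a cycle, since integers have no
  zero divisors. So torsion may be counted among all chains rather than cycles.\<close>

lemma torsion_order_absolute:
  assumes "facets \<inter> Y = U" "ridges \<subseteq> Y"
  shows "torsion_order K (int d - 1) Y {} =
    coset_index {a \<in> supported ridges. \<exists>m::nat. m > 0 \<and> (\<lambda>i. int m * a i) \<in> int_lattice U (incidence K (int d))}
      (int_lattice U (incidence K (int d)))"
proof -
  let ?L = "int_lattice U (incidence K (int d))"
  have U: "U \<subseteq> facets" using assms by blast
  have L: "bnd (int d) U = ?L" by (rule bnd_lattice[OF U])
  have ridges: "ridges \<inter> Y = ridges" using assms by blast
  have "?L \<subseteq> cyc (int d - 1) ridges"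
    using bnd_subset_cyc[of "int d - 1" ridges U, where 'r = int] by (simp add: L)
  then have "torsion_order K (int d - 1) Y {} =
    coset_index {a \<in> cyc (int d - 1) ridges. \<exists>m::nat. m > 0 \<and> (\<lambda>i. int m * a i) \<in> ?L} ?L"
    unfolding torsion_order_def Let_def cell_homology_absolute diff_add_cancel assms(1) ridges L
    by (rule torsion_quotient[OF add_subgroup_cyc add_subgroup_lattice])
  also have "{a \<in> cyc (int d - 1) ridges. \<exists>m::nat. m > 0 \<and> (\<lambda>i. int m * a i) \<in> ?L} =
      {a \<in> supported ridges. \<exists>m::nat. m > 0 \<and> (\<lambda>i. int m * a i) \<in> ?L}"
  proof -
    have "bdry K (int d - 1) a = 0" if "m > 0" "(\<lambda>i. int m * a i) \<in> ?L" for a :: "'a set \<Rightarrow> int" and m :: nat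
    proof -
      have "bdry K (int d - 1) (\<lambda>i. int m * a i) = 0"
        using that(2) \<open>?L \<subseteq> cyc (int d - 1) ridges\<close> by (auto simp: cyc_def)
      moreover have "bdry K (int d - 1) (\<lambda>i. int m * a i) \<tau> = int m * bdry K (int d - 1) a \<tau>" for \<tau>
        by (simp add: bdry_def sum_distrib_left mult_ac)
      ultimately show ?thesis using that(1) by (simp add: fun_eq_iff)
    qed
    then show ?thesis by (auto simp: cyc_def)
  qed
  finally show ?thesis .
qed

text \<open>\<open>\<Gamma>\<close> is full up to dimension d-2 and has no facets, so only degrees
  d-2 and d-1 carry information. Together they say that restriction to the ridges off
  \<open>\<Gamma>\<close> maps the rational boundaries bijectively onto all rational functions on
  these ridges.\<close>

lemma relatively_acyclic_iff:
  assumes \<Gamma>: "skel K (int d - 2) \<subseteq> \<Gamma>" "\<Gamma> \<subseteq> skel K (int d - 1)"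
  shows "relatively_acyclic K d \<Gamma> \<longleftrightarrow>
    (\<forall>x :: 'a set \<Rightarrow> rat. x \<in> supported ridges \<longrightarrow>
       (\<exists>b \<in> supported facets. \<forall>s \<in> ridges - \<Gamma>. x s = bdry K (int d) b s)) \<and>
    (\<forall>b :: 'a set \<Rightarrow> rat. b \<in> supported facets \<longrightarrow> (\<forall>s \<in> ridges - \<Gamma>. bdry K (int d) b s = 0) \<longrightarrow> bdry K (int d) b = 0)"
   (is "_ \<longleftrightarrow> ?onto \<and> ?inj")
proof -
  let ?Z = "\<lambda>k. cyc k (cells K k) :: ('a set \<Rightarrow> rat) set" and ?Z' = "\<lambda>k. cyc k (cells K k \<inter> \<Gamma>) :: ('a set \<Rightarrow> rat) set"
  let ?B = "\<lambda>k. bnd (k + 1) (cells K (k + 1)) :: ('a set \<Rightarrow> rat) set"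
    and ?B' = "\<lambda>k. bnd (k + 1) (cells K (k + 1) \<inter> \<Gamma>) :: ('a set \<Rightarrow> rat) set"
  define P where "P k \<longleftrightarrow> ?Z' k \<inter> ?B k \<subseteq> ?B' k \<and> (\<forall>z\<in>?Z k. \<exists>a\<in>?Z' k. z - a \<in> ?B k)" for k
  have low: "cells K k \<inter> \<Gamma> = cells K k" if "k \<le> int d - 2" for k
    using cells_subset_skel[OF that] \<Gamma> by blast
  have high: "cells K k \<inter> \<Gamma> = {}" if "k > int d - 1" for k
    using cells_Int_skel[OF that] \<Gamma> by blast
  have full: "cells K k \<inter> skel K (int d) = cells K k" if "k \<le> int d" for k
    using cells_subset_skel[OF that] by blast
  have "incl_induced K k (skel K (int d)) \<in> iso (cell_homology K k \<Gamma> {} :: ('a set \<Rightarrow> rat) set monoid)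
      (cell_homology K k (skel K (int d)) {}) \<longleftrightarrow> P k" if k: "k < int d" for k
  proof -
    have incl: "incl_induced K k (skel K (int d)) = (\<lambda>C. C <#>\<^bsub>additive_group (?Z k)\<^esub> ?B k)"
      using k by (intro ext) (simp add: incl_induced_def rel_cycles_absolute rel_boundaries_absolute full)
    have "?B' k \<subseteq> ?Z' k"
    proof (cases "k = int d - 1")
      case True
      then have "?B' k = {0}" using high[of "k + 1"] by (simp add: bnd_empty)
      then show ?thesis using add_subgroup_0[OF add_subgroup_cyc] by simp
    next
      case False
      then have "cells K k \<inter> \<Gamma> = cells K k" using k by (intro low) simp
      then show ?thesis by (simp add: bnd_subset_cyc)
    qed
    moreover have "?B k \<subseteq> ?Z k" by (simp add: bnd_subset_cyc)
    moreover have "?Z' k \<subseteq> ?Z k" by (auto simp: cyc_def supported_def)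
    moreover have "?B' k \<subseteq> ?B k" unfolding bnd_def by (rule image_mono) (auto simp: supported_def)
    ultimately show ?thesis
      unfolding incl P_def using k
      by (subst inclusion_iso_iff[symmetric]) (auto simp: add_subgroup_cyc add_subgroup_bnd cell_homology_absolute full)
  qed
  then have "relatively_acyclic K d \<Gamma> \<longleftrightarrow> (\<forall>k<int d. P k)"
    using \<Gamma> by (simp add: relatively_acyclic_def)
  also have "\<dots> \<longleftrightarrow> P (int d - 2) \<and> P (int d - 1)"
  proof -
    have "P k" if "k \<le> int d - 3" for k
      unfolding P_def using that low[of k] low[of "k + 1"] add_subgroup_0[OF add_subgroup_bnd] by force
    moreover have "k \<le> int d - 3 \<or> k = int d - 2 \<or> k = int d - 1" if "k < int d" for k
      using that by linarith
    ultimately have "P k" if "k < int d" "P (int d - 2)" "P (int d - 1)" for k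
      using that by blast
    then show ?thesis by auto
  qed
  \<comment> \<open>In degree d-2 the two groups of cycles coincide, so only the boundaries have to
    be compared.\<close>
  also have "P (int d - 2) \<longleftrightarrow> ?B (int d - 2) \<subseteq> ?B' (int d - 2)"
    unfolding P_def low[OF order_refl]
    using bnd_subset_cyc[of "int d - 2" "cells K (int d - 2)" "cells K (int d - 2 + 1)", where 'r = rat]
      add_subgroup_0[OF add_subgroup_bnd] by force
  \<comment> \<open>Without facets \<open>\<Gamma>\<close> has only the zero boundary in degree
    d-1.\<close>
  also have "P (int d - 1) \<longleftrightarrow> ?Z' (int d - 1) \<inter> bnd (int d) facets \<subseteq> {0} \<and>
      (\<forall>z\<in>?Z (int d - 1). \<exists>a\<in>?Z' (int d - 1). z - a \<in> bnd (int d) facets)"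
  proof -
    have "?B' (int d - 1) = {0}"
      using high[of "int d"] by (simp add: bnd_empty)
    then show ?thesis by (simp add: P_def)
  qed
  also have "?B (int d - 2) \<subseteq> ?B' (int d - 2) \<and> ?Z' (int d - 1) \<inter> bnd (int d) facets \<subseteq> {0} \<and>
      (\<forall>z\<in>?Z (int d - 1). \<exists>a\<in>?Z' (int d - 1). z - a \<in> bnd (int d) facets) \<longleftrightarrow> ?onto \<and> ?inj"
  proof (intro iffI conjI allI ballI impI)
    assume *: "?B (int d - 2) \<subseteq> ?B' (int d - 2) \<and> ?Z' (int d - 1) \<inter> bnd (int d) facets \<subseteq> {0} \<and>
      (\<forall>z\<in>?Z (int d - 1). \<exists>a\<in>?Z' (int d - 1). z - a \<in> bnd (int d) facets)"
    {
      fix x :: "'a set \<Rightarrow> rat" assume x: "x \<in> supported ridges"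
      then have "bdry K (int d - 1) x \<in> ?B (int d - 2)" by (simp add: bnd_def)
      \<comment> \<open>Subtracting a chain of \<open>\<Gamma>\<close> with the same boundary turns
        \<open>x\<close> into a cycle, to which surjectivity in degree d-1 applies.\<close>
      then obtain y where y: "y \<in> supported (ridges \<inter> \<Gamma>)" "bdry K (int d - 1) x = bdry K (int d - 1) y"
        using * by (auto simp: bnd_def)
      then have "x - y \<in> ?Z (int d - 1)"
        using x by (auto simp: cyc_def supported_def bdry_diff)
      then obtain a b where "a \<in> ?Z' (int d - 1)" "b \<in> supported facets" "x - y - a = bdry K (int d) b"
        using * by (fastforce simp: bnd_def)
      moreover from this(3) have "x = bdry K (int d) b + (y + a)" by (simp add: algebra_simps)
      ultimately show "\<exists>b \<in> supported facets. \<forall>s \<in> ridges - \<Gamma>. x s = bdry K (int d) b s"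
        using y(1) by (intro bexI[of _ b]) (auto simp: cyc_def supported_def)
    next
      fix b :: "'a set \<Rightarrow> rat"
      assume b: "b \<in> supported facets" "\<forall>s \<in> ridges - \<Gamma>. bdry K (int d) b s = 0"
      have "bdry K (int d) b \<in> ?Z' (int d - 1)"
        using b(2) bdry_supported[of "int d" b] by (auto simp: cyc_def bdry_bdry supported_def)
      then show "bdry K (int d) b = 0" using * b(1) by (auto simp: bnd_def)
    }
  next
    assume *: "?onto \<and> ?inj"
    {
      show "?B (int d - 2) \<subseteq> ?B' (int d - 2)"
      proof
        fix y assume "y \<in> ?B (int d - 2)"
        then obtain x where x: "x \<in> supported ridges" "y = bdry K (int d - 1) x" by (auto simp: bnd_def)
        then obtain b where b: "b \<in> supported facets" "\<forall>s \<in> ridges - \<Gamma>. x s = bdry K (int d) b s" using * by blast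
        have "x - bdry K (int d) b \<in> supported (ridges \<inter> \<Gamma>)"
          using x(1) b(2) bdry_supported[of "int d" b] by (auto simp: supported_def) (metis DiffI)
        moreover have "y = bdry K (int d - 1) (x - bdry K (int d) b)"
          by (simp add: x(2) bdry_diff bdry_bdry)
        ultimately show "y \<in> ?B' (int d - 2)" by (simp add: bnd_def)
      qed
      show "?Z' (int d - 1) \<inter> bnd (int d) facets \<subseteq> {0}"
      proof
        fix y assume y: "y \<in> ?Z' (int d - 1) \<inter> bnd (int d) facets"
        then obtain b where "b \<in> supported facets" "y = bdry K (int d) b" by (auto simp: bnd_def)
        then show "y \<in> {0}" using y * by (auto simp: cyc_def supported_def)
      qed
      fix z assume z: "z \<in> ?Z (int d - 1)"
      then obtain b where b: "b \<in> supported facets" "\<forall>s \<in> ridges - \<Gamma>. z s = bdry K (int d) b s"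
        using * by (auto simp: cyc_def)
      have "z - bdry K (int d) b \<in> ?Z' (int d - 1)"
        using z b(2) bdry_supported[of "int d" b] by (auto simp: cyc_def supported_def bdry_diff bdry_bdry) (metis DiffI)
      then show "\<exists>a\<in>?Z' (int d - 1). z - a \<in> bnd (int d) facets"
        using b(1) by (intro bexI[of _ "z - bdry K (int d) b"]) (auto simp: bnd_def)
    }
  qed
  finally show ?thesis .
qed

end

section \<open>Rational criteria for row bases and exchange of a basis column\<close>

lemma det_replace_col:
  fixes w :: "nat \<Rightarrow> nat \<Rightarrow> 'b::comm_ring_1"
  assumes "k < r"
  shows "Determinant.det (col_matrix r (w(k := \<lambda>a. \<Sum>b<r. c b * w b a))) = c k * Determinant.det (col_matrix r w)"
proof -
  let ?A = "col_matrix r w"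
  have "col_matrix r (w(k := \<lambda>a. \<Sum>b<r. c b * w b a)) = replace_col ?A (?A *\<^sub>v vec r c) k"
    by (rule eq_matI)
      (auto simp: replace_col_def col_matrix_def scalar_prod_def atLeast0LessThan mult.commute intro!: sum.cong)
  then show ?thesis
    using cramer_lemma_mat[of ?A r "vec r c" k] assms by (simp add: col_matrix_def)
qed

context col_basis
begin

lemma row_basis_enumeration:
  assumes "row_basis S"
  obtains f where "f \<in> {0..<r} \<rightarrow> R" "f ` {0..<r} = S" "minor f \<noteq> 0"
proof -
  have "finite S" "card S = r" "S \<subseteq> R"
    using assms finite_subset[OF _ finite_rows] by (auto simp: row_basis_def)
  then obtain f where "bij_betw f {0..<r} S"
    using ex_bij_betw_nat_finite[of S] by auto
  then have "f ` {0..<r} = S" by (simp add: bij_betw_def)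
  moreover from this have "f \<in> {0..<r} \<rightarrow> R" using \<open>S \<subseteq> R\<close> by auto
  ultimately show ?thesis using that minor_nonzero_iff assms by blast
qed

text \<open>Positivity says that the quotient is finite; for a pair this makes the homology in
  degree d-1 purely torsion.\<close>

lemma coset_index_row_lattice_pos:
  assumes "row_basis S" shows "coset_index (supported R) (row_lattice S) > 0"
proof -
  obtain f where f: "f \<in> {0..<r} \<rightarrow> R" "f ` {0..<r} = S" "minor f \<noteq> 0"
    using row_basis_enumeration[OF assms] .
  have "nat \<bar>minor f\<bar> > 0" using f by simp
  then have "coset_index (supported {..<r}) (proj f ` saturation) > 0"
    by (simp add: minor_index[OF f(1,3)])
  then show ?thesis
    using coset_index_row_lattice[OF f(1,3)] coset_index_pos f(2) by simp
qed

text \<open>The rational boundary map: acyclicity is defined over the rationals, bases over the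
  reals, and \<open>rat_comb_real_span\<close> connects the two.\<close>

definition rat_comb :: "('i \<Rightarrow> rat) \<Rightarrow> 'k \<Rightarrow> rat"
  where "rat_comb b x = (\<Sum>j\<in>F. of_int (v j x) * b j)"

lemma rat_comb_real_span: "(\<lambda>x. real_of_rat (rat_comb b x)) \<in> real_span"
proof -
  have "(\<lambda>x. \<Sum>j\<in>F. real_of_rat (b j) * real_of_int (v j x)) \<in> real_span"
    by (intro real_span_sum finite_cols col_in_real_span)
  then show ?thesis by (simp add: rat_comb_def of_rat_sum of_rat_mult mult.commute)
qed

lemma row_basis_rat_inj:
  assumes "row_basis S" "\<forall>s\<in>S. rat_comb b s = 0" shows "rat_comb b x = 0"
  using real_span_zero[OF rat_comb_real_span assms(1), of b x] assms(2) by simp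

text \<open>By finiteness of the index a positive multiple \<open>m\<close> of each unit vector lies
  in \<open>row_lattice\<close>; division by \<open>m\<close> yields a rational combination of
  columns with the prescribed values on \<open>S\<close>.\<close>

lemma row_basis_rat_onto:
  assumes S: "row_basis S"
  shows "\<exists>b\<in>supported F. \<forall>s\<in>S. x s = rat_comb b s"
proof -
  have SR: "S \<subseteq> R" "finite S" using S finite_subset[OF _ finite_rows] by (auto simp: row_basis_def)
  have "\<exists>b. \<forall>s'\<in>S. rat_comb b s' = (if s' = s then 1 else 0)" if s: "s \<in> S" for s
  proof -
    let ?e = "\<lambda>a. if a = s then 1 else 0 :: int"
    have "?e \<in> supported R" using SR s by (auto simp: supported_def)
    then obtain m :: nat where m: "m > 0" "(\<lambda>a. int m * ?e a) \<in> row_lattice S"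
      using coset_index_pos_imp_multiple[OF add_subgroup_supported add_subgroup_row_lattice
          coset_index_row_lattice_pos[OF S]] by blast
    then obtain c y where c: "(\<lambda>a. int m * ?e a) = (\<lambda>a. \<Sum>j\<in>F. c j * v j a) + y" "y \<in> supported (R - S)"
      by (auto simp: row_lattice_def int_lattice_def)
    have "rat_comb (\<lambda>j. of_int (c j) / of_nat m) s' = (if s' = s then 1 else 0)" if "s' \<in> S" for s'
    proof -
      have "int m * ?e s' = (\<Sum>j\<in>F. c j * v j s')"
        using fun_cong[OF c(1), of s'] c(2) that by (simp add: supported_def)
      then have "(of_nat m :: rat) * of_int (?e s') = (\<Sum>j\<in>F. of_int (c j) * of_int (v j s'))"
        by (metis (no_types, lifting) of_int_mult of_int_of_nat_eq of_int_sum sum.cong)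
      then show ?thesis
        using m(1) by (simp add: rat_comb_def field_simps sum_divide_distrib[symmetric] split: if_splits)
    qed
    then show ?thesis by blast
  qed
  then obtain u where u: "\<And>s s'. s \<in> S \<Longrightarrow> s' \<in> S \<Longrightarrow> rat_comb (u s) s' = (if s' = s then 1 else 0)"
    by metis
  define b where "b j = (if j \<in> F then \<Sum>s\<in>S. x s * u s j else 0)" for j
  have "rat_comb b s' = x s'" if s': "s' \<in> S" for s'
  proof -
    have "rat_comb b s' = (\<Sum>j\<in>F. \<Sum>s\<in>S. x s * (of_int (v j s') * u s j))"
      by (simp add: rat_comb_def b_def sum_distrib_left mult_ac)
    also have "\<dots> = (\<Sum>s\<in>S. x s * rat_comb (u s) s')"
      by (subst sum.swap) (simp add: rat_comb_def sum_distrib_left)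
    also have "\<dots> = (\<Sum>s\<in>S. x s * (if s' = s then 1 else 0))"
      using u s' by (intro sum.cong) auto
    also have "\<dots> = x s'" using SR s' by (simp add: if_distrib[of "times _"] cong: if_cong)
    finally show ?thesis .
  qed
  then show ?thesis by (intro bexI[of _ b]) (auto simp: supported_def b_def)
qed

text \<open>The cardinality of \<open>S\<close> is found by computing the trace of the product of two mutually
  inverse matrices in both orders.\<close>

lemma row_basisI:
  assumes SR: "S \<subseteq> R"
    and onto: "\<And>x. x \<in> supported R \<Longrightarrow> \<exists>b\<in>supported F. \<forall>s\<in>S. x s = rat_comb b s"
    and inj: "\<And>b. b \<in> supported F \<Longrightarrow> (\<And>s. s \<in> S \<Longrightarrow> rat_comb b s = 0) \<Longrightarrow> (\<And>x. rat_comb b x = 0)"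
  shows "row_basis S"
proof -
  have fS: "finite S" using SR finite_rows by (rule finite_subset)
  have "\<exists>b\<in>supported F. \<forall>s'\<in>S. rat_comb b s' = (if s' = s then 1 else 0)" if "s \<in> S" for s
  proof -
    have "(\<lambda>a. if a = s then 1 else 0) \<in> supported R" using that SR by (auto simp: supported_def)
    from onto[OF this] show ?thesis by metis
  qed
  then obtain u where uF: "\<And>s. s \<in> S \<Longrightarrow> u s \<in> supported F"
    and u: "\<And>s s'. s \<in> S \<Longrightarrow> s' \<in> S \<Longrightarrow> rat_comb (u s) s' = (if s' = s then 1 else 0)"
    by metis
  define U where "U s x = real_of_rat (rat_comb (u s) x)" for s x
  have U_S: "U s s' = (if s' = s then 1 else 0)" if "s \<in> S" "s' \<in> S" for s s'
    using u[OF that] by (simp add: U_def)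
  \<comment> \<open>The \<open>U s\<close> are dual to the coordinates in \<open>S\<close>. The
    difference of both sides is the image of a rational chain and vanishes on \<open>S\<close>,
    hence everywhere by \<open>inj\<close>.\<close>
  have col: "real_of_int (v j x) = (\<Sum>s\<in>S. real_of_int (v j s) * U s x)" if j: "j \<in> F" for j x
  proof -
    let ?b = "\<lambda>i. (if i = j then 1 else 0) - (\<Sum>s\<in>S. of_int (v j s) * u s i)"
    have eq: "rat_comb ?b y = of_int (v j y) - (\<Sum>s\<in>S. of_int (v j s) * rat_comb (u s) y)" for y
    proof -
      have "rat_comb ?b y = (\<Sum>i\<in>F. of_int (v i y) * (if i = j then 1 else 0)) -
          (\<Sum>i\<in>F. \<Sum>s\<in>S. of_int (v j s) * (of_int (v i y) * u s i))"
        by (simp add: rat_comb_def right_diff_distrib sum_subtractf sum_distrib_left mult_ac)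
      also have "(\<Sum>i\<in>F. \<Sum>s\<in>S. of_int (v j s) * (of_int (v i y) * u s i)) =
          (\<Sum>s\<in>S. of_int (v j s) * rat_comb (u s) y)"
        by (subst sum.swap) (simp add: rat_comb_def sum_distrib_left)
      finally show ?thesis
        using j finite_cols by (simp add: if_distrib[of "times _"] cong: if_cong)
    qed
    have "?b \<in> supported F" using j uF by (auto simp: supported_def intro!: sum.neutral)
    moreover have "rat_comb ?b s = 0" if "s \<in> S" for s
    proof -
      have "(\<Sum>s'\<in>S. of_int (v j s') * rat_comb (u s') s) = (\<Sum>s'\<in>S. of_int (v j s') * (if s = s' then 1 else 0))"
        using u that by (intro sum.cong) auto
      then show ?thesis
        unfolding eq using that fS by (simp add: if_distrib[of "times _"] cong: if_cong)
    qed
    ultimately have "rat_comb ?b x = 0" by (rule inj)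
    then have "real_of_rat (of_int (v j x)) = real_of_rat (\<Sum>s\<in>S. of_int (v j s) * rat_comb (u s) x)"
      unfolding eq by simp
    then show ?thesis by (simp add: U_def of_rat_sum of_rat_mult)
  qed
  have comb: "(\<Sum>i\<in>set \<Upsilon>. c i * real_of_int (v i x)) =
      (\<Sum>s\<in>S. (\<Sum>i\<in>set \<Upsilon>. c i * real_of_int (v i s)) * U s x)" for c x
  proof -
    have "(\<Sum>i\<in>set \<Upsilon>. c i * real_of_int (v i x)) = (\<Sum>i\<in>set \<Upsilon>. \<Sum>s\<in>S. c i * real_of_int (v i s) * U s x)"
      using basis_subset by (intro sum.cong) (auto simp: col[of _ x] sum_distrib_left mult.assoc)
    then show ?thesis by (subst (asm) sum.swap) (simp add: sum_distrib_right)
  qed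
  have "U s \<in> real_span" for s unfolding U_def by (rule rat_comb_real_span)
  then have "\<exists>c. \<forall>x. U s x = (\<Sum>i\<in>set \<Upsilon>. c i * real_of_int (v i x))" for s
    by (force simp: real_span_def dest: fun_cong)
  then obtain w where w: "\<And>s x. U s x = (\<Sum>i\<in>set \<Upsilon>. w s i * real_of_int (v i x))" by metis
  \<comment> \<open>Expanding a basis column by \<open>U\<close> and then back in the basis is the
    identity; the trace needs only the diagonal entries.\<close>
  have inv: "(\<Sum>s\<in>S. real_of_int (v i s) * w s i) = 1" if i: "i \<in> set \<Upsilon>" for i
  proof -
    define c where "c l = (\<Sum>s\<in>S. real_of_int (v i s) * w s l) - (if l = i then 1 else 0)" for l
    have "(\<Sum>l\<in>set \<Upsilon>. c l * real_of_int (v l x)) = 0" for x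
    proof -
      have "real_of_int (v i x) = (\<Sum>s\<in>S. real_of_int (v i s) * (\<Sum>l\<in>set \<Upsilon>. w s l * real_of_int (v l x)))"
        using col[of i x] basis_subset i w by auto
      also have "\<dots> = (\<Sum>l\<in>set \<Upsilon>. (\<Sum>s\<in>S. real_of_int (v i s) * w s l) * real_of_int (v l x))"
        by (simp add: sum_distrib_left sum_distrib_right mult.assoc) (rule sum.swap)
      finally show ?thesis
        using i by (simp add: c_def left_diff_distrib sum_subtractf if_distrib[of "\<lambda>t. t * _"] cong: if_cong)
    qed
    then have "c i = 0" using i by (rule basis_indep)
    then show ?thesis by (simp add: c_def)
  qed
  have "real (card S) = (\<Sum>s\<in>S. U s s)" using U_S by simp
  also have "\<dots> = (\<Sum>s\<in>S. \<Sum>i\<in>set \<Upsilon>. w s i * real_of_int (v i s))" by (simp add: w)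
  also have "\<dots> = (\<Sum>i\<in>set \<Upsilon>. \<Sum>s\<in>S. real_of_int (v i s) * w s i)"
    by (subst sum.swap) (simp add: mult.commute)
  also have "\<dots> = (\<Sum>i\<in>set \<Upsilon>. 1)" by (intro sum.cong) (auto simp: inv)
  also have "\<dots> = real r" by (simp add: distinct_card distinct_basis)
  finally have "card S = r" by simp
  moreover have "\<forall>i\<in>set \<Upsilon>. c i = 0" if "\<forall>s\<in>S. (\<Sum>i\<in>set \<Upsilon>. c i * real_of_int (v i s)) = 0" for c
  proof -
    have "(\<Sum>i\<in>set \<Upsilon>. c i * real_of_int (v i x)) = 0" for x
      using that by (subst comb) simp
    then show ?thesis using basis_indep by blast
  qed
  ultimately show ?thesis using SR by (simp add: row_basis_def)
qed

text \<open>On rows where the new basis is nonsingular, both minors contain the same index of the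
  projected saturation. The lattice indices are thus in the ratio of the minors, which Cramer's rule
  identifies with the coefficient of the replaced column.\<close>

lemma coset_index_replace:
  assumes "col_basis R F v (\<Upsilon>[k := \<rho>])" "k < r"
    and c: "\<And>x. real_of_int (v \<rho> x) = (\<Sum>i\<in>set \<Upsilon>. c i * real_of_int (v i x))"
  shows "real (coset_index saturation (int_lattice (set (\<Upsilon>[k := \<rho>])) v)) =
    \<bar>c (\<Upsilon> ! k)\<bar> * real (coset_index saturation (int_lattice (set \<Upsilon>) v))"
proof -
  interpret N: col_basis R F v "\<Upsilon>[k := \<rho>]" by fact
  obtain f where f: "f \<in> {0..<N.r} \<rightarrow> R" "N.minor f \<noteq> 0" by (rule N.exists_minor)
  have "real_of_int (N.minor f) =
      Determinant.det (col_matrix r (\<lambda>b a. real_of_int (v (\<Upsilon>[k := \<rho>] ! b) (f a))))"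
    by (simp add: N.minor_def real_det_col_matrix)
  also have "col_matrix r (\<lambda>b a. real_of_int (v (\<Upsilon>[k := \<rho>] ! b) (f a))) =
      col_matrix r ((\<lambda>b a. real_of_int (v (\<Upsilon> ! b) (f a)))(k := \<lambda>a. \<Sum>b<r. c (\<Upsilon> ! b) * real_of_int (v (\<Upsilon> ! b) (f a))))"
    by (rule eq_matI) (auto simp: col_matrix_def nth_list_update c sum_basis)
  finally have m: "real_of_int (N.minor f) = c (\<Upsilon> ! k) * real_of_int (minor f)"
    using det_replace_col[OF assms(2), of "\<lambda>b a. real_of_int (v (\<Upsilon> ! b) (f a))" "\<lambda>b. c (\<Upsilon> ! b)"]
    by (simp add: minor_def real_det_col_matrix)
  then have nz: "minor f \<noteq> 0" using f(2) by auto
  have eq: "N.proj = proj"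
    by (simp add: N.proj_def[abs_def] proj_def[abs_def])
  have n: "real (nat \<bar>z\<bar>) = \<bar>real_of_int z\<bar>" for z by simp
  have f': "f \<in> {0..<r} \<rightarrow> R" using f(1) by simp
  let ?C = "real (coset_index (supported {..<r}) (proj f ` saturation))"
  have 1: "\<bar>real_of_int (minor f)\<bar> = ?C * real (coset_index saturation (int_lattice (set \<Upsilon>) v))"
    unfolding n[symmetric] minor_index[OF f' nz] by (rule of_nat_mult)
  have 2: "\<bar>real_of_int (N.minor f)\<bar> = ?C * real (coset_index saturation (int_lattice (set (\<Upsilon>[k := \<rho>])) v))"
    unfolding n[symmetric] N.minor_index[OF f] eq by (simp only: of_nat_mult length_list_update)
  have "?C \<noteq> 0" using 1 nz by (intro notI) simp
  moreover have "?C * real (coset_index saturation (int_lattice (set (\<Upsilon>[k := \<rho>])) v)) =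
      ?C * (\<bar>c (\<Upsilon> ! k)\<bar> * real (coset_index saturation (int_lattice (set \<Upsilon>) v)))"
    unfolding 2[symmetric] m abs_mult 1 by (simp only: mult_ac)
  ultimately show ?thesis by simp
qed

text \<open>Cramer's rule again, after a transposition because here a row is replaced.\<close>

lemma gram_replace:
  assumes "k < r" and c: "\<And>x. real_of_int (v \<rho> x) = (\<Sum>i\<in>set \<Upsilon>. c i * real_of_int (v i x))"
  shows "Determinant.det (mat r r (\<lambda>(a, b). \<Sum>x\<in>R. real_of_int (v (\<Upsilon>[k := \<rho>] ! a) x) * real_of_int (v (\<Upsilon> ! b) x))) =
    c (\<Upsilon> ! k) * Determinant.det (mat r r (\<lambda>(a, b). \<Sum>x\<in>R. real_of_int (v (\<Upsilon> ! a) x) * real_of_int (v (\<Upsilon> ! b) x)))"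
proof -
  define g where "g a b = (\<Sum>x\<in>R. real_of_int (v (\<Upsilon> ! a) x) * real_of_int (v (\<Upsilon> ! b) x))" for a b
  define h where "h a b = (\<Sum>x\<in>R. real_of_int (v (\<Upsilon>[k := \<rho>] ! a) x) * real_of_int (v (\<Upsilon> ! b) x))" for a b
  have h: "h a b = (g(k := \<lambda>b. \<Sum>a<r. c (\<Upsilon> ! a) * g a b)) a b" if "a < r" for a b
  proof (cases "a = k")
    case True
    have "h a b = (\<Sum>x\<in>R. \<Sum>a<r. c (\<Upsilon> ! a) * (real_of_int (v (\<Upsilon> ! a) x) * real_of_int (v (\<Upsilon> ! b) x)))"
      using True assms by (simp add: h_def c sum_basis sum_distrib_right mult.assoc)
    also have "\<dots> = (\<Sum>a<r. c (\<Upsilon> ! a) * g a b)"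
      by (subst sum.swap) (simp add: g_def sum_distrib_left)
    finally show ?thesis using True by simp
  qed (simp add: h_def g_def)
  have tr: "Determinant.det (mat r r (\<lambda>(a, b). w a b)) = Determinant.det (col_matrix r w)" for w :: "nat \<Rightarrow> nat \<Rightarrow> real"
  proof -
    have "mat r r (\<lambda>(a, b). w a b) = transpose_mat (col_matrix r w)"
      by (rule eq_matI) (auto simp: col_matrix_def)
    then show ?thesis by (simp add: det_transpose[of _ r] col_matrix_def)
  qed
  have "col_matrix r h = col_matrix r (g(k := \<lambda>b. \<Sum>a<r. c (\<Upsilon> ! a) * g a b))"
    by (rule eq_matI) (auto simp: col_matrix_def h)
  then have "Determinant.det (mat r r (\<lambda>(a, b). h a b)) = c (\<Upsilon> ! k) * Determinant.det (mat r r (\<lambda>(a, b). g a b))"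
    unfolding tr using det_replace_col[OF assms(1), of g "\<lambda>a. c (\<Upsilon> ! a)"] by simp
  then show ?thesis by (simp add: h_def g_def)
qed

end

section \<open>Spanning forests\<close>

lemma sum_fun_apply: "(\<Sum>i\<in>I. f i) x = (\<Sum>i\<in>I. f i x :: 'b::comm_monoid_add)"
  by (induction I rule: infinite_finite_induct) auto

lemma remove1_nth:
  assumes "distinct xs" "b < length xs"
  shows "remove1 (xs ! b) xs = take b xs @ drop (Suc b) xs"
proof -
  have "remove1 (xs ! b) (take b xs @ xs ! b # drop (Suc b) xs) = take b xs @ drop (Suc b) xs"
    using assms id_take_nth_drop[OF assms(2)]
    by (subst remove1_append) (auto simp: in_set_conv_nth nth_eq_iff_index_eq)
  then show ?thesis using id_take_nth_drop[OF assms(2)] by simp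
qed

context finite_CW
begin

abbreviation inc :: "'a set \<Rightarrow> 'a set \<Rightarrow> int" where "inc \<equiv> incidence K (int d)"

lemma facet_col_eq: "\<sigma> \<in> facets \<Longrightarrow> facet_col K d \<sigma> = (\<lambda>\<tau>. real_of_int (inc \<sigma> \<tau>))"
  by (auto simp: facet_col_def bdry_def indicator_def finite_cells if_distrib[of "times _"] cong: if_cong)

lemma sum_facet_col:
  "U \<subseteq> facets \<Longrightarrow> (\<Sum>i\<in>U. c i *\<^sub>R facet_col K d i) = (\<lambda>x. \<Sum>i\<in>U. c i * real_of_int (inc i x))"
  by (rule ext, unfold sum_fun_apply, rule sum.cong) (auto simp: scaleR_fun_def facet_col_eq)

lemma span_facet_col:
  assumes "finite U" "inj_on (facet_col K d) U"
  shows "y \<in> span (facet_col K d ` U) \<longleftrightarrow> (\<exists>c. y = (\<Sum>i\<in>U. c i *\<^sub>R facet_col K d i))"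
proof
  assume "y \<in> span (facet_col K d ` U)"
  then obtain u where "y = (\<Sum>z\<in>facet_col K d ` U. u z *\<^sub>R z)"
    using assms by (auto simp: span_finite)
  then show "\<exists>c. y = (\<Sum>i\<in>U. c i *\<^sub>R facet_col K d i)"
    using assms by (auto simp: sum.reindex)
qed (auto intro: span_sum span_scale span_base)

text \<open>Injectivity of the columns, part of \<open>CSF\<close>, turns independence and span of a
  set of vectors into statements about coefficients indexed by facets.\<close>

lemma CSF_col_basis:
  assumes "CSF K d (set \<Upsilon>)" "distinct \<Upsilon>"
  shows "col_basis ridges facets inc \<Upsilon>"
proof
  have sub: "set \<Upsilon> \<subseteq> facets" and inj: "inj_on (facet_col K d) (set \<Upsilon>)"
    and ind: "independent (facet_col K d ` set \<Upsilon>)"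
    and span: "span (facet_col K d ` set \<Upsilon>) = span (facet_col K d ` facets)"
    using assms by (auto simp: CSF_def indep_cols_def)
  show "finite ridges" "finite facets" by (rule finite_cells)+
  show "set \<Upsilon> \<subseteq> facets" "distinct \<Upsilon>" by fact+
  show "inc j \<in> supported ridges" for j
    by (simp add: supported_def incidence_support)
  fix c :: "'a set \<Rightarrow> real" and i
  assume 0: "\<And>x. (\<Sum>i\<in>set \<Upsilon>. c i * real_of_int (inc i x)) = 0" and i: "i \<in> set \<Upsilon>"
  let ?u = "\<lambda>y. c (inv_into (set \<Upsilon>) (facet_col K d) y)"
  have "(\<Sum>y\<in>facet_col K d ` set \<Upsilon>. ?u y *\<^sub>R y) = (\<Sum>i\<in>set \<Upsilon>. c i *\<^sub>R facet_col K d i)"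
    using inj by (simp add: sum.reindex inv_into_f_f)
  also have "\<dots> = 0" using 0 by (simp add: sum_facet_col[OF sub] zero_fun_def)
  finally have "?u (facet_col K d i) = 0"
    using ind i by (intro independentD[OF ind _ subset_refl, of ?u]) auto
  then show "c i = 0" using inj i by (simp add: inv_into_f_f)
next
  fix j assume j: "j \<in> facets"
  have sub: "set \<Upsilon> \<subseteq> facets" and inj: "inj_on (facet_col K d) (set \<Upsilon>)"
    and span: "span (facet_col K d ` set \<Upsilon>) = span (facet_col K d ` facets)"
    using assms by (auto simp: CSF_def indep_cols_def)
  have "facet_col K d j \<in> span (facet_col K d ` set \<Upsilon>)"
    unfolding span using j by (intro span_base) auto
  then obtain c where "facet_col K d j = (\<Sum>i\<in>set \<Upsilon>. c i *\<^sub>R facet_col K d i)"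
    using span_facet_col[OF _ inj] by auto
  then have "\<forall>x. real_of_int (inc j x) = (\<Sum>i\<in>set \<Upsilon>. c i * real_of_int (inc i x))"
    using facet_col_eq[OF j] by (simp add: sum_facet_col[OF sub] fun_eq_iff)
  then show "\<exists>c. \<forall>x. real_of_int (inc j x) = (\<Sum>i\<in>set \<Upsilon>. c i * real_of_int (inc i x))" by blast
qed

context
  fixes \<Upsilon> :: "'a set list"
  assumes forest: "CSF K d (set \<Upsilon>)" and dist: "distinct \<Upsilon>"
begin

interpretation C: col_basis ridges facets inc \<Upsilon>
  by (rule CSF_col_basis[OF forest dist])

text \<open>By \<open>saturation_basis\<close> the torsion of every forest is counted inside one and
  the same group, which makes different forests comparable.\<close>

lemma facet_torsion_index:
  "facet_torsion K d (set \<Upsilon>) = coset_index C.saturation (int_lattice (set \<Upsilon>) inc)"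
proof -
  have sub: "set \<Upsilon> \<subseteq> facets" using forest by (simp add: CSF_def)
  have "facets \<inter> (skel K (int d - 1) \<union> set \<Upsilon>) = set \<Upsilon>"
    using sub cells_Int_skel[of "int d - 1" "int d"] by auto
  then show ?thesis
    unfolding facet_torsion_def C.saturation_basis
    by (rule torsion_order_absolute) (use cells_subset_skel[of "int d - 1"] in auto)
qed

lemma total_torsion_index:
  "torsion_order K (int d - 1) (skel K (int d)) {} = coset_index C.saturation (int_lattice facets inc)"
  unfolding C.saturation_def
  using cells_subset_skel[of "int d" "int d"] cells_subset_skel[of "int d - 1" "int d"]
  by (intro torsion_order_absolute) auto

text \<open>Since \<open>\<Gamma>\<close> contains all (d-2)-cells, every (d-1)-chain is a relative
  cycle; since the index is finite, every class is torsion. So the torsion order is the whole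
  index.\<close>

lemma pair_torsion_index:
  assumes \<Gamma>: "skel K (int d - 2) \<subseteq> \<Gamma>" "\<Gamma> \<subseteq> skel K (int d - 1)" and rb: "C.row_basis (ridges - \<Gamma>)"
  shows "torsion_order K (int d - 1) (skel K (int d)) \<Gamma> =
    coset_index (supported ridges) (C.row_lattice (ridges - \<Gamma>))"
proof -
  let ?Z = "supported ridges :: ('a set \<Rightarrow> int) set" and ?B = "C.row_lattice (ridges - \<Gamma>)"
  have full: "ridges \<inter> skel K (int d) = ridges" "facets \<inter> skel K (int d) = facets"
    using cells_subset_skel[of "int d" "int d"] cells_subset_skel[of "int d - 1" "int d"] by auto
  have low: "cells K (int d - 1 - 1) \<inter> \<Gamma> = cells K (int d - 1 - 1)"
    using \<Gamma> cells_subset_skel[of "int d - 2" "int d - 2"] by auto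
  have cyc: "rel_cycles K (int d - 1) (skel K (int d)) \<Gamma> = additive_group ?Z"
  proof -
    have "{c \<in> supported ridges. bdry K (int d - 1) c \<in> supported (cells K (int d - 1 - 1))} = ?Z"
      using bdry_supported by blast
    then show ?thesis
      unfolding rel_cycles_def additive_group_def chains_eq full low by (simp only:)
  qed
  have "rel_boundaries K (int d - 1) (skel K (int d)) \<Gamma> =
      {x + y |x y. x \<in> (bnd (int d) facets :: ('a set \<Rightarrow> int) set) \<and> y \<in> supported (ridges \<inter> \<Gamma>)}"
    by (auto simp: rel_boundaries_def chains_eq full bnd_def)
  also have "ridges \<inter> \<Gamma> = ridges - (ridges - \<Gamma>)" by auto
  finally have bnd: "rel_boundaries K (int d - 1) (skel K (int d)) \<Gamma> = ?B"
    unfolding C.row_lattice_def bnd_lattice[OF subset_refl] .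
  have "?B \<subseteq> ?Z"
  proof
    fix z assume "z \<in> ?B"
    then obtain x y where "z = x + y" "x \<in> int_lattice facets inc" "y \<in> supported (ridges - (ridges - \<Gamma>))"
      unfolding C.row_lattice_def by blast
    then show "z \<in> ?Z" using C.lattice_supported by (auto simp: supported_def)
  qed
  then have "torsion_order K (int d - 1) (skel K (int d)) \<Gamma> =
      coset_index {a \<in> ?Z. \<exists>m::nat. m > 0 \<and> (\<lambda>i. int m * a i) \<in> ?B} ?B"
    unfolding torsion_order_def Let_def cell_homology_def cyc bnd
    by (rule torsion_quotient[OF add_subgroup_supported C.add_subgroup_row_lattice])
  also have "{a \<in> ?Z. \<exists>m::nat. m > 0 \<and> (\<lambda>i. int m * a i) \<in> ?B} = ?Z"
    using coset_index_pos_imp_multiple[OF add_subgroup_supported C.add_subgroup_row_lattice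
        C.coset_index_row_lattice_pos[OF rb]] by blast
  finally show ?thesis .
qed

lemma relatively_acyclic_row_basis:
  assumes \<Gamma>: "skel K (int d - 2) \<subseteq> \<Gamma>" "\<Gamma> \<subseteq> skel K (int d - 1)"
  shows "relatively_acyclic K d \<Gamma> \<longleftrightarrow> C.row_basis (ridges - \<Gamma>)"
proof -
  have eq: "bdry K (int d) b = C.rat_comb b" for b
    by (simp add: bdry_def C.rat_comb_def fun_eq_iff)
  show ?thesis
    unfolding relatively_acyclic_iff[OF \<Gamma>] eq
  proof
    assume rb: "C.row_basis (ridges - \<Gamma>)"
    show "(\<forall>x. x \<in> supported ridges \<longrightarrow> (\<exists>b\<in>supported facets. \<forall>s\<in>ridges - \<Gamma>. x s = C.rat_comb b s)) \<and>
      (\<forall>b. b \<in> supported facets \<longrightarrow> (\<forall>s\<in>ridges - \<Gamma>. C.rat_comb b s = 0) \<longrightarrow> C.rat_comb b = 0)"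
    proof (intro conjI allI impI)
      show "\<exists>b\<in>supported facets. \<forall>s\<in>ridges - \<Gamma>. x s = C.rat_comb b s" for x
        by (rule C.row_basis_rat_onto[OF rb])
      fix b assume "\<forall>s\<in>ridges - \<Gamma>. C.rat_comb b s = 0"
      then have "C.rat_comb b x = 0" for x by (rule C.row_basis_rat_inj[OF rb])
      then show "C.rat_comb b = 0" by (simp add: fun_eq_iff)
    qed
  next
    assume *: "(\<forall>x. x \<in> supported ridges \<longrightarrow> (\<exists>b\<in>supported facets. \<forall>s\<in>ridges - \<Gamma>. x s = C.rat_comb b s)) \<and>
      (\<forall>b. b \<in> supported facets \<longrightarrow> (\<forall>s\<in>ridges - \<Gamma>. C.rat_comb b s = 0) \<longrightarrow> C.rat_comb b = 0)"
    show "C.row_basis (ridges - \<Gamma>)"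
    proof (rule C.row_basisI)
      show "\<exists>b\<in>supported facets. \<forall>s\<in>ridges - \<Gamma>. x s = C.rat_comb b s"
        if "x \<in> supported ridges" for x
        using * that by blast
      show "C.rat_comb b x = 0"
        if "b \<in> supported facets" "\<And>s. s \<in> ridges - \<Gamma> \<Longrightarrow> C.rat_comb b s = 0" for b x
      proof -
        have "C.rat_comb b = 0" using * that by blast
        then show ?thesis by simp
      qed
    qed auto
  qed
qed

text \<open>A row basis \<open>S\<close> corresponds to the (d-2)-skeleton together with the ridges
  off \<open>S\<close>. Of the two torsion factors of the forest in \<open>gram_index\<close>, one
  belongs to \<open>mu\<close>.\<close>

lemma gram_mu:
  "Determinant.det (mat (length \<Upsilon>) (length \<Upsilon>) (\<lambda>(a, b). \<Sum>x\<in>ridges. real_of_int (inc (\<Upsilon> ! a) x) * real_of_int (inc (\<Upsilon> ! b) x)))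
   = real (facet_torsion K d (set \<Upsilon>)) * mu K d (set \<Upsilon>)"
proof -
  have split: "skel K (int d - 1) = skel K (int d - 2) \<union> ridges"
    using skel_step[of "int d - 1"] by simp
  have disj: "ridges \<inter> skel K (int d - 2) = {}" by (rule cells_Int_skel) simp
  have "(\<Sum>S | C.row_basis S. (real (coset_index (supported ridges) (C.row_lattice S)))\<^sup>2 /
      (real (coset_index C.saturation (int_lattice facets inc)))\<^sup>2) =
    (\<Sum>\<Gamma> | relatively_acyclic K d \<Gamma>. (real (torsion_order K (int d - 1) (skel K (int d)) \<Gamma>))\<^sup>2 /
       (real (torsion_order K (int d - 1) (skel K (int d)) {}))\<^sup>2)"
  proof (rule sum.reindex_bij_witness[where j = "\<lambda>S. skel K (int d - 2) \<union> (ridges - S)" and i = "\<lambda>\<Gamma>. ridges - \<Gamma>"])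
    fix S assume "S \<in> {S. C.row_basis S}"
    then have S: "C.row_basis S" "S \<subseteq> ridges" by (auto simp: C.row_basis_def)
    then show eq: "ridges - (skel K (int d - 2) \<union> (ridges - S)) = S" using disj by blast
    have \<Gamma>: "skel K (int d - 2) \<subseteq> skel K (int d - 2) \<union> (ridges - S)"
      "skel K (int d - 2) \<union> (ridges - S) \<subseteq> skel K (int d - 1)" using split by auto
    then show "skel K (int d - 2) \<union> (ridges - S) \<in> {\<Gamma>. relatively_acyclic K d \<Gamma>}"
      using relatively_acyclic_row_basis[OF \<Gamma>] S(1) eq by simp
    show "(real (torsion_order K (int d - 1) (skel K (int d)) (skel K (int d - 2) \<union> (ridges - S))))\<^sup>2 /
         (real (torsion_order K (int d - 1) (skel K (int d)) {}))\<^sup>2 =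
       (real (coset_index (supported ridges) (C.row_lattice S)))\<^sup>2 /
         (real (coset_index C.saturation (int_lattice facets inc)))\<^sup>2"
      using pair_torsion_index[OF \<Gamma>] S(1) eq total_torsion_index by simp
  next
    fix \<Gamma> assume "\<Gamma> \<in> {\<Gamma>. relatively_acyclic K d \<Gamma>}"
    then have \<Gamma>: "relatively_acyclic K d \<Gamma>" "skel K (int d - 2) \<subseteq> \<Gamma>" "\<Gamma> \<subseteq> skel K (int d - 1)"
      by (auto simp: relatively_acyclic_def)
    then show "skel K (int d - 2) \<union> (ridges - (ridges - \<Gamma>)) = \<Gamma>" using split by blast
    show "ridges - \<Gamma> \<in> {S. C.row_basis S}" using relatively_acyclic_row_basis \<Gamma> by blast
  qed
  then show ?thesis
    unfolding C.gram_index facet_torsion_index mu_def by (simp add: power2_eq_square)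
qed

lemma mu_nonzero: "mu K d (set \<Upsilon>) \<noteq> 0" and facet_torsion_pos: "facet_torsion K d (set \<Upsilon>) > 0"
  using C.det_gram gram_mu C.coset_index_pos by (auto simp: facet_torsion_index)

end

context
  fixes \<Upsilon> :: "'a set list"
  assumes forest: "CSF K d (set \<Upsilon>)" and dist: "distinct \<Upsilon>"
begin

interpretation C: col_basis ridges facets inc \<Upsilon>
  by (rule CSF_col_basis[OF forest dist])

lemma facet_torsion_replace:
  assumes "CSF K d (set (\<Upsilon>[k := \<rho>]))" "distinct (\<Upsilon>[k := \<rho>])" "k < length \<Upsilon>"
    and c: "\<And>x. real_of_int (inc \<rho> x) = (\<Sum>i\<in>set \<Upsilon>. c i * real_of_int (inc i x))"
  shows "real (facet_torsion K d (set (\<Upsilon>[k := \<rho>]))) = \<bar>c (\<Upsilon> ! k)\<bar> * real (facet_torsion K d (set \<Upsilon>))"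
proof -
  interpret N: col_basis ridges facets inc "\<Upsilon>[k := \<rho>]"
    by (rule CSF_col_basis[OF assms(1,2)])
  have "facet_torsion K d (set (\<Upsilon>[k := \<rho>])) =
      coset_index C.saturation (int_lattice (set (\<Upsilon>[k := \<rho>])) inc)"
    using assms(1,2) by (rule facet_torsion_index)
  then show ?thesis
    using C.coset_index_replace[OF N.col_basis_axioms assms(3) c] facet_torsion_index[OF forest dist] by simp
qed

section \<open>The dual Laplacian and \<open>chi_bar\<close>\<close>

definition pairing :: "'a set \<Rightarrow> 'a set \<Rightarrow> real"
  where "pairing \<rho> \<rho>' = (\<Sum>x\<in>ridges. real_of_int (inc \<rho> x) * real_of_int (inc \<rho>' x))"

lemma laplacian_indicator:
  assumes "\<rho>' \<in> facets"
  shows "laplacian K d (indicat_real {\<rho>'}) \<rho> = (if \<rho> \<in> facets then pairing \<rho> \<rho>' else 0)"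
  using facet_col_eq[OF assms] by (simp add: laplacian_def facet_col_def[symmetric] cobdry_def pairing_def)

text \<open>All minors in \<open>chi_bar\<close> omit row \<open>k\<close>, so they are unaffected
  when that row of the Gram matrix is replaced by the pairings with \<open>\<rho>\<close>. The sum
  is then the Laplace expansion along this row.\<close>

lemma chi_bar_eq:
  assumes k: "k < length \<Upsilon>" and \<rho>: "\<rho> \<in> facets"
    and c: "\<And>x. real_of_int (inc \<rho> x) = (\<Sum>i\<in>set \<Upsilon>. c i * real_of_int (inc i x))"
  shows "chi_bar K d \<Upsilon> (\<Upsilon> ! k) \<rho> =
    (-1) ^ Suc k * (c (\<Upsilon> ! k) * (real (facet_torsion K d (set \<Upsilon>)) * mu K d (set \<Upsilon>)))"
proof -
  let ?r = "length \<Upsilon>"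
  have sub: "\<Upsilon> ! b \<in> facets" if "b < ?r" for b
    using that forest by (auto simp: CSF_def)
  let ?G = "mat ?r ?r (\<lambda>(a, b). pairing (\<Upsilon>[k := \<rho>] ! a) (\<Upsilon> ! b))"
  have G: "?G \<in> carrier_mat ?r ?r" by simp
  have rem_nth: "remove1 (\<Upsilon> ! b) \<Upsilon> ! a = \<Upsilon> ! (if a < b then a else Suc a)" if "b < ?r" "a < ?r - 1" for a b
    using that by (auto simp: remove1_nth[OF dist] nth_append min_def)
  have del: "mat_delete ?G k b = lap_submatrix K d (remove1 (\<Upsilon> ! k) \<Upsilon>) (remove1 (\<Upsilon> ! b) \<Upsilon>)"
    if b: "b < ?r" for b
  proof (rule eq_matI)
    fix i j assume "i < dim_row (lap_submatrix K d (remove1 (\<Upsilon> ! k) \<Upsilon>) (remove1 (\<Upsilon> ! b) \<Upsilon>))"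
      "j < dim_col (lap_submatrix K d (remove1 (\<Upsilon> ! k) \<Upsilon>) (remove1 (\<Upsilon> ! b) \<Upsilon>))"
    then have ij: "i < ?r - 1" "j < ?r - 1"
      using k b by (auto simp: lap_submatrix_def length_remove1)
    then show "mat_delete ?G k b $$ (i, j) = lap_submatrix K d (remove1 (\<Upsilon> ! k) \<Upsilon>) (remove1 (\<Upsilon> ! b) \<Upsilon>) $$ (i, j)"
      using k b by (auto simp: mat_delete_def lap_submatrix_def length_remove1 rem_nth laplacian_indicator sub)
  qed (use k b in \<open>auto simp: lap_submatrix_def length_remove1\<close>)
  have "chi_bar K d \<Upsilon> (\<Upsilon> ! k) \<rho> = (\<Sum>j = 1..?r. (-1) ^ j * Determinant.det (lap_submatrix K d (remove1 (\<Upsilon> ! k) \<Upsilon>)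
      (remove1 (\<Upsilon> ! (j - 1)) \<Upsilon>)) * laplacian K d (indicat_real {\<Upsilon> ! (j - 1)}) \<rho>)"
    by (simp add: chi_bar_def sum_fun_apply scaleR_fun_def)
  \<comment> \<open>The sum in \<open>chi_bar\<close> counts from 1 and lists count from 0, so index
    \<open>j\<close> means column \<open>j - 1\<close>.\<close>
  also have "\<dots> = (\<Sum>b<?r. (-1) ^ Suc b * Determinant.det (mat_delete ?G k b) * pairing \<rho> (\<Upsilon> ! b))"
    by (rule sum.reindex_bij_witness[where j = "\<lambda>j. j - 1" and i = Suc])
      (use sub \<rho> in \<open>auto simp: del laplacian_indicator\<close>)
  also have "\<dots> = (\<Sum>b<?r. (-1) ^ Suc k * (?G $$ (k, b) * cofactor ?G k b))"
  proof (rule sum.cong)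
    fix b assume b: "b \<in> {..<?r}"
    \<comment> \<open>The cofactor has sign (-1)^(k+b) and \<open>chi_bar\<close> has (-1)^(b+1);
      they differ by (-1)^(k+1), which is independent of \<open>b\<close> and survives as a global
      sign.\<close>
    have "(-1 :: real) ^ Suc k * (-1) ^ (k + b) = (-1) ^ Suc b"
      by (simp add: power_add flip: mult.assoc power_mult_distrib)
    then show "(-1) ^ Suc b * Determinant.det (mat_delete ?G k b) * pairing \<rho> (\<Upsilon> ! b) =
        (-1) ^ Suc k * (?G $$ (k, b) * cofactor ?G k b)"
      using b k by (simp add: cofactor_def mult_ac)
  qed simp
  also have "\<dots> = (-1) ^ Suc k * Determinant.det ?G"
    unfolding laplace_expansion_row[OF G k] by (rule sum_distrib_left[symmetric])
  also have "Determinant.det ?G = c (\<Upsilon> ! k) * (real (facet_torsion K d (set \<Upsilon>)) * mu K d (set \<Upsilon>))"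
    using C.gram_replace[OF k c] gram_mu[OF forest dist] by (simp add: pairing_def)
  finally show ?thesis .
qed

end

end

section \<open>Bonds\<close>

lemma sum_indicator:
  assumes "finite B"
  shows "(\<Sum>\<rho>\<in>B. c \<rho> *\<^sub>R indicat_real {\<rho>}) \<rho>' = (if \<rho>' \<in> B then c \<rho>' else 0)"
  using assms by (simp add: sum_fun_apply scaleR_fun_def indicator_def if_distrib[of "times _"] cong: if_cong)

lemma scaleR_fun_apply: "(a *\<^sub>R f) x = a *\<^sub>R f x"
  by (simp add: scaleR_fun_def)

text \<open>Modulo the hyperplane the point of the segment with parameter \<open>u\<close> is
  \<open>1 - u + u * l\<close> times the column of \<open>\<sigma>\<close>. For nonzero
  \<open>l\<close> this factor has a zero in [0,1], namely 1/(1-l), exactly when \<open>l\<close> is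
  negative.\<close>

lemma side_sign_eq_sgn:
  assumes l: "facet_col K d \<rho> - l *\<^sub>R facet_col K d \<sigma> \<in> span (facet_col K d ` A)" "l \<noteq> 0"
    and \<sigma>: "facet_col K d \<sigma> \<notin> span (facet_col K d ` A)"
  shows "side_sign K d A \<sigma> \<rho> = sgn l"
proof -
  let ?x = "facet_col K d" and ?W = "span (facet_col K d ` A)"
  have mem: "(1 - u) *\<^sub>R ?x \<sigma> + u *\<^sub>R ?x \<rho> \<in> ?W \<longleftrightarrow> 1 - u + u * l = 0" for u
  proof -
    have eq: "(1 - u) *\<^sub>R ?x \<sigma> + u *\<^sub>R ?x \<rho> = (1 - u + u * l) *\<^sub>R ?x \<sigma> + u *\<^sub>R (?x \<rho> - l *\<^sub>R ?x \<sigma>)"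
      by (simp add: algebra_simps)
    have w: "u *\<^sub>R (?x \<rho> - l *\<^sub>R ?x \<sigma>) \<in> ?W" using l(1) by (rule span_scale)
    have "(1 - u) *\<^sub>R ?x \<sigma> + u *\<^sub>R ?x \<rho> \<in> ?W \<longleftrightarrow> (1 - u + u * l) *\<^sub>R ?x \<sigma> \<in> ?W"
      unfolding eq using span_add_eq2[OF w] by simp
    also have "\<dots> \<longleftrightarrow> 1 - u + u * l = 0"
    proof
      assume "(1 - u + u * l) *\<^sub>R ?x \<sigma> \<in> ?W"
      then have "inverse (1 - u + u * l) *\<^sub>R ((1 - u + u * l) *\<^sub>R ?x \<sigma>) \<in> ?W" by (rule span_scale)
      then show "1 - u + u * l = 0" using \<sigma> by (cases "1 - u + u * l = 0") auto
    qed (simp add: span_zero)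
    finally show ?thesis .
  qed
  have "closed_segment (?x \<sigma>) (?x \<rho>) \<inter> ?W = {} \<longleftrightarrow> \<not> (\<exists>u. 0 \<le> u \<and> u \<le> 1 \<and> 1 - u + u * l = 0)"
    using mem by (auto simp: closed_segment_def)
  also have "\<dots> \<longleftrightarrow> l > 0"
  proof (cases "l > 0")
    case True
    have "1 - u + u * l \<noteq> 0" if "0 \<le> u" "u \<le> 1" for u
    proof (cases "u = 0")
      case False
      then have "u * l > 0" using that True by simp
      then show ?thesis using that by linarith
    qed simp
    then show ?thesis using True by auto
  next
    case False
    then have "0 \<le> 1 / (1 - l)" "1 / (1 - l) \<le> 1" "1 - 1 / (1 - l) + 1 / (1 - l) * l = 0"
      using l(2) by (auto simp: field_simps)
    then show ?thesis using False by blast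
  qed
  finally show ?thesis using l(2) by (simp add: side_sign_def sgn_if)
qed

context finite_CW
begin

abbreviation hyp :: "'a set set \<Rightarrow> ('a set \<Rightarrow> real) set" where "hyp A \<equiv> span (facet_col K d ` A)"

lemma CSF_card: 
  assumes "CSF K d \<Upsilon>" shows "card \<Upsilon> = bdry_rank K d"
proof -
  have "dim (facet_col K d ` facets) = card (facet_col K d ` \<Upsilon>)"
    using assms by (intro real_vector.dim_eq_card) (auto simp: CSF_def indep_cols_def)
  then show ?thesis
    using assms by (simp add: bdry_rank_def CSF_def indep_cols_def card_image)
qed

text \<open>An independent set of as many columns as the rank spans: a column outside its span would
  give one independent vector too many.\<close>

lemma CSF_insert:
  assumes A: "A \<subseteq> facets" "indep_cols K d A" "card A + 1 = bdry_rank K d"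
    and \<rho>: "\<rho> \<in> facets" "facet_col K d \<rho> \<notin> hyp A"
  shows "CSF K d (insert \<rho> A)"
proof -
  let ?x = "facet_col K d" and ?S = "facet_col K d ` insert \<rho> A"
  have notin: "?x \<rho> \<notin> ?x ` A" using \<rho>(2) span_base[of "?x \<rho>" "?x ` A"] by blast
  have inj: "inj_on ?x (insert \<rho> A)" using A(2) notin by (auto simp: indep_cols_def)
  have ind: "independent ?S"
    unfolding image_insert
    by (rule real_vector.independent_insertI[OF \<rho>(2)]) (use A(2) in \<open>simp add: indep_cols_def\<close>)
  have finA: "finite A" using A(1) finite_cells by (rule finite_subset)
  have "\<rho> \<notin> A" using notin by blast
  then have card: "card ?S = bdry_rank K d" using A(3) finA card_image[OF inj] by simp
  obtain B where B: "B \<subseteq> ?x ` facets" "?x ` facets \<subseteq> span B" "card B = bdry_rank K d"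
    using real_vector.basis_exists[of "?x ` facets"] unfolding bdry_rank_def by metis
  have finB: "finite B" using B(1) finite_cells by (meson finite_imageI finite_subset)
  have sub: "?S \<subseteq> ?x ` facets" using A(1) \<rho>(1) by blast
  have "y \<in> span ?S" if y: "y \<in> ?x ` facets" for y
  proof (rule ccontr)
    assume n: "y \<notin> span ?S"
    then have "independent (insert y ?S)" using ind by (rule real_vector.independent_insertI)
    moreover have "insert y ?S \<subseteq> span B" using y sub B(2) by blast
    ultimately have "card (insert y ?S) \<le> card B"
      using real_vector.independent_span_bound[OF finB] by blast
    moreover have "y \<notin> ?S" using n span_base[of y ?S] by blast
    ultimately show False using card B(3) finA by simp
  qed
  then have "span (?x ` facets) \<subseteq> span ?S" by (intro span_minimal subspace_span) auto
  moreover have "span ?S \<subseteq> span (?x ` facets)" by (rule span_mono[OF sub])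
  ultimately show ?thesis
    using A(1) \<rho>(1) inj ind by (auto simp: CSF_def indep_cols_def)
qed

lemma CSF_coordinate:
  assumes "CSF K d (insert \<sigma> A)" "\<rho> \<in> facets"
  obtains l where "facet_col K d \<rho> - l *\<^sub>R facet_col K d \<sigma> \<in> hyp A"
proof -
  have "facet_col K d \<rho> \<in> span (facet_col K d ` insert \<sigma> A)"
    using assms by (auto simp: CSF_def intro: span_base)
  then show ?thesis using that by (auto simp: span_breakdown_eq)
qed

context
  fixes A B :: "'a set set"
  assumes bond: "is_bond K d B" and A_sub: "A \<subseteq> facets - B"
    and A_card: "card A + 1 = bdry_rank K d" and A_indep: "indep_cols K d A"
begin

lemma A_facets: "A \<subseteq> facets" and B_facets: "B \<subseteq> facets"
  using A_sub bond by (auto simp: is_bond_def)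

text \<open>Off the hyperplane, \<open>A\<close> with \<open>\<rho>\<close> is a forest and must
  meet \<open>B\<close>, which \<open>A\<close> avoids. Conversely, minimality gives a forest
  meeting \<open>B\<close> at most in \<open>\<rho>\<close>; by the first argument its other facets
  lie in the hyperplane, and with \<open>\<rho>\<close> there too the hyperplane would have too
  large a dimension.\<close>

lemma mem_bond_iff:
  assumes \<rho>: "\<rho> \<in> facets" shows "\<rho> \<in> B \<longleftrightarrow> facet_col K d \<rho> \<notin> hyp A"
proof
  assume "facet_col K d \<rho> \<notin> hyp A"
  then have "CSF K d (insert \<rho> A)" by (intro CSF_insert A_facets A_indep A_card \<rho>)
  then have "B \<inter> insert \<rho> A \<noteq> {}" using bond by (auto simp: is_bond_def meets_all_CSF_def)
  then show "\<rho> \<in> B" using A_sub by blast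
next
  assume \<rho>B: "\<rho> \<in> B"
  then have "B - {\<rho>} \<subset> B" by blast
  then have "\<not> meets_all_CSF K d (B - {\<rho>})"
    using bond by (simp add: is_bond_def)
  then obtain \<Upsilon> where \<Upsilon>: "CSF K d \<Upsilon>" "(B - {\<rho>}) \<inter> \<Upsilon> = {}"
    by (auto simp: meets_all_CSF_def)
  have out: "facet_col K d \<tau> \<in> hyp A" if "\<tau> \<in> \<Upsilon>" "\<tau> \<noteq> \<rho>" for \<tau>
  proof (rule ccontr)
    assume "facet_col K d \<tau> \<notin> hyp A"
    moreover have "\<tau> \<in> facets" using that \<Upsilon>(1) by (auto simp: CSF_def)
    ultimately have "CSF K d (insert \<tau> A)" by (intro CSF_insert A_facets A_indep A_card)
    then have "B \<inter> insert \<tau> A \<noteq> {}" using bond by (auto simp: is_bond_def meets_all_CSF_def)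
    then show False using A_sub \<Upsilon>(2) that by blast
  qed
  show "facet_col K d \<rho> \<notin> hyp A"
  proof
    assume "facet_col K d \<rho> \<in> hyp A"
    then have "facet_col K d ` \<Upsilon> \<subseteq> hyp A" using out by auto
    moreover have "finite (facet_col K d ` A)" using A_facets finite_cells by (meson finite_imageI finite_subset)
    moreover have "independent (facet_col K d ` \<Upsilon>)" using \<Upsilon>(1) by (simp add: CSF_def indep_cols_def)
    ultimately have "card (facet_col K d ` \<Upsilon>) \<le> card (facet_col K d ` A)"
      using real_vector.independent_span_bound by blast
    also have "\<dots> \<le> card A" using A_facets finite_cells by (meson card_image_le finite_subset)
    finally have "card \<Upsilon> \<le> card A"
      using \<Upsilon>(1) by (simp add: CSF_def indep_cols_def card_image)
    then show False using CSF_card[OF \<Upsilon>(1)] A_card by simp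
  qed
qed

lemma bond_CSF: "\<rho> \<in> B \<Longrightarrow> CSF K d (insert \<rho> A)"
  using mem_bond_iff B_facets by (intro CSF_insert A_facets A_indep A_card) auto

lemma bond_fund_bond:
  assumes \<rho>: "\<rho> \<in> B" shows "B = fund_bond K d (insert \<rho> A) \<rho>"
proof -
  have \<rho>A: "\<rho> \<notin> A" using \<rho> A_sub by blast
  have "\<tau> \<in> B \<longleftrightarrow> CSF K d (insert \<tau> A)" if \<tau>: "\<tau> \<in> facets" "\<tau> \<notin> A" for \<tau>
  proof
    assume C: "CSF K d (insert \<tau> A)"
    then have "inj_on (facet_col K d) (insert \<tau> A)" by (simp add: CSF_def indep_cols_def)
    then have "facet_col K d \<tau> \<notin> facet_col K d ` A" using \<tau>(2) by auto
    moreover have "independent (insert (facet_col K d \<tau>) (facet_col K d ` A))"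
      using C by (simp add: CSF_def indep_cols_def)
    ultimately have "facet_col K d \<tau> \<notin> hyp A"
      by (simp add: real_vector.independent_insert)
    then show "\<tau> \<in> B" using mem_bond_iff \<tau>(1) by blast
  qed (rule bond_CSF)
  moreover have "insert \<rho> A - {\<rho>} = A" using \<rho>A by blast
  ultimately show ?thesis
    using \<rho> A_sub B_facets unfolding fund_bond_def by auto
qed

lemma bond_coordinate:
  assumes "\<sigma> \<in> B" "\<rho> \<in> B"
  obtains l where "l \<noteq> 0" "facet_col K d \<rho> - l *\<^sub>R facet_col K d \<sigma> \<in> hyp A"
proof -
  obtain l where l: "facet_col K d \<rho> - l *\<^sub>R facet_col K d \<sigma> \<in> hyp A"
    using CSF_coordinate[OF bond_CSF[OF assms(1)]] assms(2) B_facets by blast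
  moreover have "l \<noteq> 0" using l assms(2) mem_bond_iff[of \<rho>] B_facets by auto
  ultimately show ?thesis using that by blast
qed

lemma chi_bar_bond:
  assumes \<sigma>: "\<sigma> \<in> B" and \<Upsilon>: "distinct \<Upsilon>" "set \<Upsilon> = insert \<sigma> A" and k: "k < length \<Upsilon>" "\<Upsilon> ! k = \<sigma>"
  shows "(1 / mu K d (set \<Upsilon>)) *\<^sub>R chi_bar K d \<Upsilon> \<sigma> =
    (-1) ^ Suc k *\<^sub>R (\<Sum>\<rho>\<in>B. (side_sign K d A \<sigma> \<rho> * real (facet_torsion K d (insert \<rho> A))) *\<^sub>R indicat_real {\<rho>})"
    (is "_ = _ *\<^sub>R ?W")
proof
  fix \<rho>
  have finB: "finite B" using B_facets finite_cells by (rule finite_subset)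
  have C: "CSF K d (set \<Upsilon>)" using bond_CSF[OF \<sigma>] \<Upsilon>(2) by simp
  interpret C: col_basis ridges facets inc \<Upsilon> by (rule CSF_col_basis[OF C \<Upsilon>(1)])
  have \<sigma>A: "\<sigma> \<notin> A" "\<sigma> \<in> facets" using \<sigma> A_sub B_facets by auto
  show "((1 / mu K d (set \<Upsilon>)) *\<^sub>R chi_bar K d \<Upsilon> \<sigma>) \<rho> = ((-1) ^ Suc k *\<^sub>R ?W) \<rho>"
  proof (cases "\<rho> \<in> facets")
    \<comment> \<open>Chains are total functions, so the vectors are also compared off the facets,
      where both vanish.\<close>
    case False
    have "laplacian K d (indicat_real {\<Upsilon> ! (j - 1)}) \<rho> = 0" for j
      using False by (simp add: laplacian_def cobdry_def)
    then have "chi_bar K d \<Upsilon> \<sigma> \<rho> = 0"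
      by (simp add: chi_bar_def sum_fun_apply scaleR_fun_def)
    moreover have "?W \<rho> = 0" using False B_facets finB by (subst sum_indicator) auto
    ultimately show ?thesis by (simp add: scaleR_fun_def)
  next
    case True
    obtain c where c: "\<And>x. real_of_int (inc \<rho> x) = (\<Sum>i\<in>set \<Upsilon>. c i * real_of_int (inc i x))"
      using C.basis_span[OF True] by blast
    have "facet_col K d \<rho> = (\<Sum>i\<in>insert \<sigma> A. c i *\<^sub>R facet_col K d i)"
      using c \<sigma>A A_facets True by (subst sum_facet_col) (auto simp: facet_col_eq \<Upsilon>(2))
    moreover have "finite A" using A_facets finite_cells by (rule finite_subset)
    ultimately have "facet_col K d \<rho> - c \<sigma> *\<^sub>R facet_col K d \<sigma> = (\<Sum>i\<in>A. c i *\<^sub>R facet_col K d i)"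
      using \<sigma>A by simp
    then have l: "facet_col K d \<rho> - c \<sigma> *\<^sub>R facet_col K d \<sigma> \<in> hyp A"
      by (auto intro: span_sum span_scale span_base)
    \<comment> \<open>On the bond the sign of \<open>c \<sigma>\<close> is the side and its absolute
      value the ratio of torsion orders; off the bond \<open>c \<sigma>\<close> is zero.\<close>
    have W: "?W \<rho> = c \<sigma> * real (facet_torsion K d (set \<Upsilon>))"
    proof (cases "\<rho> \<in> B")
      case \<rho>B: True
      have "c \<sigma> \<noteq> 0" using l \<rho>B mem_bond_iff[OF True] by auto
      then have sgn: "side_sign K d A \<sigma> \<rho> = sgn (c \<sigma>)"
        using l mem_bond_iff[OF \<sigma>A(2)] \<sigma> by (intro side_sign_eq_sgn) auto
      have set: "set (\<Upsilon>[k := \<rho>]) = insert \<rho> A"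
        using set_update_distinct[OF \<Upsilon>(1) k(1)] k(2) \<Upsilon>(2) \<sigma>A by auto
      have "\<rho> \<notin> A" using \<rho>B A_sub by blast
      then have "distinct (\<Upsilon>[k := \<rho>])"
        using \<Upsilon> k by (intro distinct_list_update) auto
      then have "real (facet_torsion K d (insert \<rho> A)) = \<bar>c \<sigma>\<bar> * real (facet_torsion K d (set \<Upsilon>))"
        using facet_torsion_replace[OF C \<Upsilon>(1) _ _ k(1) c] bond_CSF[OF \<rho>B] k(2) by (simp add: set)
      then show ?thesis
        using \<rho>B finB by (simp add: sum_indicator sgn) (simp add: sgn_if)
    next
      case False
      then have "facet_col K d \<rho> \<in> hyp A" using mem_bond_iff[OF True] by blast
      then have "facet_col K d \<rho> - (facet_col K d \<rho> - c \<sigma> *\<^sub>R facet_col K d \<sigma>) \<in> hyp A"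
        using l by (rule span_diff)
      then have "c \<sigma> *\<^sub>R facet_col K d \<sigma> \<in> hyp A" by simp
      then have "inverse (c \<sigma>) *\<^sub>R (c \<sigma> *\<^sub>R facet_col K d \<sigma>) \<in> hyp A" by (rule span_scale)
      then have "c \<sigma> = 0" using mem_bond_iff[OF \<sigma>A(2)] \<sigma> by (cases "c \<sigma> = 0") auto
      then show ?thesis using False finB by (simp add: sum_indicator)
    qed
    show ?thesis
      using chi_bar_eq[OF C \<Upsilon>(1) k(1) True c] mu_nonzero[OF C \<Upsilon>(1)]
      by (simp add: k(2) W scaleR_fun_apply)
  qed
qed

text \<open>Modulo the hyperplane all columns are multiples of that of \<open>\<sigma>\<close>;
  passing to \<open>\<sigma>'\<close> divides every coordinate by the same nonzero number, so all
  signs change together.\<close>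

lemma side_sign_change:
  assumes "\<sigma> \<in> B" "\<sigma>' \<in> B"
  obtains s where "s = 1 \<or> s = -1" "\<And>\<rho>. \<rho> \<in> B \<Longrightarrow> side_sign K d A \<sigma>' \<rho> = s * side_sign K d A \<sigma> \<rho>"
proof -
  obtain l' where l': "l' \<noteq> 0" "facet_col K d \<sigma>' - l' *\<^sub>R facet_col K d \<sigma> \<in> hyp A"
    using bond_coordinate[OF assms] .
  have out: "facet_col K d \<tau> \<notin> hyp A" if "\<tau> \<in> B" for \<tau> using that mem_bond_iff B_facets by blast
  have "side_sign K d A \<sigma>' \<rho> = sgn l' * side_sign K d A \<sigma> \<rho>" if \<rho>: "\<rho> \<in> B" for \<rho>
  proof -
    obtain l where l: "l \<noteq> 0" "facet_col K d \<rho> - l *\<^sub>R facet_col K d \<sigma> \<in> hyp A"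
      using bond_coordinate[OF assms(1) \<rho>] .
    have "(facet_col K d \<rho> - l *\<^sub>R facet_col K d \<sigma>) - (l / l') *\<^sub>R (facet_col K d \<sigma>' - l' *\<^sub>R facet_col K d \<sigma>) \<in> hyp A"
      by (rule span_diff[OF l(2) span_scale[OF l'(2)]])
    then have "facet_col K d \<rho> - (l / l') *\<^sub>R facet_col K d \<sigma>' \<in> hyp A"
      using l'(1) by (simp add: algebra_simps)
    then have "side_sign K d A \<sigma>' \<rho> = sgn (l / l')"
      using l(1) l'(1) out assms(2) by (intro side_sign_eq_sgn) auto
    moreover have "side_sign K d A \<sigma> \<rho> = sgn l"
      using l out assms(1) by (intro side_sign_eq_sgn) auto
    moreover have "sgn (l / l') = sgn l' * sgn l" using l'(1) by (cases "l' > 0") (simp_all add: sgn_divide)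
    ultimately show ?thesis by simp
  qed
  then show ?thesis using that[of "sgn l'"] l'(1) by (auto simp: sgn_if)
qed

end

text \<open>A combination of Laplacians is the coboundary of the same combination of boundaries,
  which is the witness \<open>y\<close>.\<close>

lemma chi_bar_cut_space: "a *\<^sub>R chi_bar K d \<Upsilon> \<sigma> \<in> cut_space K d"
proof -
  let ?J = "{1..length \<Upsilon>}"
  define w where "w j = (-1) ^ j * Determinant.det (lap_submatrix K d (remove1 \<sigma> \<Upsilon>) (remove1 (\<Upsilon> ! (j - 1)) \<Upsilon>))" for j
  define y where "y \<tau> = (\<Sum>j\<in>?J. a * w j * bdry K (int d) (indicat_real {\<Upsilon> ! (j - 1)}) \<tau>)" for \<tau>
  have "cobdry K (int d) y \<rho> = (a *\<^sub>R chi_bar K d \<Upsilon> \<sigma>) \<rho>" for \<rho>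
  proof (cases "\<rho> \<in> facets")
    case True
    have "cobdry K (int d) y \<rho> = (\<Sum>\<tau>\<in>ridges. \<Sum>j\<in>?J. real_of_int (inc \<rho> \<tau>) * (a * w j * bdry K (int d) (indicat_real {\<Upsilon> ! (j - 1)}) \<tau>))"
      using True by (simp add: cobdry_def y_def sum_distrib_left)
    also have "\<dots> = (\<Sum>j\<in>?J. a * w j * laplacian K d (indicat_real {\<Upsilon> ! (j - 1)}) \<rho>)"
      using True by (subst sum.swap) (simp add: laplacian_def cobdry_def sum_distrib_left mult_ac)
    finally show ?thesis
      by (simp add: chi_bar_def sum_fun_apply scaleR_fun_def w_def sum_distrib_left mult_ac)
  qed (simp add: cobdry_def chi_bar_def sum_fun_apply scaleR_fun_def laplacian_def)
  then have "a *\<^sub>R chi_bar K d \<Upsilon> \<sigma> = cobdry K (int d) y" by (simp add: fun_eq_iff)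
  moreover have "y \<in> chains K (int d - 1) (skel K (int d))"
  proof -
    have "bdry K (int d) c \<tau> = 0" if "\<tau> \<notin> ridges" for c :: "'a set \<Rightarrow> real" and \<tau>
      using bdry_supported[of "int d" c] that by (simp add: supported_def)
    moreover have "ridges \<inter> skel K (int d) = ridges"
      using cells_subset_skel[of "int d - 1" "int d"] by auto
    ultimately show ?thesis by (simp add: chains_eq y_def supported_def)
  qed
  ultimately show ?thesis by (auto simp: cut_space_def)
qed

end

theorem theorem4p10:
  fixes K :: "'a cell_structure" and d i :: nat
    and A B :: "'a set set" and \<sigma> :: "'a set" and \<Upsilon> :: "'a set list"
  assumes cw: "finite_CW_complex K d"
    and bond: "is_bond K d B"
    and A_sub: "A \<subseteq> cells K d - B"
    and A_card: "card A + 1 = bdry_rank K d"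
    and A_indep: "indep_cols K d A"
    and \<sigma>: "\<sigma> \<in> B"
    and \<Upsilon>: "distinct \<Upsilon>" "set \<Upsilon> = insert \<sigma> A"
    and i: "i \<in> {1..length \<Upsilon>}" "\<Upsilon> ! (i - 1) = \<sigma>"
  shows "(\<forall>\<rho>\<in>B. CSF K d (insert \<rho> A) \<and> B = fund_bond K d (insert \<rho> A) \<rho>) \<and>
    (1 / mu K d (set \<Upsilon>)) *\<^sub>R chi_bar K d \<Upsilon> \<sigma> =
      (-1) ^ i *\<^sub>R (\<Sum>\<rho>\<in>B. (side_sign K d A \<sigma> \<rho> * real (facet_torsion K d (insert \<rho> A)))
                       *\<^sub>R indicat_real {\<rho>}) \<and>
    (1 / mu K d (set \<Upsilon>)) *\<^sub>R chi_bar K d \<Upsilon> \<sigma> \<in> cut_space K d \<and>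
    (\<forall>\<rho>. ((1 / mu K d (set \<Upsilon>)) *\<^sub>R chi_bar K d \<Upsilon> \<sigma>) \<rho> \<in> \<int>) \<and>
    (\<forall>\<sigma>'\<in>B. \<forall>\<Upsilon>'. distinct \<Upsilon>' \<and> set \<Upsilon>' = insert \<sigma>' A \<longrightarrow>
       (1 / mu K d (set \<Upsilon>')) *\<^sub>R chi_bar K d \<Upsilon>' \<sigma>'
         \<in> {(1 / mu K d (set \<Upsilon>)) *\<^sub>R chi_bar K d \<Upsilon> \<sigma>,
            - ((1 / mu K d (set \<Upsilon>)) *\<^sub>R chi_bar K d \<Upsilon> \<sigma>)})"
proof (intro conjI ballI allI impI)
  interpret finite_CW K d by unfold_locales (rule cw)
  note hyps = bond A_sub A_card A_indep
  let ?v = "\<lambda>\<Upsilon> \<sigma>. (1 / mu K d (set \<Upsilon>)) *\<^sub>R chi_bar K d \<Upsilon> \<sigma>"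
  let ?W = "\<lambda>\<sigma>. \<Sum>\<rho>\<in>B. (side_sign K d A \<sigma> \<rho> * real (facet_torsion K d (insert \<rho> A))) *\<^sub>R indicat_real {\<rho>}"
  have finB: "finite B" using B_facets[OF hyps] finite_cells by (rule finite_subset)
  show "CSF K d (insert \<rho> A)" "B = fund_bond K d (insert \<rho> A) \<rho>" if "\<rho> \<in> B" for \<rho>
    using bond_CSF[OF hyps that] bond_fund_bond[OF hyps that] by auto
  \<comment> \<open>The theorem counts positions from 1, \<open>chi_bar_bond\<close> from 0.\<close>
  have "Suc (i - 1) = i" "i - 1 < length \<Upsilon>" using i(1) by auto
  then show eq: "?v \<Upsilon> \<sigma> = (-1) ^ i *\<^sub>R ?W \<sigma>"
    using chi_bar_bond[OF hyps \<sigma> \<Upsilon> _ i(2)] by simp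
  show "?v \<Upsilon> \<sigma> \<in> cut_space K d" by (rule chi_bar_cut_space)
  \<comment> \<open>Integrality is read off the other side of the identity, whose coefficients are
    torsion orders with signs.\<close>
  show "?v \<Upsilon> \<sigma> \<rho> \<in> \<int>" for \<rho>
    unfolding eq using finB
    by (simp add: scaleR_fun_apply sum_indicator) (simp add: side_sign_def)
  fix \<sigma>' \<Upsilon>'
  assume \<sigma>': "\<sigma>' \<in> B" and \<Upsilon>': "distinct \<Upsilon>' \<and> set \<Upsilon>' = insert \<sigma>' A"
  then obtain k where k: "k < length \<Upsilon>'" "\<Upsilon>' ! k = \<sigma>'" by (metis in_set_conv_nth insertI1)
  have eq': "?v \<Upsilon>' \<sigma>' = (-1) ^ Suc k *\<^sub>R ?W \<sigma>'"
    using chi_bar_bond[OF hyps \<sigma>' _ _ k] \<Upsilon>' by blast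
  obtain s where s: "s = 1 \<or> s = -1" "\<And>\<rho>. \<rho> \<in> B \<Longrightarrow> side_sign K d A \<sigma>' \<rho> = s * side_sign K d A \<sigma> \<rho>"
    using side_sign_change[OF hyps \<sigma> \<sigma>'] by blast
  \<comment> \<open>The torsion orders in the sum do not involve the base facet; only the side signs
    change, all by \<open>s\<close>. The position of \<open>\<sigma>'\<close> in its list
    contributes a further sign.\<close>
  have "?W \<sigma>' = s *\<^sub>R ?W \<sigma>"
    unfolding scaleR_sum_right by (rule sum.cong) (simp_all add: s(2) mult.assoc)
  then have "?v \<Upsilon>' \<sigma>' = ((-1) ^ Suc k * s) *\<^sub>R ?W \<sigma>" unfolding eq' by simp
  moreover have "(-1 :: real) ^ Suc k * s \<in> {(-1) ^ i, - ((-1) ^ i)}"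
    using s(1) minus_one_power_iff[of "Suc k", where 'a = real] minus_one_power_iff[of i, where 'a = real] by auto
  ultimately show "?v \<Upsilon>' \<sigma>' \<in> {?v \<Upsilon> \<sigma>, - ?v \<Upsilon> \<sigma>}"
    unfolding eq by (auto simp flip: scaleR_minus_left)
qed

end
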